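(* Let $X\in\mathrm{Dom}(D)$ be such that $\mathbb E[X]=0$, and write $$T_X:=\langle D_\cdot X,\mathbb E[D_\cdot X\mid\tilde{\mathcal F}_\cdot]\rangle=\int_0^\infty D_tX\,\mathbb E[D_tX\mid\tilde{\mathcal F}_t]\,dt .$$ Then $$d_W(X,\mathcal N)\le\frac12\|2-T_X\|_{L^2(\Omega)}\le |1-\mathbb E[X^2]|+\frac12\|T_X-\mathbb E[T_X]\|_{L^2(\Omega)},$$ and $$d_{TV}(X,\mathcal N)\le\|2-T_X\|_{L^2(\Omega)}\le 2|1-\mathbb E[X^2]|+\|T_X-\mathbb E[T_X]\|_{L^2(\Omega)}.$$ If moreover $\nu>0$ and $X$ is a.s. $(-\nu,\infty)$-valued, then $$d_{\mathcal H}(X,\Gamma_\nu)\le\Big\|2(X+\nu)-\frac12T_X\Big\|_{L^2(\Omega)}\le\Big\|2(X+\nu)-\|X\|^2_{L^2(\Omega)}\Big\|_{L^2(\Omega)}+\|T_X-\mathbb E[T_X]\|_{L^2(\Omega)}.$$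
   Context: $\mathbb{N}=\{0,1,2,\ldots\}$ and $\mathbb{R}_+=[0,\infty)$. $(U_k)_{k\in\mathbb N}$ is an i.i.d. sequence of random variables uniformly distributed on $[-1,1]$; $Y_t:=\sum_{k=0}^\infty \mathbf 1_{[2k+1+U_k,\infty)}(t)$, $t\in\mathbb{R}_+$; $(\mathcal F_t)_{t\ge 0}$ is the filtration generated by $(Y_t)_{t\ge0}$, and $\tilde{\mathcal F}_t:=\mathcal F_{2k}$ for $2k\le t<2k+2$, $k\in\mathbb N$. For $X=f(U_0,\ldots,U_n)$ with $f\in\mathcal C^1_b([-1,1]^{n+1})$, the gradient is $$D_tX:=\sum_{k=0}^n \partial_kf(U_0,\ldots,U_n)\Big((1-U_k)\mathbf 1_{(2k,2k+1+U_k]}(t)-(1+U_k)\mathbf 1_{(2k+1+U_k,2k+2]}(t)\Big),\quad t\in\mathbb R_+,$$ where $\partial_k$ is the partial derivative with respect to the variable evaluated at $U_k$. $D$ is closable as an operator from $L^2(\Omega)$ to $L^2(\Omega\times\mathbb R_+)$, and $\mathrm{Dom}(D)$ denotes the domain of its closure, still denoted by $D$. $\langle\cdot,\cdot\rangle$ is the inner product of $L^2(\mathbb R_+)$. $\mathcal N$ is a standard normal random variable. $\Gamma_\nu:=2\Gamma(\nu/2)-\nu$, where $\Gamma(\nu/2)$ is a gamma random variable with parameters $(\nu/2,1)$. Distances: $d_W(X,Y)=\sup_{h}|\mathbb E[h(X)]-\mathbb E[h(Y)]|$ over Lipschitz functions $h:\mathbb R\to\mathbb R$ with Lipschitz constant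 at most $1$; $d_{TV}(X,Y)=\sup_{A}|\mathbb P(X\in A)-\mathbb P(Y\in A)|$ over Borel sets $A\subset\mathbb R$; $d_{\mathcal H}(X,Y)=\sup_{h\in\mathcal H}|\mathbb E[h(X)]-\mathbb E[h(Y)]|$ with $\mathcal H=\{h\in\mathcal C^2_b(\mathbb R):\max(\|h\|_\infty,\|h'\|_\infty,\|h''\|_\infty)\le1\}$. Norms on the right-hand sides may be $+\infty$. *)

theory Defs
  imports "HOL-Probability.Probability"
begin

section \<open>Norms and probability distances\<close>

text \<open>The \<open>L\<^sup>2\<close>-norm as an extended number: it is \<open>\<infinity>\<close> for a measurable function
  that is not square integrable.\<close>

definition L2norm :: "'a measure \<Rightarrow> ('a \<Rightarrow> real) \<Rightarrow> ennreal" where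
  "L2norm M f =
     (let I = (\<integral>\<^sup>+x. ennreal ((f x)\<^sup>2) \<partial>M)
      in if I = \<infinity> then \<infinity> else ennreal (sqrt (enn2real I)))"

definition in_L2 :: "'a measure \<Rightarrow> ('a \<Rightarrow> real) \<Rightarrow> bool" where
  "in_L2 M f \<longleftrightarrow> f \<in> borel_measurable M \<and> L2norm M f < \<infinity>"

text \<open>Distances between real random variables \<open>X\<close> on \<open>P\<close> and \<open>Y\<close> on \<open>Q\<close>; the two
  probability spaces may differ, since only the laws matter.\<close>

definition dist_class :: "(real \<Rightarrow> real) set \<Rightarrow> 'a measure \<Rightarrow> ('a \<Rightarrow> real) \<Rightarrow>
    'b measure \<Rightarrow> ('b \<Rightarrow> real) \<Rightarrow> ennreal" where
  "dist_class \<H> P X Q Y =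
     (SUP h\<in>\<H>. ennreal \<bar>(LINT x|P. h (X x)) - (LINT y|Q. h (Y y))\<bar>)"

definition dist_W :: "'a measure \<Rightarrow> ('a \<Rightarrow> real) \<Rightarrow> 'b measure \<Rightarrow> ('b \<Rightarrow> real) \<Rightarrow> ennreal" where
  "dist_W = dist_class {h. 1-lipschitz_on UNIV h}"

definition dist_TV :: "'a measure \<Rightarrow> ('a \<Rightarrow> real) \<Rightarrow> 'b measure \<Rightarrow> ('b \<Rightarrow> real) \<Rightarrow> ennreal" where
  "dist_TV P X Q Y =
     (SUP A\<in>sets (borel :: real measure).
        ennreal \<bar>measure P {x \<in> space P. X x \<in> A} - measure Q {y \<in> space Q. Y y \<in> A}\<bar>)"

definition C2b_unit :: "(real \<Rightarrow> real) set" where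
  "C2b_unit = {h. \<exists>h' h''.
     (\<forall>x. (h has_real_derivative h' x) (at x)) \<and>
     (\<forall>x. (h' has_real_derivative h'' x) (at x)) \<and>
     continuous_on UNIV h'' \<and>
     (\<forall>x. \<bar>h x\<bar> \<le> 1 \<and> \<bar>h' x\<bar> \<le> 1 \<and> \<bar>h'' x\<bar> \<le> 1)}"

definition dist_C2 :: "'a measure \<Rightarrow> ('a \<Rightarrow> real) \<Rightarrow> 'b measure \<Rightarrow> ('b \<Rightarrow> real) \<Rightarrow> ennreal" where
  "dist_C2 = dist_class C2b_unit"

text \<open>Density of the gamma distribution with parameters \<open>(a, 1)\<close>.\<close>

definition gamma_density :: "real \<Rightarrow> real \<Rightarrow> real" where
  "gamma_density a x = (if x > 0 then x powr (a - 1) * exp (- x) / Gamma a else 0)"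


section \<open>The jump process and its filtrations\<close>

text \<open>For \<open>\<omega>\<close> with all \<open>U k \<omega> \<in> [-1, 1]\<close> (almost every \<open>\<omega>\<close>), only finitely many summands
  are nonzero.\<close>

definition jump_process :: "(nat \<Rightarrow> 'a \<Rightarrow> real) \<Rightarrow> real \<Rightarrow> 'a \<Rightarrow> real" where
  "jump_process U t \<omega> = (\<Sum>k. indicator {2 * real k + 1 + U k \<omega>..} t)"

definition jump_filtration :: "'a measure \<Rightarrow> (nat \<Rightarrow> 'a \<Rightarrow> real) \<Rightarrow> real \<Rightarrow> 'a measure" where
  "jump_filtration M U t =
     sigma (space M)
       (\<Union>s\<in>{0..t}. {jump_process U s -` A \<inter> space M | A. A \<in> sets borel})"

definition tilde_filtration :: "'a measure \<Rightarrow> (nat \<Rightarrow> 'a \<Rightarrow> real) \<Rightarrow> real \<Rightarrow> 'a measure" where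
  "tilde_filtration M U t = jump_filtration M U (2 * of_int \<lfloor>t / 2\<rfloor>)"


section \<open>The gradient and its closure\<close>

text \<open>Points of \<open>[-1, 1]\<^bsup>n+1\<^esup>\<close> are the extensional functions on \<open>{..n}\<close>.\<close>

definition cube :: "nat \<Rightarrow> (nat \<Rightarrow> real) set" where
  "cube n = (\<Pi>\<^sub>E k\<in>{..n}. {-1..1})"

text \<open>\<open>f\<close> is of class \<open>C\<^sup>1\<^sub>b\<close> on the closed cube with partial derivatives \<open>f' 0, \<dots>, f' n\<close>
  (one-sided on the faces).\<close>

definition C1b_on_cube ::
  "nat \<Rightarrow> ((nat \<Rightarrow> real) \<Rightarrow> real) \<Rightarrow> (nat \<Rightarrow> (nat \<Rightarrow> real) \<Rightarrow> real) \<Rightarrow> bool" where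
  "C1b_on_cube n f f' \<longleftrightarrow>
     continuous_on (cube n) f \<and> bounded (f ` cube n) \<and>
     (\<forall>k\<le>n. continuous_on (cube n) (f' k) \<and> bounded (f' k ` cube n) \<and>
        (\<forall>x\<in>cube n.
           ((\<lambda>y. f (x(k := y))) has_real_derivative f' k x) (at (x k) within {-1..1})))"

definition smooth_functional ::
  "(nat \<Rightarrow> 'a \<Rightarrow> real) \<Rightarrow> nat \<Rightarrow> ((nat \<Rightarrow> real) \<Rightarrow> real) \<Rightarrow> 'a \<Rightarrow> real" where
  "smooth_functional U n f \<omega> = f (\<lambda>k\<in>{..n}. U k \<omega>)"

definition smooth_gradient ::
  "(nat \<Rightarrow> 'a \<Rightarrow> real) \<Rightarrow> nat \<Rightarrow> (nat \<Rightarrow> (nat \<Rightarrow> real) \<Rightarrow> real) \<Rightarrow> real \<Rightarrow> 'a \<Rightarrow> real" where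
  "smooth_gradient U n f' t \<omega> =
     (\<Sum>k\<le>n. f' k (\<lambda>j\<in>{..n}. U j \<omega>) *
        ((1 - U k \<omega>) * indicator {2 * real k <.. 2 * real k + 1 + U k \<omega>} t
         - (1 + U k \<omega>) * indicator {2 * real k + 1 + U k \<omega> <.. 2 * real k + 2} t))"

abbreviation half_line :: "real measure" where
  "half_line \<equiv> restrict_space lborel {0..}"

text \<open>\<open>closed_gradient M U X DX\<close> means that \<open>(X, DX)\<close> lies in the closure, in
  \<open>L\<^sup>2(\<Omega>) \<times> L\<^sup>2(\<Omega> \<times> \<real>\<^sub>+)\<close>, of the graph of the gradient on smooth functionals, that is,
  \<open>X \<in> Dom(D)\<close> and \<open>DX\<close> represents \<open>D X\<close>. Both are representatives of almost everywhere
  classes. Values of \<open>f\<close> and \<open>f'\<close> outside the cube are only used on a null set if each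
  \<open>U k\<close> is almost surely \<open>[-1, 1]\<close>-valued, and do not influence the \<open>L\<^sup>2\<close>-norms below.\<close>

definition closed_gradient ::
  "'a measure \<Rightarrow> (nat \<Rightarrow> 'a \<Rightarrow> real) \<Rightarrow> ('a \<Rightarrow> real) \<Rightarrow> (real \<Rightarrow> 'a \<Rightarrow> real) \<Rightarrow> bool" where
  "closed_gradient M U X DX \<longleftrightarrow>
     in_L2 M X \<and> in_L2 (M \<Otimes>\<^sub>M half_line) (\<lambda>(\<omega>, t). DX t \<omega>) \<and>
     (\<exists>n f f'.
        (\<forall>m::nat. C1b_on_cube (n m) (f m) (f' m)) \<and>
        (\<lambda>m. L2norm M (\<lambda>\<omega>. X \<omega> - smooth_functional U (n m) (f m) \<omega>))
          \<longlonglongrightarrow> 0 \<and>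
        (\<lambda>m. L2norm (M \<Otimes>\<^sub>M half_line)
               (\<lambda>(\<omega>, t). DX t \<omega> - smooth_gradient U (n m) (f' m) t \<omega>))
          \<longlonglongrightarrow> 0)"

text \<open>\<open>Z\<close> is a jointly measurable version of the process
  \<open>t \<mapsto> E[D\<^sub>t X | tilde_filtration t]\<close>. Joint measurability has to be required because
  \<^const>\<open>real_cond_exp\<close> picks an arbitrary version separately for each \<open>t\<close>.\<close>

definition cond_gradient ::
  "'a measure \<Rightarrow> (nat \<Rightarrow> 'a \<Rightarrow> real) \<Rightarrow> (real \<Rightarrow> 'a \<Rightarrow> real) \<Rightarrow> (real \<Rightarrow> 'a \<Rightarrow> real) \<Rightarrow> bool" where
  "cond_gradient M U DX Z \<longleftrightarrow>
     (\<lambda>(\<omega>, t). Z t \<omega>) \<in> borel_measurable (M \<Otimes>\<^sub>M half_line) \<and>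
     (AE t in half_line. AE \<omega> in M.
        Z t \<omega> = real_cond_exp M (tilde_filtration M U t) (DX t) \<omega>)"

definition T_functional :: "(real \<Rightarrow> 'a \<Rightarrow> real) \<Rightarrow> (real \<Rightarrow> 'a \<Rightarrow> real) \<Rightarrow> 'a \<Rightarrow> real" where
  "T_functional DX Z \<omega> = (LINT t|half_line. DX t \<omega> * Z t \<omega>)"

end

(*
  Integrating the gradient of a smooth functional F against the uniform law of one coordinate
  undoes the differentiation: E[D_t F | F_2k] = E[F | F_2k] - E[F | F_(2k+2)](U_k := t - 2k - 1)
  for t in (2k, 2k+2). These are martingale increments, so integrating against another gradient
  telescopes to E <D F, E[D X | F~]> = 2 Cov(F, X), which extends to X in Dom(D) by closedness.
  Applied to F = g(X) it gives 2 E[X g(X)] = E[g'(X) T_X], and the three bounds follow by inserting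
  the solutions of the Stein equations of the normal and of the centred gamma law, whose
  derivatives are bounded by 1 or 2 (normal) and by 1/2 (gamma).
*)
theory Submission
  imports Defs
begin

section \<open>Resampling coordinates of an i.i.d. uniform sequence\<close>

text \<open>On Dom(D) the gradient has no formula. All computations are therefore done with bounded
  C1 functions of a sequence under the product law \<open>unif_seq\<close>, and only expressions
  that are continuous in the L2 norms are carried over to \<open>X\<close>. In particular
  \<open>g (X)\<close> is never shown to lie in Dom(D): the chain rule is used for
  \<open>g (F m)\<close> with smooth approximants \<open>F m\<close>, and the limit needs
  \<open>g'\<close> bounded and continuous. As T_X is a priori only integrable, a Stein solution f
  is usable once f' is continuous and bounded on the whole line. For total variation this forces
  continuous test functions first, and Borel sets by regularity afterwards. The gamma solution lives
  on a half line; its derivative is bounded by a maximum principle for the equation differentiated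
  twice, whose zeroth-order coefficient is -2. The factor 2 in the duality is the slot length 2
  against a uniform law of mass 1. It turns E[f'(X) - X f(X)] into E[f'(X) (2 - T_X)] / 2, so the
  constants 1/2 and 1 in the normal bounds are half of the bounds 1 and 2 on |f'|.\<close>

abbreviation (input) unif :: "real measure" where
  "unif \<equiv> uniform_measure lborel {-1..1}"

abbreviation (input) unif_seq :: "(nat \<Rightarrow> real) measure" where
  "unif_seq \<equiv> PiM UNIV (\<lambda>_. unif)"

text \<open>Resampling: the coordinates in \<open>J\<close> come from a second, independent
  sequence. \<open>J = {k}\<close> averages over one coordinate, \<open>J = {k..}\<close> conditions
  on the first \<open>k\<close> coordinates.\<close>

definition mix :: "nat set \<Rightarrow> (nat \<Rightarrow> real) \<Rightarrow> (nat \<Rightarrow> real) \<Rightarrow> nat \<Rightarrow> real" where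
  "mix J x y = (\<lambda>i. if i \<in> J then y i else x i)"

lemma prob_space_unif: "prob_space unif"
  by (rule prob_space_uniform_measure) auto

lemma prob_space_unif_seq: "prob_space unif_seq"
  by (rule prob_space_PiM) (rule prob_space_unif)

interpretation unif: prob_space unif by (rule prob_space_unif)
interpretation unif_seq: prob_space unif_seq by (rule prob_space_unif_seq)
interpretation unif_seq_pair: pair_prob_space unif_seq unif_seq ..

text \<open>On a countable product of the reals the product sigma-algebra is the Borel one, so
  continuous functions of the sequence are measurable for \<open>unif_seq\<close>.\<close>

lemma sets_unif_seq [measurable_cong]: "sets unif_seq = sets borel"
proof -
  have "sets unif_seq = sets (PiM UNIV (\<lambda>_::nat. borel :: real measure))"
    by (rule sets_PiM_cong) auto
  then show ?thesis by (simp add: sets_PiM_equal_borel)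
qed

lemma space_unif_seq [simp]: "space unif_seq = UNIV"
  by (simp add: space_PiM)

lemma measure_unif_seq_UNIV [simp]: "measure unif_seq UNIV = 1"
  using unif_seq.prob_space by simp

lemma measurable_seqI:
  assumes "\<And>i::nat. (\<lambda>x. f x i) \<in> borel_measurable M"
  shows "f \<in> M \<rightarrow>\<^sub>M (borel :: (nat \<Rightarrow> real) measure)"
proof -
  have "f \<in> M \<rightarrow>\<^sub>M PiM UNIV (\<lambda>_::nat. borel :: real measure)"
    using assms by (intro measurable_PiM_single') auto
  then show ?thesis
    by (simp cong: measurable_cong_sets add: sets_PiM_equal_borel)
qed

lemma measurable_seq_component: "(\<lambda>x::nat \<Rightarrow> real. x i) \<in> borel_measurable borel"
  by (intro borel_measurable_continuous_onI continuous_on_product_coordinates)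

lemma measurable_mix [measurable (raw)]:
  assumes "f \<in> M \<rightarrow>\<^sub>M borel" "g \<in> M \<rightarrow>\<^sub>M borel"
  shows "(\<lambda>z. mix J (f z) (g z)) \<in> M \<rightarrow>\<^sub>M borel"
proof (rule measurable_seqI)
  show "(\<lambda>z. mix J (f z) (g z) i) \<in> borel_measurable M" for i
    using assms[THEN measurable_compose, OF measurable_seq_component, of i]
    by (cases "i \<in> J") (simp_all add: mix_def)
qed

lemma measurable_seq_upd [measurable (raw)]:
  assumes "f \<in> M \<rightarrow>\<^sub>M borel" "g \<in> borel_measurable M"
  shows "(\<lambda>z. (f z)(k := g z)) \<in> M \<rightarrow>\<^sub>M (borel :: (nat \<Rightarrow> real) measure)"
proof (rule measurable_seqI)
  show "(\<lambda>z. ((f z)(k := g z)) i) \<in> borel_measurable M" for i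
    using assms(2) measurable_compose[OF assms(1) measurable_seq_component, of i]
    by (cases "i = k") simp_all
qed

lemma measurable_fun_upd [measurable]: "fun_upd x k \<in> borel \<rightarrow>\<^sub>M (borel :: (nat \<Rightarrow> real) measure)"
  using measurable_seq_upd[of "\<lambda>_. x" borel "\<lambda>v. v" k] by simp

text \<open>It suffices to test finite-dimensional boxes. The preimage of a box over
  \<open>K\<close> is the product of a box over \<open>K - J\<close> in \<open>x\<close> and a box
  over \<open>K \<inter> J\<close> in \<open>y\<close>, and the factors multiply by
  independence.\<close>

lemma distr_mix:
  "distr (unif_seq \<Otimes>\<^sub>M unif_seq) unif_seq (\<lambda>(x, y). mix J x y) = unif_seq"
proof (rule measure_eqI_PiM_infinite[symmetric, OF refl])
  show "finite_measure unif_seq" by (rule unif_seq.finite_measure_axioms)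
  fix A and K :: "nat set"
  assume K: "finite K" "K \<subseteq> UNIV" and A: "\<And>i. i \<in> K \<Longrightarrow> A i \<in> sets unif"
  let ?X = "prod_emb UNIV (\<lambda>_. unif) K (Pi\<^sub>E K A)"
  let ?f = "\<lambda>(x, y). mix J x y"
  have [measurable]: "?X \<in> sets unif_seq"
    using K A by (intro sets_PiM_I) auto
  have emb: "prod_emb UNIV (\<lambda>_. unif) L (Pi\<^sub>E L A) = {x. \<forall>i\<in>L. x i \<in> A i}" for L
    by (auto simp: prod_emb_def space_PiM restrict_PiE_iff)
  have "(\<Prod>i\<in>K. unif (A i)) = (\<Prod>i\<in>K - J. unif (A i)) * (\<Prod>i\<in>K \<inter> J. unif (A i))"
    using K by (subst prod.union_disjoint[symmetric]) (auto intro!: prod.cong)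
  also have "(\<Prod>i\<in>K - J. unif (A i)) = unif_seq (prod_emb UNIV (\<lambda>_. unif) (K - J) (Pi\<^sub>E (K - J) A))"
    using K A prob_space_unif by (intro emeasure_PiM_emb[symmetric]) auto
  also have "(\<Prod>i\<in>K \<inter> J. unif (A i)) = unif_seq (prod_emb UNIV (\<lambda>_. unif) (K \<inter> J) (Pi\<^sub>E (K \<inter> J) A))"
    using K A prob_space_unif by (intro emeasure_PiM_emb[symmetric]) auto
  also have "unif_seq (prod_emb UNIV (\<lambda>_. unif) (K - J) (Pi\<^sub>E (K - J) A)) *
      unif_seq (prod_emb UNIV (\<lambda>_. unif) (K \<inter> J) (Pi\<^sub>E (K \<inter> J) A))
    = (unif_seq \<Otimes>\<^sub>M unif_seq) (prod_emb UNIV (\<lambda>_. unif) (K - J) (Pi\<^sub>E (K - J) A) \<times>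
        prod_emb UNIV (\<lambda>_. unif) (K \<inter> J) (Pi\<^sub>E (K \<inter> J) A))"
    using K A by (intro unif_seq.emeasure_pair_measure_Times[symmetric] sets_PiM_I) auto
  also have "prod_emb UNIV (\<lambda>_. unif) (K - J) (Pi\<^sub>E (K - J) A) \<times>
        prod_emb UNIV (\<lambda>_. unif) (K \<inter> J) (Pi\<^sub>E (K \<inter> J) A)
     = ?f -` ?X \<inter> space (unif_seq \<Otimes>\<^sub>M unif_seq)"
    by (auto simp: emb space_pair_measure mix_def)
  also have "(unif_seq \<Otimes>\<^sub>M unif_seq) \<dots> = distr (unif_seq \<Otimes>\<^sub>M unif_seq) unif_seq ?f ?X"
    by (subst emeasure_distr) auto
  finally show "unif_seq ?X = distr (unif_seq \<Otimes>\<^sub>M unif_seq) unif_seq ?f ?X"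
    using K A prob_space_unif by (subst emeasure_PiM_emb) auto
qed simp

lemma resample_integrable:
  fixes G :: "(nat \<Rightarrow> real) \<Rightarrow> real"
  assumes "integrable unif_seq G"
  shows "integrable (unif_seq \<Otimes>\<^sub>M unif_seq) (\<lambda>(x, y). G (mix J x y))"
proof -
  have "integrable (distr (unif_seq \<Otimes>\<^sub>M unif_seq) unif_seq (\<lambda>(x, y). mix J x y)) G"
    using assms by (simp add: distr_mix)
  then show ?thesis
    by (subst (asm) integrable_distr_eq) (use assms in \<open>auto simp: case_prod_unfold\<close>)
qed

lemma resample_integral:
  fixes G :: "(nat \<Rightarrow> real) \<Rightarrow> real"
  assumes "integrable unif_seq G"
  shows "(\<integral>x. (\<integral>y. G (mix J x y) \<partial>unif_seq) \<partial>unif_seq) = (\<integral>x. G x \<partial>unif_seq)"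
proof -
  have "(\<integral>x. G x \<partial>unif_seq)
      = (\<integral>x. G x \<partial>distr (unif_seq \<Otimes>\<^sub>M unif_seq) unif_seq (\<lambda>(x, y). mix J x y))"
    by (simp add: distr_mix)
  also have "\<dots> = (\<integral>z. (\<lambda>(x, y). G (mix J x y)) z \<partial>(unif_seq \<Otimes>\<^sub>M unif_seq))"
    by (subst integral_distr) (use assms in \<open>auto simp: case_prod_unfold\<close>)
  also have "\<dots> = (\<integral>x. (\<integral>y. G (mix J x y) \<partial>unif_seq) \<partial>unif_seq)"
    using unif_seq_pair.integral_fst'[OF resample_integrable[OF assms, of J]] by simp
  finally show ?thesis ..
qed

lemma integral_component_unif_seq:
  fixes h :: "real \<Rightarrow> real"
  assumes "h \<in> borel_measurable borel"
  shows "(\<integral>y. h (y k) \<partial>unif_seq) = (\<integral>v. h v \<partial>unif)"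
proof -
  have "(\<integral>v. h v \<partial>unif) = (\<integral>v. h v \<partial>distr unif_seq unif (\<lambda>\<omega>. \<omega> k))"
    using distr_PiM_component[of UNIV "\<lambda>_. unif" k] prob_space_unif by simp
  also have "\<dots> = (\<integral>y. h (y k) \<partial>unif_seq)"
    using assms by (subst integral_distr) (simp_all cong: measurable_cong_sets)
  finally show ?thesis ..
qed

text \<open>With \<open>J = {k}\<close> the second sequence enters through its coordinate
  \<open>k\<close> only, so averaging over it is a one-dimensional uniform average.\<close>

lemma integral_resample_coord:
  fixes G :: "(nat \<Rightarrow> real) \<Rightarrow> real"
  assumes "integrable unif_seq G"
  shows "(\<integral>x. (\<integral>v. G (x(k := v)) \<partial>unif) \<partial>unif_seq) = (\<integral>x. G x \<partial>unif_seq)"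
proof -
  have [measurable]: "G \<in> borel_measurable borel"
    using borel_measurable_integrable[OF assms] by simp
  have "(\<integral>v. G (x(k := v)) \<partial>unif) = (\<integral>y. G (mix {k} x y) \<partial>unif_seq)" for x
  proof -
    have "mix {k} x y = x(k := y k)" for y by (auto simp: mix_def fun_eq_iff)
    then show ?thesis
      by (simp add: integral_component_unif_seq[of "\<lambda>v. G (x(k := v))" k])
  qed
  then show ?thesis using resample_integral[OF assms, of "{k}"] by simp
qed

lemma AE_unif_seq_cube: "AE x in unif_seq. \<forall>k. x k \<in> {-1..1}"
proof -
  have "AE v in unif. v \<in> {-1..1}"
    by (subst AE_uniform_measure) auto
  then show ?thesis
    unfolding AE_all_countable using prob_space_unif
    by (intro allI AE_PiM_component) auto
qed

section \<open>The gradient on cylinder functions\<close>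

lemma integral_unif:
  fixes h :: "real \<Rightarrow> real"
  assumes [measurable]: "h \<in> borel_measurable borel"
  shows "(\<integral>v. h v \<partial>unif) = (\<integral>v. indicator {-1..1} v * h v \<partial>lborel) / 2"
proof -
  have "unif = density lborel (\<lambda>v. ennreal (indicator {-1..1} v / 2))"
    unfolding uniform_measure_def
    by (intro arg_cong2[where f = density] refl ext)
       (auto simp: indicator_def divide_ennreal[symmetric])
  then have "(\<integral>v. h v \<partial>unif) = (\<integral>v. (indicator {-1..1} v / 2) *\<^sub>R h v \<partial>lborel)"
    by (simp add: integral_density)
  then show ?thesis by simp
qed

text \<open>For \<open>2 k < t \<le> 2 k + 2\<close> the gradient is \<open>D\<^sub>t F = \<partial>\<^sub>k F \<cdot> kern (t - 2 k - 1) (U k)\<close>.\<close>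

definition kern :: "real \<Rightarrow> real \<Rightarrow> real" where
  "kern s v = (1 - v) * indicator {s..} v - (1 + v) * indicator {..<s} v"

lemma borel_measurable_kern [measurable (raw)]:
  assumes [measurable]: "f \<in> borel_measurable M" "g \<in> borel_measurable M"
  shows "(\<lambda>x. kern (f x) (g x)) \<in> borel_measurable M"
proof -
  have kern_eq: "kern s v = (if s \<le> v then 1 - v else - (1 + v))" for s v
    by (auto simp: kern_def indicator_def)
  show ?thesis unfolding kern_eq by measurable
qed

lemma abs_kern_le: "v \<in> {-1..1} \<Longrightarrow> \<bar>kern s v\<bar> \<le> 2"
  by (auto simp: kern_def indicator_def)

text \<open>Integration by parts on \<open>[-1, s]\<close> and on \<open>[s, 1]\<close>.\<close>

lemma integral_kern:
  fixes p p' :: "real \<Rightarrow> real"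
  assumes deriv: "\<And>v. v \<in> {-1..1} \<Longrightarrow> (p has_real_derivative p' v) (at v within {-1..1})"
    and cont: "continuous_on {-1..1} p'" and meas: "p \<in> borel_measurable borel" "p' \<in> borel_measurable borel"
    and s: "s \<in> {-1..1}"
  shows "(\<integral>v. p' v * kern s v \<partial>unif) = (\<integral>v. p v \<partial>unif) - p s"
proof -
  note [measurable] = meas
  have contp: "continuous_on {-1..1} p"
    using deriv by (meson DERIV_continuous continuous_on_eq_continuous_within)
  have int: "set_integrable lborel {a..b} q" if "continuous_on {-1..1} q" "-1 \<le> a" "b \<le> 1" for a b and q :: "real \<Rightarrow> real"
    using that by (intro borel_integrable_atLeastAtMost' continuous_on_subset[OF that(1)]) auto
  \<comment> \<open>The integrand is the derivative of \<open>(c + d * v) * p v\<close>. The two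
    linear weights needed are \<open>-1 - v\<close> left of \<open>s\<close> and
    \<open>1 - v\<close> right of \<open>s\<close>, the two branches of \<open>kern\<close>.\<close>
  have FTC: "(\<integral>v. indicator {a..b} v * (((c + d * v) * p' v) + d * p v) \<partial>lborel)
      = (c + d * b) * p b - (c + d * a) * p a" if "-1 \<le> a" "a \<le> b" "b \<le> 1" for a b c d :: real
  proof -
    have "(\<integral>v. indicator {a..b} v *\<^sub>R (((c + d * v) * p' v) + d * p v) \<partial>lborel)
      = (c + d * b) * p b - (c + d * a) * p a"
    proof (rule integral_FTC_atLeastAtMost)
      show "((\<lambda>v. (c + d * v) * p v) has_vector_derivative (c + d * x) * p' x + d * p x) (at x within {a..b})"
        if "a \<le> x" "x \<le> b" for x
      proof -
        have "(p has_real_derivative p' x) (at x within {a..b})"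
          using deriv[of x] that \<open>-1 \<le> a\<close> \<open>b \<le> 1\<close> by (auto intro: DERIV_subset)
        then show ?thesis
          unfolding has_real_derivative_iff_has_vector_derivative[symmetric]
          by (auto intro!: derivative_eq_intros simp: algebra_simps)
      qed
      have "continuous_on {-1..1} (\<lambda>v. (c + d * v) * p' v + d * p v)"
        by (intro continuous_intros cont contp)
      then show "continuous_on {a..b} (\<lambda>v. (c + d * v) * p' v + d * p v)"
        by (rule continuous_on_subset) (use that in auto)
    qed (use that in auto)
    then show ?thesis by simp
  qed
  have s1: "-1 \<le> s" and s2: "s \<le> 1" using s by auto
  have si: "set_integrable lborel {-1..s} (\<lambda>v. (-1 + -1 * v) * p' v + -1 * p v)"
       "set_integrable lborel {s..1} (\<lambda>v. (1 + -1 * v) * p' v + -1 * p v)"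
       "set_integrable lborel {-1..1} p"
    using s by (auto intro!: int continuous_intros cont contp)
  note si = si[unfolded set_integrable_def real_scaleR_def]
  have "(\<integral>v. indicator {-1..1} v * (p' v * kern s v) \<partial>lborel)
      = (\<integral>v. indicator {-1..s} v * ((-1 + -1 * v) * p' v + -1 * p v)
          + indicator {s..1} v * ((1 + -1 * v) * p' v + -1 * p v) + indicator {-1..1} v * p v \<partial>lborel)"
  proof (intro integral_cong_AE)
    show "AE v in lborel. indicator {-1..1} v * (p' v * kern s v) =
        indicator {-1..s} v * ((-1 + -1 * v) * p' v + -1 * p v)
          + indicator {s..1} v * ((1 + -1 * v) * p' v + -1 * p v) + indicator {-1..1} v * p v"
      using AE_lborel_singleton[of s]
      by eventually_elim (use s in \<open>auto simp: indicator_def kern_def algebra_simps\<close>)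
  qed (use meas in measurable)
  \<comment> \<open>The weights vanish at -1 and at 1, so only boundary terms at \<open>s\<close>
    survive: \<open>-(1 + s) * p s\<close> and \<open>-(1 - s) * p s\<close>.\<close>
  also have "\<dots> = (- 2 * p s) + (\<integral>v. indicator {-1..1} v * p v \<partial>lborel)"
    unfolding Bochner_Integration.integral_add[OF Bochner_Integration.integrable_add[OF si(1,2)] si(3)]
      Bochner_Integration.integral_add[OF si(1,2)]
    unfolding FTC[of "-1" s "-1" "-1", OF order_refl s1 s2] FTC[of s 1 1 "-1", OF s1 s2 order_refl]
    by (simp add: algebra_simps)
  finally show ?thesis
    by (simp add: integral_unif field_simps)
qed

text \<open>Smooth functionals on the whole sequence space. Continuity and bounds hold everywhere,
  so measurability needs no care outside the cube; differentiability is asked only where the moving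
  coordinate lies in [-1, 1], which allows kinks beyond. Derivatives beyond index \<open>n\<close>
  are fixed to be 0 so that formulas may range over all slots.\<close>

definition C1_cyl :: "nat \<Rightarrow> ((nat \<Rightarrow> real) \<Rightarrow> real) \<Rightarrow> (nat \<Rightarrow> (nat \<Rightarrow> real) \<Rightarrow> real) \<Rightarrow> bool" where
  "C1_cyl n F F' \<longleftrightarrow>
     continuous_on UNIV F \<and> bounded (range F) \<and> (\<forall>x y. (\<forall>i\<le>n. x i = y i) \<longrightarrow> F x = F y) \<and>
     (\<forall>k. continuous_on UNIV (F' k) \<and> bounded (range (F' k)) \<and> (n < k \<longrightarrow> F' k = (\<lambda>_. 0)) \<and>
        (\<forall>x. \<forall>v\<in>{-1..1}.
           ((\<lambda>v. F (x(k := v))) has_real_derivative F' k (x(k := v))) (at v within {-1..1})))"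

text \<open>The values of \<open>F\<close> lie in a compact interval, where continuity already
  bounds \<open>g\<close> and \<open>g'\<close>.\<close>

lemma C1_cyl_compose:
  assumes F: "C1_cyl n F F'"
    and g: "\<And>x. (g has_real_derivative g' x) (at x)" "continuous_on UNIV g'"
  shows "C1_cyl n (\<lambda>x. g (F x)) (\<lambda>k x. g' (F x) * F' k x)"
proof -
  have contg: "continuous_on UNIV g"
    using g(1) by (meson DERIV_continuous continuous_at_imp_continuous_on)
  have contF: "continuous_on UNIV F" "\<And>k. continuous_on UNIV (F' k)"
    using F by (auto simp: C1_cyl_def)
  obtain B where B: "\<And>x. \<bar>F x\<bar> \<le> B"
    using F by (auto simp: C1_cyl_def bounded_iff)
  have bdd: "bounded (range (\<lambda>x. q (F x)))" if "continuous_on UNIV q" for q :: "real \<Rightarrow> real"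
  proof -
    have "compact (q ` {-B..B})"
      by (intro compact_continuous_image continuous_on_subset[OF that]) auto
    moreover have "range (\<lambda>x. q (F x)) \<subseteq> q ` {-B..B}"
      using B by (auto simp: abs_le_iff minus_le_iff)
    ultimately show ?thesis
      using compact_imp_bounded bounded_subset by blast
  qed
  have bdd': "bounded (range (\<lambda>x. g' (F x) * F' k x))" for k
  proof -
    have "bounded (range (\<lambda>x. g' (F x)))" by (rule bdd[OF g(2)])
    then obtain C where C: "\<And>x. \<bar>g' (F x)\<bar> \<le> C" by (auto simp: bounded_iff)
    have "bounded (range (F' k))" using F by (auto simp: C1_cyl_def)
    then obtain D where D: "\<And>x. \<bar>F' k x\<bar> \<le> D" by (auto simp: bounded_iff)
    have "0 \<le> C" using C abs_ge_zero order_trans by blast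
    then have "\<bar>g' (F x) * F' k x\<bar> \<le> C * D" for x
      unfolding abs_mult by (intro mult_mono C D) auto
    then show ?thesis by (auto simp: bounded_iff)
  qed
  have chain: "((\<lambda>v. g (F (x(k := v)))) has_real_derivative g' (F (x(k := v))) * F' k (x(k := v)))
      (at v within {-1..1})" if "v \<in> {-1..1}" for x k v
    using F that by (intro DERIV_chain2[OF g(1)]) (auto simp: C1_cyl_def)
  have "continuous_on UNIV (\<lambda>x. g (F x))" "\<And>k. continuous_on UNIV (\<lambda>x. g' (F x) * F' k x)"
    by (auto intro!: continuous_intros continuous_on_compose2[OF contg] continuous_on_compose2[OF g(2)] contF)
  then show ?thesis
    using F bdd[OF contg] bdd' chain unfolding C1_cyl_def
    by (intro conjI allI impI ballI) (auto intro: arg_cong[where f = g])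
qed

text \<open>In terms of the sequence \<open>U\<close>, the function \<open>tail k F\<close> is the conditional expectation of \<open>F\<close>
  at time \<open>2 k\<close>, and \<open>zeta k F s\<close> will turn out to be that of \<open>D\<^sub>t F\<close> for
  \<open>t = 2 k + 1 + s\<close>.\<close>

definition tail :: "nat \<Rightarrow> ((nat \<Rightarrow> real) \<Rightarrow> real) \<Rightarrow> (nat \<Rightarrow> real) \<Rightarrow> real" where
  "tail k F x = (\<integral>y. F (mix {k..} x y) \<partial>unif_seq)"

definition zeta :: "nat \<Rightarrow> ((nat \<Rightarrow> real) \<Rightarrow> real) \<Rightarrow> real \<Rightarrow> (nat \<Rightarrow> real) \<Rightarrow> real" where
  "zeta k F s x = tail k F x - tail (Suc k) F (x(k := s))"

lemma measurable_tail [measurable (raw)]: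
  assumes [measurable]: "F \<in> borel_measurable borel" "f \<in> M \<rightarrow>\<^sub>M borel"
  shows "(\<lambda>z. tail k F (f z)) \<in> borel_measurable M"
proof -
  have "tail k F \<in> borel_measurable borel"
    unfolding tail_def by measurable
  then show ?thesis by measurable
qed

lemma measurable_zeta [measurable (raw)]:
  assumes [measurable]: "F \<in> borel_measurable borel" "f \<in> M \<rightarrow>\<^sub>M borel" "g \<in> borel_measurable M"
  shows "(\<lambda>z. zeta k F (g z) (f z)) \<in> borel_measurable M"
  unfolding zeta_def by measurable

lemma abs_tail_le:
  assumes [measurable]: "F \<in> borel_measurable borel" and "\<And>x. \<bar>F x\<bar> \<le> B"
  shows "\<bar>tail k F x\<bar> \<le> B"
proof -
  have "0 \<le> B" using assms(2)[of x] by simp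
  have "norm (tail k F x) \<le> (\<integral>y. norm (F (mix {k..} x y)) \<partial>unif_seq)"
    unfolding tail_def by (rule integral_norm_bound)
  also have "\<dots> \<le> (\<integral>y. B \<partial>unif_seq)"
    using assms(2) \<open>0 \<le> B\<close>
    by (intro integral_mono unif_seq.integrable_const_bound[where B = B]) auto
  finally show ?thesis by simp
qed

lemma abs_zeta_le:
  assumes "F \<in> borel_measurable borel" and "\<And>x. \<bar>F x\<bar> \<le> B"
  shows "\<bar>zeta k F s x\<bar> \<le> 2 * B"
  using abs_tail_le[OF assms, of k x] abs_tail_le[OF assms, of "Suc k" "x(k := s)"]
  by (simp add: zeta_def)

lemma tail_cong: "(\<And>i. i < k \<Longrightarrow> x i = y i) \<Longrightarrow> tail k F x = tail k F y"
proof -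
  assume *: "\<And>i. i < k \<Longrightarrow> x i = y i"
  have "mix {k..} x z = mix {k..} y z" for z
    using * by (auto simp: mix_def fun_eq_iff)
  then show ?thesis by (simp add: tail_def)
qed

lemma zeta_cong: "(\<And>i. i < k \<Longrightarrow> x i = y i) \<Longrightarrow> zeta k F s x = zeta k F s y"
  unfolding zeta_def by (intro arg_cong2[where f = "(-)"] tail_cong) auto

lemma tail_0: "tail 0 F x = (\<integral>x. F x \<partial>unif_seq)"
  by (simp add: tail_def mix_def)

lemma tail_determined:
  assumes "\<And>x y. (\<And>i. i < k \<Longrightarrow> x i = y i) \<Longrightarrow> F x = F y"
  shows "tail k F x = F x"
proof -
  have "F (mix {k..} x y) = F x" for y by (rule assms) (auto simp: mix_def)
  then show ?thesis by (simp add: tail_def)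
qed

text \<open>Tower property over one step: resampling from \<open>k\<close> on amounts to resampling
  coordinate \<open>k\<close> and then everything after it.\<close>

lemma integral_tail_Suc:
  assumes [measurable]: "F \<in> borel_measurable borel" and B: "\<And>x. \<bar>F x\<bar> \<le> B"
  shows "(\<integral>s. tail (Suc k) F (x(k := s)) \<partial>unif) = tail k F x"
proof -
  have int: "integrable unif_seq (\<lambda>y. F (mix {k..} x y))"
    using B by (intro unif_seq.integrable_const_bound[where B = B]) auto
  have "mix {k..} x (y(k := s)) = mix {Suc k..} (x(k := s)) y" for y s
    by (auto simp: mix_def fun_eq_iff)
  then have "tail k F x = (\<integral>y. (\<integral>s. F (mix {Suc k..} (x(k := s)) y) \<partial>unif) \<partial>unif_seq)"
    using integral_resample_coord[OF int, of k] by (simp add: tail_def)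
  also have "\<dots> = (\<integral>s. (\<integral>y. F (mix {Suc k..} (x(k := s)) y) \<partial>unif_seq) \<partial>unif)"
  proof -
    interpret pair_prob_space unif_seq unif ..
    show ?thesis
      by (rule Fubini_integral[symmetric])
        (use B in \<open>auto intro!: integrable_const_bound[where B = B] simp: case_prod_unfold\<close>)
  qed
  finally show ?thesis by (simp add: tail_def)
qed

text \<open>Increments of the martingale \<open>tail k F\<close> are centred. This removes the first
  of the two terms produced by integration by parts in \<open>integral_zeta_kern\<close>.\<close>

lemma integral_zeta:
  assumes [measurable]: "F \<in> borel_measurable borel" and B: "\<And>x. \<bar>F x\<bar> \<le> B"
  shows "(\<integral>s. zeta k F s x \<partial>unif) = 0"
proof -
  have "(\<lambda>s. tail (Suc k) F (x(k := s))) \<in> borel_measurable borel" by measurable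
  then have "integrable unif (\<lambda>s. tail (Suc k) F (x(k := s)))"
    using abs_tail_le[OF assms]
    by (intro unif.integrable_const_bound[where B = B]) (auto cong: measurable_cong_sets)
  then show ?thesis
    by (simp add: zeta_def integral_tail_Suc[OF assms] unif.prob_space[simplified])
qed

lemma measurable_kern_coord [measurable (raw)]:
  fixes g :: "'a \<Rightarrow> nat \<Rightarrow> real"
  assumes [measurable]: "f \<in> borel_measurable M" "g \<in> M \<rightarrow>\<^sub>M borel"
  shows "(\<lambda>z. kern (f z) (g z k)) \<in> borel_measurable M"
  using measurable_compose[OF assms(2) measurable_seq_component] by measurable

lemma C1_cyl_bounds:
  assumes "C1_cyl n F F'"
  obtains B where "\<And>x. \<bar>F x\<bar> \<le> B" "\<And>k x. \<bar>F' k x\<bar> \<le> B"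
proof -
  obtain B where B: "\<And>x. \<bar>F x\<bar> \<le> B"
    using assms by (auto simp: C1_cyl_def bounded_iff)
  have "\<exists>C. \<forall>x. \<bar>F' k x\<bar> \<le> C" for k
    using assms by (auto simp: C1_cyl_def bounded_iff)
  then obtain C where C: "\<And>k x. \<bar>F' k x\<bar> \<le> C k" by metis
  have C0: "0 \<le> C k" for k using C[of k undefined] by simp
  have B0: "0 \<le> B" using B[of undefined] by simp
  \<comment> \<open>Only finitely many derivatives are nonzero, so the sum of their bounds serves
    all \<open>k\<close> at once.\<close>
  have "\<bar>F' k x\<bar> \<le> B + (\<Sum>j\<le>n. C j)" for k x
  proof (cases "k \<le> n")
    case True
    then have "C k \<le> (\<Sum>j\<le>n. C j)" using C0 by (intro member_le_sum) auto
    then show ?thesis using C[of k x] B0 by linarith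
  next
    case False
    then have "F' k x = 0" using assms by (auto simp: C1_cyl_def)
    then show ?thesis using B0 C0 by (simp add: sum_nonneg)
  qed
  moreover have "\<bar>F x\<bar> \<le> B + (\<Sum>j\<le>n. C j)" for x
    using B[of x] C0 by (simp add: sum_nonneg add_increasing2)
  ultimately show thesis by (rule that[rotated])
qed

lemma C1_cyl_measurable:
  assumes "C1_cyl n F F'"
  shows "F \<in> borel_measurable borel" "F' k \<in> borel_measurable borel"
  using assms by (auto simp: C1_cyl_def intro: borel_measurable_continuous_onI)

lemma measurable_seq_upd_const:
  fixes F :: "(nat \<Rightarrow> real) \<Rightarrow> real"
  assumes "F \<in> borel_measurable borel"
  shows "(\<lambda>v. F (x(k := v))) \<in> borel_measurable borel"
  using measurable_compose[OF measurable_fun_upd assms] .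

text \<open>Resampling coordinate \<open>k\<close> leaves \<open>I\<close> unchanged, as
  \<open>I\<close> looks at earlier coordinates only, and what remains in that coordinate is the
  one-dimensional identity \<open>integral_kern\<close>.\<close>

lemma integral_cyl_kern:
  assumes F: "C1_cyl n F F'" and s: "s \<in> {-1..1}"
    and I [measurable]: "I \<in> borel_measurable borel" and C: "\<And>x. \<bar>I x\<bar> \<le> C"
    and cyl: "\<And>x y. (\<And>i. i < k \<Longrightarrow> x i = y i) \<Longrightarrow> I x = I y"
  shows "(\<integral>x. I x * (F' k x * kern s (x k)) \<partial>unif_seq)
      = (\<integral>x. I x * F x \<partial>unif_seq) - (\<integral>x. I x * F (x(k := s)) \<partial>unif_seq)"
proof -
  obtain B where B: "\<And>x. \<bar>F x\<bar> \<le> B" "\<And>k x. \<bar>F' k x\<bar> \<le> B"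
    by (rule C1_cyl_bounds[OF F]) blast
  note [measurable] = C1_cyl_measurable[OF F]
  have C0: "0 \<le> C" and B0: "0 \<le> B" using C[of undefined] B(1)[of undefined] by simp_all
  have int1: "integrable unif_seq (\<lambda>x. I x * (F' k x * kern s (x k)))"
  proof (rule unif_seq.integrable_const_bound[where B = "C * (B * 2)"])
    show "AE x in unif_seq. norm (I x * (F' k x * kern s (x k))) \<le> C * (B * 2)"
      using AE_unif_seq_cube
    proof eventually_elim
      case (elim x)
      then show ?case
        unfolding real_norm_def abs_mult using B0 C0 C B(2)
        by (intro mult_mono abs_kern_le) auto
    qed
  qed measurable
  have int2: "integrable unif_seq (\<lambda>x. I x * F x)"
    using C B(1) C0 B0 by (intro unif_seq.integrable_const_bound[where B = "C * B"])
      (auto simp: abs_mult intro!: mult_mono)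
  have int3: "integrable unif_seq (\<lambda>x. I x * F (x(k := s)))"
    using C B(1) C0 B0 by (intro unif_seq.integrable_const_bound[where B = "C * B"])
      (auto simp: abs_mult intro!: mult_mono)
  have Iupd: "I (x(k := v)) = I x" for x v by (rule cyl) auto
  have inner: "(\<integral>v. F' k (x(k := v)) * kern s v \<partial>unif)
      = (\<integral>v. F (x(k := v)) \<partial>unif) - F (x(k := s))" for x
  proof (rule integral_kern)
    show "((\<lambda>v. F (x(k := v))) has_real_derivative F' k (x(k := v))) (at v within {-1..1})"
      if "v \<in> {-1..1}" for v
      using F that by (auto simp: C1_cyl_def)
    have c1: "continuous_on UNIV (F' k)" using F by (auto simp: C1_cyl_def)
    have c2: "continuous_on UNIV (\<lambda>v. x(k := v))"
    proof (intro continuous_on_coordinatewise_then_product)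
      show "continuous_on UNIV (\<lambda>v. (x(k := v)) i)" for i
        by (cases "i = k") (auto intro!: continuous_intros)
    qed
    show "continuous_on {-1..1} (\<lambda>v. F' k (x(k := v)))"
      by (rule continuous_on_subset[OF continuous_on_compose2[OF c1 c2]]) simp_all
  qed (fact s measurable_seq_upd_const[OF C1_cyl_measurable(1)[OF F]]
        measurable_seq_upd_const[OF C1_cyl_measurable(2)[OF F]])+
  have intv: "integrable unif_seq (\<lambda>x. \<integral>v. I (x(k := v)) * F (x(k := v)) \<partial>unif)"
  proof (rule unif_seq.integrable_const_bound[where B = "C * B"])
    have "norm (\<integral>v. I (x(k := v)) * F (x(k := v)) \<partial>unif) \<le> C * B" for x
    proof -
      have "norm (\<integral>v. I (x(k := v)) * F (x(k := v)) \<partial>unif)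
          \<le> (\<integral>v. norm (I (x(k := v)) * F (x(k := v))) \<partial>unif)"
        by (rule integral_norm_bound)
      also have "\<dots> \<le> (\<integral>v. C * B \<partial>unif)"
      proof (intro integral_mono)
        show "integrable unif (\<lambda>v. norm (I (x(k := v)) * F (x(k := v))))"
        proof (rule unif.integrable_const_bound[where B = "C * B"])
          show "AE v in unif. norm (norm (I (x(k := v)) * F (x(k := v)))) \<le> C * B"
            using C B(1) C0 B0 by (auto simp: abs_mult intro!: mult_mono AE_I2)
        qed measurable
        show "norm (I (x(k := v)) * F (x(k := v))) \<le> C * B" for v
          using C B(1) C0 B0 by (auto simp: abs_mult intro!: mult_mono)
      qed simp
      finally show ?thesis using unif.prob_space by simp
    qed
    then show "AE x in unif_seq. norm (\<integral>v. I (x(k := v)) * F (x(k := v)) \<partial>unif) \<le> C * B"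
      by simp
  qed measurable
  have "(\<integral>x. I x * (F' k x * kern s (x k)) \<partial>unif_seq)
      = (\<integral>x. (\<integral>v. I (x(k := v)) * (F' k (x(k := v)) * kern s ((x(k := v)) k)) \<partial>unif) \<partial>unif_seq)"
    by (rule integral_resample_coord[OF int1, symmetric])
  also have "\<dots> = (\<integral>x. (\<integral>v. I (x(k := v)) * F (x(k := v)) \<partial>unif) - I x * F (x(k := s)) \<partial>unif_seq)"
    by (simp add: Iupd inner right_diff_distrib)
  also have "\<dots> = (\<integral>x. (\<integral>v. I (x(k := v)) * F (x(k := v)) \<partial>unif) \<partial>unif_seq)
      - (\<integral>x. I x * F (x(k := s)) \<partial>unif_seq)"
    by (rule Bochner_Integration.integral_diff[OF intv int3])
  also have "(\<integral>x. (\<integral>v. I (x(k := v)) * F (x(k := v)) \<partial>unif) \<partial>unif_seq) = (\<integral>x. I x * F x \<partial>unif_seq)"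
    by (rule integral_resample_coord[OF int2])
  finally show ?thesis .
qed

text \<open>The defining property of a conditional expectation given the first \<open>k\<close>
  coordinates: the resampled coordinates do not occur in \<open>I\<close>.\<close>

lemma integral_mult_tail:
  assumes [measurable]: "F \<in> borel_measurable borel" "I \<in> borel_measurable borel"
    and B: "\<And>x. \<bar>F x\<bar> \<le> B" and C: "\<And>x. \<bar>I x\<bar> \<le> C"
    and cyl: "\<And>x y. (\<And>i. i < k \<Longrightarrow> x i = y i) \<Longrightarrow> I x = I y"
  shows "(\<integral>x. I x * tail k F x \<partial>unif_seq) = (\<integral>x. I x * F x \<partial>unif_seq)"
proof -
  have C0: "0 \<le> C" and B0: "0 \<le> B" using C[of undefined] B[of undefined] by simp_all
  have int: "integrable unif_seq (\<lambda>x. I x * F x)"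
    using C B C0 B0 by (intro unif_seq.integrable_const_bound[where B = "C * B"])
      (auto simp: abs_mult intro!: mult_mono)
  have "I (mix {k..} x y) = I x" for x y by (rule cyl) (auto simp: mix_def)
  then show ?thesis
    using resample_integral[OF int, of "{k..}"] by (simp add: tail_def)
qed

text \<open>This identifies \<open>zeta k F s\<close> as the conditional expectation of the gradient
  given the first \<open>k\<close> coordinates: \<open>I\<close> runs through bounded functions of
  these.\<close>

lemma integral_cyl_kern_zeta:
  assumes F: "C1_cyl n F F'" and s: "s \<in> {-1..1}"
    and I [measurable]: "I \<in> borel_measurable borel" and C: "\<And>x. \<bar>I x\<bar> \<le> C"
    and cyl: "\<And>x y. (\<And>i. i < k \<Longrightarrow> x i = y i) \<Longrightarrow> I x = I y"
  shows "(\<integral>x. I x * (F' k x * kern s (x k)) \<partial>unif_seq) = (\<integral>x. I x * zeta k F s x \<partial>unif_seq)"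
proof -
  obtain B where B: "\<And>x. \<bar>F x\<bar> \<le> B"
    by (rule C1_cyl_bounds[OF F]) blast
  note [measurable] = C1_cyl_measurable[OF F]
  have C0: "0 \<le> C" and B0: "0 \<le> B" using C[of undefined] B[of undefined] by simp_all
  have "(\<integral>x. I x * tail k F x \<partial>unif_seq) = (\<integral>x. I x * F x \<partial>unif_seq)"
    by (rule integral_mult_tail[OF C1_cyl_measurable(1)[OF F] I B C cyl])
  moreover have "(\<integral>x. I x * tail (Suc k) F (x(k := s)) \<partial>unif_seq) = (\<integral>x. I x * F (x(k := s)) \<partial>unif_seq)"
  proof -
    have "(mix {Suc k..} x y)(k := s) = mix {Suc k..} (x(k := s)) y" for x y
      by (auto simp: mix_def fun_eq_iff)
    then have "tail (Suc k) F (x(k := s)) = tail (Suc k) (\<lambda>x. F (x(k := s))) x" for x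
      by (simp add: tail_def)
    then have "(\<integral>x. I x * tail (Suc k) F (x(k := s)) \<partial>unif_seq)
        = (\<integral>x. I x * tail (Suc k) (\<lambda>x. F (x(k := s))) x \<partial>unif_seq)"
      by (simp only:)
    also have "\<dots> = (\<integral>x. I x * F (x(k := s)) \<partial>unif_seq)"
    proof (rule integral_mult_tail[OF _ I B C])
      show "I x = I y" if "\<And>i. i < Suc k \<Longrightarrow> x i = y i" for x y
        by (rule cyl) (use that in auto)
    qed measurable
    finally show ?thesis .
  qed
  moreover have "integrable unif_seq (\<lambda>x. I x * tail k F x)"
  proof (rule unif_seq.integrable_const_bound[where B = "C * B"])
    show "AE x in unif_seq. norm (I x * tail k F x) \<le> C * B"
      unfolding real_norm_def abs_mult
      by (intro AE_I2 mult_mono C abs_tail_le B C0 abs_ge_zero) measurable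
  qed measurable
  moreover have "integrable unif_seq (\<lambda>x. I x * tail (Suc k) F (x(k := s)))"
  proof (rule unif_seq.integrable_const_bound[where B = "C * B"])
    show "AE x in unif_seq. norm (I x * tail (Suc k) F (x(k := s))) \<le> C * B"
      unfolding real_norm_def abs_mult
      by (intro AE_I2 mult_mono C abs_tail_le B C0 abs_ge_zero) measurable
  qed measurable
  moreover have "(\<integral>x. I x * (F' k x * kern s (x k)) \<partial>unif_seq)
      = (\<integral>x. I x * F x \<partial>unif_seq) - (\<integral>x. I x * F (x(k := s)) \<partial>unif_seq)"
    by (rule integral_cyl_kern[OF F s I C cyl])
  ultimately show ?thesis
    by (simp add: zeta_def right_diff_distrib)
qed

text \<open>Integrating over \<open>s\<close> resamples the coordinate \<open>k\<close>, which turns the increments of the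
  martingale \<open>tail k F\<close> into a discrete Clark-Ocone formula.\<close>

lemma integral_zeta_kern:
  assumes F: "C1_cyl n F F'" and G: "C1_cyl m G G'"
  shows "(\<integral>s. (\<integral>x. zeta k F s x * (G' k x * kern s (x k)) \<partial>unif_seq) \<partial>unif)
      = (\<integral>x. tail (Suc k) F x * G x \<partial>unif_seq) - (\<integral>x. tail k F x * G x \<partial>unif_seq)"
proof -
  obtain B where B: "\<And>x. \<bar>F x\<bar> \<le> B"
    by (rule C1_cyl_bounds[OF F]) blast
  obtain C where C: "\<And>x. \<bar>G x\<bar> \<le> C"
    by (rule C1_cyl_bounds[OF G]) blast
  note [measurable] = C1_cyl_measurable[OF F] C1_cyl_measurable[OF G]
  have C0: "0 \<le> C" and B0: "0 \<le> B" using C[of undefined] B[of undefined] by simp_all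
  note zb = abs_zeta_le[OF C1_cyl_measurable(1)[OF F] B]
  interpret sx: pair_prob_space unif unif_seq ..
  have i1: "integrable (unif \<Otimes>\<^sub>M unif_seq) (\<lambda>(s, x). zeta k F s x * G x)"
  proof (rule sx.integrable_const_bound[where B = "(2 * B) * C"])
    show "AE z in unif \<Otimes>\<^sub>M unif_seq. norm (case z of (s, x) \<Rightarrow> zeta k F s x * G x) \<le> (2 * B) * C"
      unfolding case_prod_unfold real_norm_def abs_mult using zb C B0 C0
      by (intro AE_I2 mult_mono) auto
  qed measurable
  have i2: "integrable (unif \<Otimes>\<^sub>M unif_seq) (\<lambda>(s, x). zeta k F s x * G (x(k := s)))"
  proof (rule sx.integrable_const_bound[where B = "(2 * B) * C"])
    show "AE z in unif \<Otimes>\<^sub>M unif_seq. norm (case z of (s, x) \<Rightarrow> zeta k F s x * G (x(k := s))) \<le> (2 * B) * C"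
      unfolding case_prod_unfold real_norm_def abs_mult using zb C B0 C0
      by (intro AE_I2 mult_mono) auto
  qed measurable
  have i3: "integrable unif_seq (\<lambda>x. tail j F x * G x)" for j
  proof (rule unif_seq.integrable_const_bound[where B = "B * C"])
    show "AE x in unif_seq. norm (tail j F x * G x) \<le> B * C"
      unfolding real_norm_def abs_mult
      by (intro AE_I2 mult_mono C abs_tail_le B B0 abs_ge_zero) measurable
  qed measurable
  have "(\<integral>s. (\<integral>x. zeta k F s x * (G' k x * kern s (x k)) \<partial>unif_seq) \<partial>unif)
      = (\<integral>s. (\<integral>x. zeta k F s x * G x \<partial>unif_seq) - (\<integral>x. zeta k F s x * G (x(k := s)) \<partial>unif_seq) \<partial>unif)"
  proof (rule integral_cong_AE)
    have "AE s in unif. s \<in> {-1..1}" by (subst AE_uniform_measure) auto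
    then show "AE s in unif. (\<integral>x. zeta k F s x * (G' k x * kern s (x k)) \<partial>unif_seq)
      = (\<integral>x. zeta k F s x * G x \<partial>unif_seq) - (\<integral>x. zeta k F s x * G (x(k := s)) \<partial>unif_seq)"
    proof eventually_elim
      case (elim s)
      \<comment> \<open>Here \<open>zeta k F s\<close> plays the role of \<open>I\<close>: for fixed
        \<open>s\<close> it depends on coordinates below \<open>k\<close> only.\<close>
      show ?case
        by (rule integral_cyl_kern[OF G elim _ zb]) (auto intro: zeta_cong)
    qed
  qed measurable
  also have "\<dots> = (\<integral>s. (\<integral>x. zeta k F s x * G x \<partial>unif_seq) \<partial>unif)
      - (\<integral>s. (\<integral>x. zeta k F s x * G (x(k := s)) \<partial>unif_seq) \<partial>unif)"
    using sx.integrable_fst'[OF i1] sx.integrable_fst'[OF i2]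
    by (intro Bochner_Integration.integral_diff) auto
  also have "(\<integral>s. (\<integral>x. zeta k F s x * G x \<partial>unif_seq) \<partial>unif)
      = (\<integral>x. (\<integral>s. zeta k F s x * G x \<partial>unif) \<partial>unif_seq)"
    by (rule sx.Fubini_integral[symmetric]) (use i1 in simp)
  \<comment> \<open>\<open>G x\<close> does not depend on \<open>s\<close>, and \<open>zeta\<close>
    averages to 0 in \<open>s\<close>.\<close>
  also have "\<dots> = 0"
    using integral_zeta[OF C1_cyl_measurable(1)[OF F] B] by simp
  also have "(\<integral>s. (\<integral>x. zeta k F s x * G (x(k := s)) \<partial>unif_seq) \<partial>unif)
      = (\<integral>x. (\<integral>s. zeta k F s x * G (x(k := s)) \<partial>unif) \<partial>unif_seq)"
    by (rule sx.Fubini_integral[symmetric]) (use i2 in simp)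
  \<comment> \<open>In the other term \<open>s\<close> sits in coordinate \<open>k\<close> of both
    factors. Since \<open>tail k F\<close> ignores that coordinate, it may be evaluated at
    \<open>x(k := s)\<close> too, and the inner integral becomes a resampling of coordinate
    \<open>k\<close>.\<close>
  also have "\<dots> = (\<integral>x. (\<integral>s. (tail k F (x(k := s)) - tail (Suc k) F (x(k := s))) * G (x(k := s)) \<partial>unif) \<partial>unif_seq)"
  proof -
    have "tail k F (x(k := s)) = tail k F x" for x s by (rule tail_cong) auto
    then show ?thesis by (simp add: zeta_def)
  qed
  also have "\<dots> = (\<integral>x. (tail k F x - tail (Suc k) F x) * G x \<partial>unif_seq)"
    using i3[of k] i3[of "Suc k"] by (intro integral_resample_coord) (simp add: left_diff_distrib)
  also have "\<dots> = (\<integral>x. tail k F x * G x \<partial>unif_seq) - (\<integral>x. tail (Suc k) F x * G x \<partial>unif_seq)"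
    using i3[of k] i3[of "Suc k"] by (simp add: left_diff_distrib)
  finally show ?thesis by simp
qed

section \<open>From coordinates to continuous time\<close>

definition slot :: "real \<Rightarrow> nat" where
  "slot t = nat \<lfloor>t / 2\<rfloor>"

text \<open>Time relative to the middle of its slot, on the scale of \<open>U\<close>: the jump of
  the slot occurs when \<open>pos t\<close> equals the uniform variable of that slot.\<close>

definition pos :: "real \<Rightarrow> real" where
  "pos t = t - 2 * real (slot t) - 1"

lemma measurable_slot [measurable (raw)]:
  assumes [measurable]: "f \<in> borel_measurable M"
  shows "(\<lambda>x. slot (f x)) \<in> M \<rightarrow>\<^sub>M count_space UNIV"
  unfolding slot_def by measurable

lemma measurable_pos [measurable (raw)]:
  assumes [measurable]: "f \<in> borel_measurable M"
  shows "(\<lambda>x. pos (f x)) \<in> borel_measurable M"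
  unfolding pos_def by measurable

lemma slot_eq_iff: "0 \<le> t \<Longrightarrow> slot t = k \<longleftrightarrow> 2 * real k \<le> t \<and> t < 2 * real k + 2"
  unfolding slot_def by (auto simp: nat_eq_iff floor_eq_iff)

lemma pos_bounds: "0 \<le> t \<Longrightarrow> pos t \<in> {-1..<1}"
  using slot_eq_iff[of t "slot t"] by (auto simp: pos_def)

lemma sigma_finite_half_line: "sigma_finite_measure half_line"
  by (rule sigma_finite_measure_restrict_space) (auto intro: lborel.sigma_finite_measure_axioms)

interpretation half_line: sigma_finite_measure half_line by (rule sigma_finite_half_line)

text \<open>The factor 2 arises because each slot has length 2 while \<open>unif\<close> has mass
  1.\<close>

lemma integral_half_line_slots:
  fixes h :: "nat \<Rightarrow> real \<Rightarrow> real"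
  assumes meas: "\<And>k. h k \<in> borel_measurable borel" and B: "\<And>k s. s \<in> {-1..1} \<Longrightarrow> \<bar>h k s\<bar> \<le> B"
    and zero: "\<And>k s. n < k \<Longrightarrow> s \<in> {-1..1} \<Longrightarrow> h k s = 0"
  shows "(\<integral>t. h (slot t) (pos t) \<partial>half_line) = (\<Sum>k\<le>n. 2 * (\<integral>s. h k s \<partial>unif))"
proof -
  note [measurable] = meas
  \<comment> \<open>Half-open support makes the translated slots disjoint, so that at each time
    exactly one summand can be nonzero.\<close>
  define g where "g = (\<lambda>k s. indicator {-1..<1} s * h k s)"
  have int_g: "integrable lborel (g k)" for k
  proof (rule Bochner_Integration.integrable_bound[where f = "\<lambda>s. B * indicator {-1..<1} s"])
    show "AE s in lborel. norm (g k s) \<le> norm (B * indicator {-1..<1} s)"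
      using B[of _ k] by (auto simp: g_def indicator_def intro!: AE_I2 order_trans[OF B])
  qed (auto simp: g_def)
  have shift: "(\<integral>t. g k (t - 2 * real k - 1) \<partial>lborel) = 2 * (\<integral>s. h k s \<partial>unif)"
    "integrable lborel (\<lambda>t. g k (t - 2 * real k - 1))" for k
  proof -
    have eq: "(-1 - 2 * real k) + 1 * t = t - 2 * real k - 1" for t by simp
    have "(\<integral>t. g k (t - 2 * real k - 1) \<partial>lborel) = (\<integral>s. g k s \<partial>lborel)"
      using lborel_integral_real_affine[of 1 "g k" "-1 - 2 * real k"] by (simp only: eq) simp
    also have "\<dots> = (\<integral>s. indicator {-1..1} s * h k s \<partial>lborel)"
    proof (rule integral_cong_AE)
      show "AE s in lborel. g k s = indicator {-1..1} s * h k s"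
        using AE_lborel_singleton[of 1] by eventually_elim (auto simp: g_def indicator_def)
    qed (simp_all add: g_def)
    finally show "(\<integral>t. g k (t - 2 * real k - 1) \<partial>lborel) = 2 * (\<integral>s. h k s \<partial>unif)"
      by (simp add: integral_unif)
    show "integrable lborel (\<lambda>t. g k (t - 2 * real k - 1))"
      using lborel_integrable_real_affine[OF int_g, of 1 k "-1 - 2 * real k"] by (simp only: eq)
  qed
  have "(\<integral>t. h (slot t) (pos t) \<partial>half_line) = (\<integral>t. indicator {0..} t * h (slot t) (pos t) \<partial>lborel)"
    by (subst integral_restrict_space) auto
  also have "\<dots> = (\<integral>t. (\<Sum>k\<le>n. g k (t - 2 * real k - 1)) \<partial>lborel)"
  proof (rule Bochner_Integration.integral_cong[OF refl])
    fix t :: real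
    show "indicator {0..} t * h (slot t) (pos t) = (\<Sum>k\<le>n. g k (t - 2 * real k - 1))"
    proof (cases "0 \<le> t")
      case True
      have "g k (t - 2 * real k - 1) = (if k = slot t then h (slot t) (pos t) else 0)" for k
        using slot_eq_iff[OF True, of k] by (auto simp: g_def indicator_def pos_def)
      moreover have "h (slot t) (pos t) = 0" if "\<not> slot t \<le> n"
        using zero[of "slot t" "pos t"] pos_bounds[OF True] that by auto
      ultimately show ?thesis using True by (auto simp: sum.delta)
    next
      case False
      then show ?thesis by (auto simp: g_def indicator_def intro!: sum.neutral[symmetric])
    qed
  qed
  also have "\<dots> = (\<Sum>k\<le>n. 2 * (\<integral>s. h k s \<partial>unif))"
    by (simp add: shift)
  finally show ?thesis .
qed

definition grad :: "(nat \<Rightarrow> (nat \<Rightarrow> real) \<Rightarrow> real) \<Rightarrow> real \<Rightarrow> (nat \<Rightarrow> real) \<Rightarrow> real" where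
  "grad F' t x = F' (slot t) x * kern (pos t) (x (slot t))"

definition pgrad :: "((nat \<Rightarrow> real) \<Rightarrow> real) \<Rightarrow> real \<Rightarrow> (nat \<Rightarrow> real) \<Rightarrow> real" where
  "pgrad F t x = zeta (slot t) F (pos t) x"

lemma measurable_grad [measurable (raw)]:
  assumes [measurable]: "\<And>k. F' k \<in> borel_measurable borel" "f \<in> borel_measurable M" "g \<in> M \<rightarrow>\<^sub>M borel"
  shows "(\<lambda>z. grad F' (f z) (g z)) \<in> borel_measurable M"
  unfolding grad_def
  by (rule measurable_compose_countable[where g = "\<lambda>z. slot (f z)"
        and f = "\<lambda>k z. F' k (g z) * kern (pos (f z)) (g z k)"]) measurable

lemma measurable_pgrad [measurable (raw)]:
  assumes [measurable]: "F \<in> borel_measurable borel" "f \<in> borel_measurable M" "g \<in> M \<rightarrow>\<^sub>M borel"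
  shows "(\<lambda>z. pgrad F (f z) (g z)) \<in> borel_measurable M"
  unfolding pgrad_def
  by (rule measurable_compose_countable[where g = "\<lambda>z. slot (f z)"
        and f = "\<lambda>k z. zeta k F (pos (f z)) (g z)"]) measurable

lemma zeta_eq_0:
  assumes "C1_cyl n F F'" "n < k"
  shows "zeta k F s x = 0"
proof -
  have cyl: "F x = F y" if "\<And>i. i < j \<Longrightarrow> x i = y i" "n < j" for j x y
  proof -
    have "\<forall>i\<le>n. x i = y i" using that by auto
    then show ?thesis using assms(1) unfolding C1_cyl_def by blast
  qed
  have "tail j F x = F x" if "n < j" for j x
    by (rule tail_determined) (use cyl that in blast)
  moreover have "F (x(k := s)) = F x"
    by (rule cyl[of "Suc n"]) (use assms(2) in auto)
  ultimately show ?thesis using assms(2) by (simp add: zeta_def)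
qed

lemma grad_eq_0: "C1_cyl n F F' \<Longrightarrow> n < slot t \<Longrightarrow> grad F' t x = 0"
  by (auto simp: grad_def C1_cyl_def)

lemma pgrad_eq_0: "C1_cyl n F F' \<Longrightarrow> n < slot t \<Longrightarrow> pgrad F t x = 0"
  by (simp add: pgrad_def zeta_eq_0)

lemma less_slot: "2 * real n + 2 \<le> t \<Longrightarrow> n < slot t"
proof -
  assume "2 * real n + 2 \<le> t"
  then have "int (Suc n) \<le> \<lfloor>t / 2\<rfloor>" by (simp add: le_floor_iff)
  then show ?thesis by (simp add: slot_def)
qed

lemma abs_grad_le:
  assumes "\<And>k x. \<bar>F' k x\<bar> \<le> B" "\<And>k. x k \<in> {-1..1}"
  shows "\<bar>grad F' t x\<bar> \<le> 2 * B"
proof -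
  have "0 \<le> B" using assms(1)[of 0 x] by simp
  then have "\<bar>F' (slot t) x\<bar> * \<bar>kern (pos t) (x (slot t))\<bar> \<le> B * 2"
    using assms by (intro mult_mono abs_kern_le) auto
  then show ?thesis by (simp add: grad_def abs_mult)
qed

lemma integral_cyl_grad:
  assumes F: "C1_cyl n F F'" and t: "0 \<le> t"
    and I: "I \<in> borel_measurable borel" and C: "\<And>x. \<bar>I x\<bar> \<le> C"
    and cyl: "\<And>x y. (\<And>i. i < slot t \<Longrightarrow> x i = y i) \<Longrightarrow> I x = I y"
  shows "(\<integral>x. I x * grad F' t x \<partial>unif_seq) = (\<integral>x. I x * pgrad F t x \<partial>unif_seq)"
  unfolding grad_def pgrad_def
  by (rule integral_cyl_kern_zeta[OF F _ I C cyl]) (use pos_bounds[OF t] in auto)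

text \<open>Each slot contributes twice an increment of \<open>tail k F\<close> tested against
  \<open>G\<close>. The sum starts at the constant \<open>tail 0 F\<close>, the mean of
  \<open>F\<close>, and stops at \<open>tail (Suc n) F\<close>, which is \<open>F\<close> itself
  since \<open>F\<close> depends on coordinates up to \<open>n\<close>.\<close>

theorem integral_pgrad_grad:
  assumes F: "C1_cyl n F F'" and G: "C1_cyl m G G'"
  shows "(\<integral>t. (\<integral>x. pgrad F t x * grad G' t x \<partial>unif_seq) \<partial>half_line)
      = 2 * ((\<integral>x. F x * G x \<partial>unif_seq) - (\<integral>x. F x \<partial>unif_seq) * (\<integral>x. G x \<partial>unif_seq))"
proof -
  obtain B where B: "\<And>x. \<bar>F x\<bar> \<le> B" by (rule C1_cyl_bounds[OF F]) blast
  obtain C where C: "\<And>x. \<bar>G x\<bar> \<le> C" "\<And>k x. \<bar>G' k x\<bar> \<le> C" by (rule C1_cyl_bounds[OF G]) blast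
  have C0: "0 \<le> C" and B0: "0 \<le> B" using C(1)[of undefined] B[of undefined] by simp_all
  note [measurable] = C1_cyl_measurable[OF F] C1_cyl_measurable[OF G]
  have telescope: "(\<Sum>k\<le>n. a (Suc k) - a k) = a (Suc n) - a 0" for a :: "nat \<Rightarrow> real"
    by (induction n) auto
  let ?h = "\<lambda>k s. \<integral>x. zeta k F s x * (G' k x * kern s (x k)) \<partial>unif_seq"
  have "(\<integral>t. ?h (slot t) (pos t) \<partial>half_line) = (\<Sum>k\<le>n. 2 * (\<integral>s. ?h k s \<partial>unif))"
  proof (rule integral_half_line_slots)
    show "?h k \<in> borel_measurable borel" for k by measurable
    show "\<bar>?h k s\<bar> \<le> (2 * B) * (C * 2)" for k s
    proof -
      have bound: "AE x in unif_seq. norm (zeta k F s x * (G' k x * kern s (x k))) \<le> (2 * B) * (C * 2)"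
        using AE_unif_seq_cube
      proof eventually_elim
        case (elim x)
        then show ?case unfolding real_norm_def abs_mult
          using C C0 B0 abs_zeta_le[OF C1_cyl_measurable(1)[OF F] B]
          by (intro mult_mono abs_kern_le) auto
      qed
      have "norm (?h k s) \<le> (\<integral>x. norm (zeta k F s x * (G' k x * kern s (x k))) \<partial>unif_seq)"
        by (rule integral_norm_bound)
      also have "\<dots> \<le> (\<integral>x. (2 * B) * (C * 2) \<partial>unif_seq)"
        using bound B0 C0
        by (intro integral_mono_AE unif_seq.integrable_const_bound[where B = "(2 * B) * (C * 2)"])
          (auto intro: mult_nonneg_nonneg)
      finally show ?thesis by simp
    qed
    show "?h k s = 0" if "n < k" for k s
      using zeta_eq_0[OF F that] by simp
  qed
  also have "\<dots> = 2 * (\<Sum>k\<le>n. (\<integral>x. tail (Suc k) F x * G x \<partial>unif_seq) - (\<integral>x. tail k F x * G x \<partial>unif_seq))"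
    unfolding integral_zeta_kern[OF F G] by (simp add: sum_distrib_left)
  also have "\<dots> = 2 * ((\<integral>x. tail (Suc n) F x * G x \<partial>unif_seq) - (\<integral>x. tail 0 F x * G x \<partial>unif_seq))"
    by (simp add: telescope[of "\<lambda>k. \<integral>x. tail k F x * G x \<partial>unif_seq"])
  also have "(\<integral>x. tail (Suc n) F x * G x \<partial>unif_seq) = (\<integral>x. F x * G x \<partial>unif_seq)"
  proof -
    have "tail (Suc n) F x = F x" for x
      by (rule tail_determined) (use F in \<open>auto simp: C1_cyl_def\<close>)
    then show ?thesis by simp
  qed
  finally show ?thesis by (simp add: tail_0 grad_def pgrad_def)
qed

section \<open>The jump filtration\<close>

text \<open>Excluding the endpoints puts each jump strictly inside its slot, so that at the even
  times, where the filtrations are read off, the past consists of exactly the earlier slots.\<close>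

lemma AE_unif_seq_open_cube: "AE x in unif_seq. \<forall>k. x k \<in> {-1<..<1}"
proof -
  have "AE v in lborel. v \<in> {-1..1} \<longrightarrow> v \<in> {-1<..<1::real}"
    using AE_lborel_singleton[of "-1"] AE_lborel_singleton[of 1] by eventually_elim auto
  then have "AE v in unif. v \<in> {-1<..<1}"
    by (subst AE_uniform_measure) auto
  then show ?thesis
    unfolding AE_all_countable using prob_space_unif
    by (intro allI AE_PiM_component) auto
qed

locale uniform_jumps = prob_space M for M :: "'a measure" +
  fixes U :: "nat \<Rightarrow> 'a \<Rightarrow> real"
  assumes indep: "indep_vars (\<lambda>_. borel) U UNIV"
    and dist: "\<And>k. distr M borel (U k) = uniform_measure lborel {-1..1}"
begin

definition V :: "'a \<Rightarrow> nat \<Rightarrow> real" where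
  "V \<omega> = (\<lambda>k. U k \<omega>)"

lemma measurable_U [measurable]: "U k \<in> borel_measurable M"
  using indep by (auto simp: indep_vars_def)

lemma measurable_V [measurable]: "V \<in> M \<rightarrow>\<^sub>M borel"
  by (rule measurable_seqI) (simp add: V_def)

lemma distr_V: "distr M unif_seq V = unif_seq"
proof -
  have "distr M (PiM UNIV (\<lambda>_. borel)) (\<lambda>x. \<lambda>i\<in>UNIV. U i x) = PiM UNIV (\<lambda>i. distr M borel (U i))"
    using indep_vars_iff_distr_eq_PiM'[where I = UNIV and M' = "\<lambda>_. borel" and X = U] indep by simp
  moreover have "(\<lambda>x. \<lambda>i\<in>UNIV. U i x) = V" by (auto simp: V_def fun_eq_iff)
  moreover have "distr M (PiM UNIV (\<lambda>_. borel)) V = distr M unif_seq V"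
    by (rule distr_cong) (auto simp: sets_unif_seq sets_PiM_equal_borel)
  ultimately show ?thesis by (simp add: dist)
qed

lemma integral_V:
  fixes G :: "(nat \<Rightarrow> real) \<Rightarrow> real"
  assumes "G \<in> borel_measurable borel"
  shows "(\<integral>\<omega>. G (V \<omega>) \<partial>M) = (\<integral>x. G x \<partial>unif_seq)"
proof -
  have "(\<integral>x. G x \<partial>distr M unif_seq V) = (\<integral>\<omega>. G (V \<omega>) \<partial>M)"
    using assms by (intro integral_distr) simp_all
  then show ?thesis by (simp add: distr_V)
qed

lemma AE_V: "AE x in unif_seq. Q x \<Longrightarrow> AE \<omega> in M. Q (V \<omega>)"
  by (rule AE_distrD[of V M unif_seq]) (simp, unfold distr_V)

lemma AE_U: "AE \<omega> in M. \<forall>k. U k \<omega> \<in> {-1<..<1}"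
  using AE_V[OF AE_unif_seq_open_cube] by (simp add: V_def)

lemma measurable_jump_process [measurable]: "jump_process U s \<in> borel_measurable M"
proof -
  have "(\<lambda>\<omega>. indicator {2 * real k + 1 + U k \<omega>..} s :: real) \<in> borel_measurable M" for k
    unfolding indicator_def atLeast_iff by measurable
  then show ?thesis unfolding jump_process_def by measurable
qed

text \<open>Jumps with index at least \<open>k\<close> occur strictly after time \<open>2 k\<close>,
  because \<open>U j > -1\<close>.\<close>

lemma jump_process_eq:
  assumes U: "\<And>k. U k \<omega> \<in> {-1<..<1}" and s: "s \<le> 2 * real k"
  shows "jump_process U s \<omega> = (\<Sum>j<k. indicator {2 * real j + 1 + U j \<omega>..} s)"
  unfolding jump_process_def
proof (rule suminf_finite)
  fix j assume "j \<notin> {..<k}"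
  then have "real k \<le> real j" by simp
  then show "indicator {2 * real j + 1 + U j \<omega>..} s = 0"
    using U[of j] s by (auto simp: indicator_def)
qed simp

lemma jump_process_between:
  assumes U: "\<And>k. U k \<omega> \<in> {-1<..<1}" and q: "0 \<le> q" "q < 2"
  shows "jump_process U (2 * real j + q) \<omega> = real j + indicator {1 + U j \<omega>..} q"
proof -
  have "jump_process U (2 * real j + q) \<omega>
      = (\<Sum>i<j. indicator {2 * real i + 1 + U i \<omega>..} (2 * real j + q)) + indicator {1 + U j \<omega>..} q"
    using q by (subst jump_process_eq[OF U, of _ "Suc j"]) (auto simp: indicator_def)
  also have "(\<Sum>i<j. indicator {2 * real i + 1 + U i \<omega>..} (2 * real j + q)) = (\<Sum>i<j. 1)"
  proof (intro sum.cong refl)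
    fix i assume "i \<in> {..<j}"
    then have "real i + 1 \<le> real j" by auto
    then show "indicator {2 * real i + 1 + U i \<omega>..} (2 * real j + q) = 1"
      using U[of i] q by (auto simp: indicator_def)
  qed
  finally show ?thesis by simp
qed

lemma space_jump_filtration [simp]: "space (jump_filtration M U t) = space M"
  unfolding jump_filtration_def by (rule space_measure_of) auto

lemma sets_jump_filtration:
  "sets (jump_filtration M U t)
     = sigma_sets (space M) (\<Union>s\<in>{0..t}. {jump_process U s -` A \<inter> space M | A. A \<in> sets borel})"
  unfolding jump_filtration_def by (rule sets_measure_of) auto

lemma subalgebra_jump_filtration: "subalgebra M (jump_filtration M U t)"
  unfolding subalgebra_def sets_jump_filtration
  by (auto intro!: sets.sigma_sets_subset measurable_sets[OF measurable_jump_process])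

lemma measurable_jump_process_filtration:
  assumes "0 \<le> s" "s \<le> t"
  shows "jump_process U s \<in> borel_measurable (jump_filtration M U t)"
proof (rule measurableI)
  fix A :: "real set" assume "A \<in> sets borel"
  then show "jump_process U s -` A \<inter> space (jump_filtration M U t) \<in> sets (jump_filtration M U t)"
    using assms unfolding sets_jump_filtration space_jump_filtration
    by (intro sigma_sets.Basic UN_I[of s]) auto
qed simp

text \<open>The agreement is only almost sure: the jump process is a function of the first
  \<open>k\<close> coordinates only where all \<open>U j\<close> lie strictly between -1 and
  1.\<close>

definition cyl_event :: "nat \<Rightarrow> 'a set \<Rightarrow> (nat \<Rightarrow> real) set \<Rightarrow> bool" where
  "cyl_event k A B \<longleftrightarrow> B \<in> sets borel \<and> (\<forall>x y. (\<forall>i<k. x i = y i) \<longrightarrow> x \<in> B \<longleftrightarrow> y \<in> B) \<and>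
     (AE \<omega> in M. \<omega> \<in> A \<longleftrightarrow> V \<omega> \<in> B)"

text \<open>One half of the identification of the filtration at time \<open>2 k\<close> with the
  first \<open>k\<close> coordinates, by induction over the generated sigma-algebra. The other half,
  that these coordinates are measurable up to null sets, is supplied by \<open>W\<close>.\<close>

lemma jump_filtration_cyl:
  assumes "A \<in> sets (jump_filtration M U (2 * real k))"
  shows "\<exists>B. cyl_event k A B"
  using assms unfolding sets_jump_filtration
proof (induction rule: sigma_sets.induct)
  case (Basic A)
  then obtain s C where s: "s \<le> 2 * real k" and C [measurable]: "C \<in> sets borel"
    and A: "A = jump_process U s -` C \<inter> space M" by auto
  define y :: "(nat \<Rightarrow> real) \<Rightarrow> real"
    where "y x = (\<Sum>j<k. indicator {2 * real j + 1 + x j..} s)" for x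
  have [measurable]: "y \<in> borel_measurable borel"
  proof -
    have "(\<lambda>x. indicator {2 * real j + 1 + x j..} s :: real) \<in> borel_measurable borel" for j
      using measurable_seq_component[of j, measurable] unfolding indicator_def atLeast_iff by measurable
    then show ?thesis unfolding y_def by measurable
  qed
  have "cyl_event k A (y -` C)"
    unfolding cyl_event_def
  proof (intro conjI allI impI)
    show "y -` C \<in> sets borel"
      using measurable_sets[OF \<open>y \<in> borel_measurable borel\<close> C] by simp
    show "x \<in> y -` C \<longleftrightarrow> x' \<in> y -` C" if "\<forall>i<k. x i = x' i" for x x'
    proof -
      have "y x = y x'" unfolding y_def using that by (intro sum.cong) auto
      then show ?thesis by simp
    qed
    show "AE \<omega> in M. \<omega> \<in> A \<longleftrightarrow> V \<omega> \<in> y -` C"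
      using AE_U AE_space
    proof eventually_elim
      case (elim \<omega>)
      then have "jump_process U s \<omega> = y (V \<omega>)"
        unfolding y_def V_def by (intro jump_process_eq s) auto
      then show ?case using elim by (simp add: A)
    qed
  qed
  then show ?case by blast
next
  case Empty
  have "cyl_event k {} {}" by (simp add: cyl_event_def)
  then show ?case by blast
next
  case (Compl A)
  then obtain B where B: "cyl_event k A B" by blast
  have "cyl_event k (space M - A) (- B)"
    unfolding cyl_event_def
  proof (intro conjI)
    show "- B \<in> sets borel" using B by (auto simp: cyl_event_def)
    show "\<forall>x y. (\<forall>i<k. x i = y i) \<longrightarrow> (x \<in> - B) = (y \<in> - B)"
      using B by (auto simp: cyl_event_def)
    have "AE \<omega> in M. \<omega> \<in> A \<longleftrightarrow> V \<omega> \<in> B" using B by (simp add: cyl_event_def)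
    then show "AE \<omega> in M. \<omega> \<in> space M - A \<longleftrightarrow> V \<omega> \<in> - B"
      using AE_space by eventually_elim auto
  qed
  then show ?case by blast
next
  case (Union A)
  then have "\<forall>i. \<exists>B. cyl_event k (A i) B" by blast
  then obtain B where B: "\<And>i. cyl_event k (A i) (B i)" by metis
  have "cyl_event k (\<Union>i. A i) (\<Union>i. B i)"
    unfolding cyl_event_def
  proof (intro conjI)
    show "(\<Union>i. B i) \<in> sets borel" using B by (auto simp: cyl_event_def)
    show "\<forall>x y. (\<forall>i<k. x i = y i) \<longrightarrow> (x \<in> (\<Union>i. B i)) = (y \<in> (\<Union>i. B i))"
      using B unfolding cyl_event_def UN_iff by blast
    have "AE \<omega> in M. \<forall>i. \<omega> \<in> A i \<longleftrightarrow> V \<omega> \<in> B i"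
      unfolding AE_all_countable using B by (simp add: cyl_event_def)
    then show "AE \<omega> in M. \<omega> \<in> (\<Union>i. A i) \<longleftrightarrow> V \<omega> \<in> (\<Union>i. B i)"
      by eventually_elim auto
  qed
  then show ?case by blast
qed

text \<open>On the time interval \<open>[2 j, 2 j + 2)\<close> the process is equal to \<open>j\<close> exactly before the time
  \<open>2 j + 1 + U j\<close>, so the jump time is a supremum over rational times.\<close>

definition W :: "nat \<Rightarrow> 'a \<Rightarrow> real" where
  "W j \<omega> = (SUP q\<in>{0..<2} \<inter> \<rat>. if jump_process U (2 * real j + q) \<omega> < real j + 1 then q else 0) - 1"

lemma measurable_W:
  assumes "j < k"
  shows "W j \<in> borel_measurable (jump_filtration M U (2 * real k))"
proof -
  have m: "jump_process U (2 * real j + q) \<in> borel_measurable (jump_filtration M U (2 * real k))"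
    if "q \<in> {0..<2} \<inter> \<rat>" for q
  proof (rule measurable_jump_process_filtration)
    have "real j + 1 \<le> real k" using assms by simp
    then show "2 * real j + q \<le> 2 * real k" using that by simp
  qed (use that in auto)
  have "countable ({0..<2} \<inter> \<rat> :: real set)"
    by (rule countable_subset[OF _ countable_rat]) auto
  moreover have "(\<lambda>\<omega>. if jump_process U (2 * real j + q) \<omega> < real j + 1 then q else 0)
      \<in> borel_measurable (jump_filtration M U (2 * real k))" if "q \<in> {0..<2} \<inter> \<rat>" for q
    using m[OF that] by measurable
  ultimately show ?thesis
    unfolding W_def
    by (intro borel_measurable_diff borel_measurable_cSUP borel_measurable_const)
       (auto intro!: bdd_aboveI[where M = 2])
qed

lemma W_eq:
  assumes U: "\<And>k. U k \<omega> \<in> {-1<..<1}"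
  shows "W j \<omega> = U j \<omega>"
proof -
  let ?I = "{0..<2} \<inter> \<rat> :: real set"
  \<comment> \<open>The default 0 taken after the jump cannot affect the supremum, since
    \<open>1 + U j \<omega>\<close> is positive.\<close>
  let ?f = "\<lambda>q::real. if q < 1 + U j \<omega> then q else 0"
  have "(SUP q\<in>?I. if jump_process U (2 * real j + q) \<omega> < real j + 1 then q else 0) = (SUP q\<in>?I. ?f q)"
    by (intro SUP_cong refl) (auto simp: jump_process_between[OF U] indicator_def)
  also have "\<dots> = 1 + U j \<omega>"
  proof (rule antisym)
    show "(SUP q\<in>?I. ?f q) \<le> 1 + U j \<omega>"
    proof (rule cSUP_least)
      have "(0::real) \<in> ?I" by simp
      then show "?I \<noteq> {}" by blast
    qed (use U[of j] in auto)
    show "1 + U j \<omega> \<le> (SUP q\<in>?I. ?f q)"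
    proof (rule dense_le_bounded[of 0])
      show "0 < 1 + U j \<omega>" using U[of j] by simp
      fix w assume w: "0 < w" "w < 1 + U j \<omega>"
      obtain q where q: "q \<in> \<rat>" "w < q" "q < 1 + U j \<omega>"
        using Rats_dense_in_real[OF w(2)] by blast
      have "q \<le> (SUP q\<in>?I. ?f q)"
      proof (rule cSUP_upper2[where x = q])
        show "bdd_above (?f ` ?I)" by (auto intro!: bdd_aboveI[where M = 2])
      qed (use q w U[of j] in auto)
      then show "w \<le> (SUP q\<in>?I. ?f q)" using q by simp
    qed
  qed
  finally show ?thesis by (simp add: W_def)
qed

end

section \<open>Square-integrable functions\<close>

definition sqint :: "'a measure \<Rightarrow> ('a \<Rightarrow> real) \<Rightarrow> bool" where
  "sqint N f \<longleftrightarrow> f \<in> borel_measurable N \<and> integrable N (\<lambda>x. (f x)\<^sup>2)"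

lemma L2norm_eq:
  assumes "sqint N f"
  shows "L2norm N f = ennreal (sqrt (\<integral>x. (f x)\<^sup>2 \<partial>N))"
proof -
  have "(\<integral>\<^sup>+x. ennreal ((f x)\<^sup>2) \<partial>N) = ennreal (\<integral>x. (f x)\<^sup>2 \<partial>N)"
    using assms by (intro nn_integral_eq_integral) (auto simp: sqint_def)
  then show ?thesis by (simp add: L2norm_def)
qed

lemma L2norm_infinite:
  assumes "f \<in> borel_measurable N" "\<not> sqint N f"
  shows "L2norm N f = \<infinity>"
proof (rule ccontr)
  assume "L2norm N f \<noteq> \<infinity>"
  then have "(\<integral>\<^sup>+x. ennreal ((f x)\<^sup>2) \<partial>N) < \<infinity>"
    by (auto simp: L2norm_def Let_def less_top split: if_splits)
  then have "integrable N (\<lambda>x. (f x)\<^sup>2)"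
    using assms(1) by (intro integrableI_nonneg) auto
  with assms show False by (simp add: sqint_def)
qed

lemma in_L2_iff_sqint: "in_L2 N f \<longleftrightarrow> sqint N f"
proof (cases "sqint N f")
  case True
  then show ?thesis using L2norm_eq[OF True] by (auto simp: in_L2_def sqint_def less_top)
next
  case False
  then show ?thesis using L2norm_infinite[of f N] by (auto simp: in_L2_def)
qed

lemma L2norm_cong_AE:
  assumes "AE x in N. f x = g x"
  shows "L2norm N f = L2norm N g"
proof -
  have "(\<integral>\<^sup>+x. ennreal ((f x)\<^sup>2) \<partial>N) = (\<integral>\<^sup>+x. ennreal ((g x)\<^sup>2) \<partial>N)"
    by (rule nn_integral_cong_AE) (use assms in auto)
  then show ?thesis by (simp add: L2norm_def)
qed

lemma sqint_mult_integrable: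
  assumes f: "sqint N f" and g: "sqint N g"
  shows "integrable N (\<lambda>x. f x * g x)"
proof (rule Bochner_Integration.integrable_bound)
  show "integrable N (\<lambda>x. (f x)\<^sup>2 + (g x)\<^sup>2)"
    using assms by (auto simp: sqint_def)
  have "\<bar>a * b\<bar> \<le> a\<^sup>2 + b\<^sup>2" for a b :: real
  proof -
    have "0 \<le> (\<bar>a\<bar> - \<bar>b\<bar>)\<^sup>2" by simp
    then have "2 * \<bar>a * b\<bar> \<le> a\<^sup>2 + b\<^sup>2" by (simp add: power2_diff abs_mult)
    then show ?thesis by linarith
  qed
  then show "AE x in N. norm (f x * g x) \<le> norm ((f x)\<^sup>2 + (g x)\<^sup>2)"
    by (intro AE_I2) simp
qed (use assms in \<open>auto simp: sqint_def\<close>)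

lemma sqint_diff:
  assumes f: "sqint N f" and g: "sqint N g"
  shows "sqint N (\<lambda>x. f x - g x)"
  using assms sqint_mult_integrable[OF assms] by (auto simp: sqint_def power2_diff mult.assoc)

lemma sqint_add:
  assumes f: "sqint N f" and g: "sqint N g"
  shows "sqint N (\<lambda>x. f x + g x)"
  using assms sqint_mult_integrable[OF assms] by (auto simp: sqint_def power2_sum mult.assoc)

lemma sqint_cmult: "sqint N f \<Longrightarrow> sqint N (\<lambda>x. c * f x)"
  by (auto simp: sqint_def power_mult_distrib)

lemma sqint_abs: "sqint N f \<Longrightarrow> sqint N (\<lambda>x. \<bar>f x\<bar>)"
  by (auto simp: sqint_def)

lemma sqint_bound:
  assumes "sqint N f" "g \<in> borel_measurable N" "AE x in N. \<bar>g x\<bar> \<le> \<bar>f x\<bar>"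
  shows "sqint N g"
  unfolding sqint_def
proof (intro conjI Bochner_Integration.integrable_bound[of N "\<lambda>x. (f x)\<^sup>2" "\<lambda>x. (g x)\<^sup>2"])
  show "AE x in N. norm ((g x)\<^sup>2) \<le> norm ((f x)\<^sup>2)"
    using assms(3) by eventually_elim (simp add: abs_le_square_iff)
qed (use assms in \<open>auto simp: sqint_def\<close>)

lemma discriminant_le:
  fixes A B C :: real
  assumes pos: "\<And>t. 0 \<le> A - 2 * t * B + t\<^sup>2 * C" and C: "0 \<le> C"
  shows "B\<^sup>2 \<le> A * C"
proof (cases "C = 0")
  case True
  have "B = 0"
  proof (rule ccontr)
    assume "B \<noteq> 0"
    \<comment> \<open>With \<open>C = 0\<close> the polynomial is linear in \<open>t\<close>; this
      choice gives it the value -1.\<close>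
    then show False using pos[of "(A + 1) / (2 * B)"] True by (simp add: field_simps)
  qed
  then show ?thesis using pos[of 0] C by simp
next
  case False
  with C have "0 < C" by simp
  have "0 \<le> C * (A - 2 * (B / C) * B + (B / C)\<^sup>2 * C)"
    using pos[of "B / C"] C by simp
  also have "\<dots> = A * C - B\<^sup>2"
    using \<open>0 < C\<close> by (simp add: field_simps power2_eq_square)
  finally show ?thesis by simp
qed

lemma Cauchy_Schwarz_sqint:
  assumes f: "sqint N f" and g: "sqint N g"
  shows "\<bar>\<integral>x. f x * g x \<partial>N\<bar> \<le> sqrt (\<integral>x. (f x)\<^sup>2 \<partial>N) * sqrt (\<integral>x. (g x)\<^sup>2 \<partial>N)"
proof -
  have "(\<integral>x. f x * g x \<partial>N)\<^sup>2 \<le> (\<integral>x. (f x)\<^sup>2 \<partial>N) * (\<integral>x. (g x)\<^sup>2 \<partial>N)"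
  proof (rule discriminant_le)
    fix t :: real
    have "0 \<le> (\<integral>x. (f x - t * g x)\<^sup>2 \<partial>N)" by simp
    also have "(\<lambda>x. (f x - t * g x)\<^sup>2) = (\<lambda>x. (f x)\<^sup>2 - 2 * t * (f x * g x) + t\<^sup>2 * (g x)\<^sup>2)"
      by (simp add: power2_diff power_mult_distrib fun_eq_iff algebra_simps)
    also have "(\<integral>x. (f x)\<^sup>2 - 2 * t * (f x * g x) + t\<^sup>2 * (g x)\<^sup>2 \<partial>N)
        = (\<integral>x. (f x)\<^sup>2 \<partial>N) - 2 * t * (\<integral>x. f x * g x \<partial>N) + t\<^sup>2 * (\<integral>x. (g x)\<^sup>2 \<partial>N)"
      using f g sqint_mult_integrable[OF f g] by (simp add: sqint_def)
    finally show "0 \<le> (\<integral>x. (f x)\<^sup>2 \<partial>N) - 2 * t * (\<integral>x. f x * g x \<partial>N) + t\<^sup>2 * (\<integral>x. (g x)\<^sup>2 \<partial>N)" .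
  qed simp
  then have "sqrt ((\<integral>x. f x * g x \<partial>N)\<^sup>2) \<le> sqrt ((\<integral>x. (f x)\<^sup>2 \<partial>N) * (\<integral>x. (g x)\<^sup>2 \<partial>N))"
    by (rule real_sqrt_le_mono)
  then show ?thesis by (simp add: real_sqrt_mult)
qed

lemma tendsto_L2_abs_mult:
  assumes u: "\<And>m. sqint N (u m)" and g: "sqint N g"
    and lim: "(\<lambda>m. \<integral>x. (u m x)\<^sup>2 \<partial>N) \<longlonglongrightarrow> 0"
  shows "(\<lambda>m. \<integral>x. \<bar>u m x\<bar> * \<bar>g x\<bar> \<partial>N) \<longlonglongrightarrow> 0"
proof (rule tendsto_sandwich[OF _ _ tendsto_const])
  have "(\<lambda>m. sqrt (\<integral>x. (u m x)\<^sup>2 \<partial>N) * sqrt (\<integral>x. (g x)\<^sup>2 \<partial>N))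
      \<longlonglongrightarrow> sqrt 0 * sqrt (\<integral>x. (g x)\<^sup>2 \<partial>N)"
    by (intro tendsto_intros lim)
  then show "(\<lambda>m. sqrt (\<integral>x. (u m x)\<^sup>2 \<partial>N) * sqrt (\<integral>x. (g x)\<^sup>2 \<partial>N)) \<longlonglongrightarrow> 0"
    by simp
  show "\<forall>\<^sub>F m in sequentially. (\<integral>x. \<bar>u m x\<bar> * \<bar>g x\<bar> \<partial>N)
      \<le> sqrt (\<integral>x. (u m x)\<^sup>2 \<partial>N) * sqrt (\<integral>x. (g x)\<^sup>2 \<partial>N)"
    using Cauchy_Schwarz_sqint[OF sqint_abs[OF u] sqint_abs[OF g]] by (auto intro!: always_eventually)
qed auto

lemma tendsto_L2_mult:
  assumes u: "\<And>m. sqint N (u m)" "sqint N v" and g: "sqint N g"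
    and lim: "(\<lambda>m. \<integral>x. (v x - u m x)\<^sup>2 \<partial>N) \<longlonglongrightarrow> 0"
  shows "(\<lambda>m. \<integral>x. g x * u m x \<partial>N) \<longlonglongrightarrow> (\<integral>x. g x * v x \<partial>N)"
proof -
  have "(\<lambda>m. (\<integral>x. g x * v x \<partial>N) - (\<integral>x. g x * u m x \<partial>N)) \<longlonglongrightarrow> 0"
  proof (rule Lim_null_comparison[OF _ tendsto_L2_abs_mult[OF sqint_diff[OF u(2) u(1)] g lim]])
    show "\<forall>\<^sub>F m in sequentially. norm ((\<integral>x. g x * v x \<partial>N) - (\<integral>x. g x * u m x \<partial>N))
        \<le> (\<integral>x. \<bar>v x - u m x\<bar> * \<bar>g x\<bar> \<partial>N)"
    proof (intro always_eventually allI)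
      fix m
      have "(\<integral>x. g x * v x \<partial>N) - (\<integral>x. g x * u m x \<partial>N) = (\<integral>x. (v x - u m x) * g x \<partial>N)"
        using sqint_mult_integrable[OF g u(2)] sqint_mult_integrable[OF g u(1)[of m]]
        by (simp add: algebra_simps)
      then show "norm ((\<integral>x. g x * v x \<partial>N) - (\<integral>x. g x * u m x \<partial>N))
          \<le> (\<integral>x. \<bar>v x - u m x\<bar> * \<bar>g x\<bar> \<partial>N)"
        using integral_norm_bound[of N "\<lambda>x. (v x - u m x) * g x"] by (simp add: abs_mult)
    qed
  qed
  then have "(\<lambda>m. (\<integral>x. g x * v x \<partial>N) - ((\<integral>x. g x * v x \<partial>N) - (\<integral>x. g x * u m x \<partial>N)))
      \<longlonglongrightarrow> (\<integral>x. g x * v x \<partial>N) - 0"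
    by (intro tendsto_intros)
  then show ?thesis by simp
qed

lemma L2norm_tendsto_0:
  assumes u: "\<And>m. sqint N (u m)" and lim: "(\<lambda>m. L2norm N (u m)) \<longlonglongrightarrow> 0"
  shows "(\<lambda>m. \<integral>x. (u m x)\<^sup>2 \<partial>N) \<longlonglongrightarrow> 0"
proof -
  have "(\<lambda>m. ennreal (sqrt (\<integral>x. (u m x)\<^sup>2 \<partial>N))) \<longlonglongrightarrow> ennreal 0"
    using lim by (simp add: L2norm_eq[OF u])
  then have "(\<lambda>m. sqrt (\<integral>x. (u m x)\<^sup>2 \<partial>N)) \<longlonglongrightarrow> 0"
    by (subst (asm) tendsto_ennreal_iff) auto
  then have "(\<lambda>m. (sqrt (\<integral>x. (u m x)\<^sup>2 \<partial>N))\<^sup>2) \<longlonglongrightarrow> 0\<^sup>2"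
    by (rule tendsto_power)
  then show ?thesis by simp
qed

lemma AE_pair_fst:
  assumes "sigma_finite_measure N" "AE x in M. Q x"
  shows "AE z in M \<Otimes>\<^sub>M N. Q (fst z)"
proof -
  interpret N: sigma_finite_measure N by fact
  obtain A where A: "A \<in> null_sets M" "{x \<in> space M. \<not> Q x} \<subseteq> A"
    using assms(2) by (auto simp: eventually_ae_filter)
  have "A \<times> space N \<in> null_sets (M \<Otimes>\<^sub>M N)"
    using A by (auto simp: null_sets_def N.emeasure_pair_measure_Times)
  then show ?thesis
    by (rule AE_I') (use A in \<open>auto simp: space_pair_measure\<close>)
qed

lemma AE_pair_snd:
  assumes "sigma_finite_measure N" "AE x in N. Q x"
  shows "AE z in M \<Otimes>\<^sub>M N. Q (snd z)"
proof -
  interpret N: sigma_finite_measure N by fact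
  obtain A where A: "A \<in> null_sets N" "{x \<in> space N. \<not> Q x} \<subseteq> A"
    using assms(2) by (auto simp: eventually_ae_filter)
  have "space M \<times> A \<in> null_sets (M \<Otimes>\<^sub>M N)"
    using A by (auto simp: null_sets_def N.emeasure_pair_measure_Times)
  then show ?thesis
    by (rule AE_I') (use A in \<open>auto simp: space_pair_measure\<close>)
qed

definition clamp_seq :: "nat \<Rightarrow> (nat \<Rightarrow> real) \<Rightarrow> nat \<Rightarrow> real" where
  "clamp_seq n x = (\<lambda>k\<in>{..n}. max (-1) (min 1 (x k)))"

lemma continuous_clamp_seq: "continuous_on UNIV (clamp_seq n)"
proof (rule continuous_on_coordinatewise_then_product)
  show "continuous_on UNIV (\<lambda>x. clamp_seq n x i)" for i
  proof (cases "i \<le> n")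
    case True
    then show ?thesis
      by (auto simp: clamp_seq_def intro!: continuous_on_max continuous_on_min continuous_on_const
          continuous_on_product_coordinates)
  qed (simp add: clamp_seq_def)
qed

lemma clamp_seq_in_cube: "clamp_seq n x \<in> cube n"
  by (auto simp: clamp_seq_def cube_def)

lemma clamp_seq_restrict:
  assumes "\<And>k. x k \<in> {-1..1}"
  shows "clamp_seq n x = (\<lambda>k\<in>{..n}. x k)"
proof -
  have "max (-1) (min 1 (x k)) = x k" for k using assms[of k] by auto
  then show ?thesis by (simp add: clamp_seq_def)
qed

lemma clamp_seq_upd:
  assumes "k \<le> n" "v \<in> {-1..1}"
  shows "clamp_seq n (x(k := v)) = (clamp_seq n x)(k := v)"
  using assms by (auto simp: clamp_seq_def fun_eq_iff)

text \<open>Composing with the retraction \<open>clamp_seq\<close> onto the cube gives a representative that is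
  continuous, hence measurable, everywhere.\<close>

lemma C1_cyl_clamp:
  assumes f: "C1b_on_cube n f f'"
  shows "C1_cyl n (\<lambda>x. f (clamp_seq n x)) (\<lambda>k x. if k \<le> n then f' k (clamp_seq n x) else 0)"
proof -
  have cont: "continuous_on UNIV (\<lambda>x. q (clamp_seq n x))" "bounded (range (\<lambda>x. q (clamp_seq n x)))"
    if "continuous_on (cube n) q" "bounded (q ` cube n)" for q :: "(nat \<Rightarrow> real) \<Rightarrow> real"
  proof -
    show "continuous_on UNIV (\<lambda>x. q (clamp_seq n x))"
      by (rule continuous_on_compose2[OF that(1) continuous_clamp_seq]) (auto simp: clamp_seq_in_cube)
    show "bounded (range (\<lambda>x. q (clamp_seq n x)))"
      by (rule bounded_subset[OF that(2)]) (auto simp: clamp_seq_in_cube)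
  qed
  have cyl: "clamp_seq n x = clamp_seq n y" if "\<forall>i\<le>n. x i = y i" for x y
    using that by (auto simp: clamp_seq_def fun_eq_iff)
  have deriv: "((\<lambda>v. f (clamp_seq n (x(k := v)))) has_real_derivative
      (if k \<le> n then f' k (clamp_seq n (x(k := v))) else 0)) (at v within {-1..1})"
    if v: "v \<in> {-1..1}" for x k v
  proof (cases "k \<le> n")
    case True
    let ?y = "(clamp_seq n x)(k := v)"
    have "?y \<in> cube n"
      using clamp_seq_in_cube[of n "x(k := v)"] clamp_seq_upd[OF True v] by simp
    then have "((\<lambda>u. f (?y(k := u))) has_real_derivative f' k ?y) (at v within {-1..1})"
      using f True unfolding C1b_on_cube_def by fastforce
    then have "((\<lambda>u. f ((clamp_seq n x)(k := u))) has_real_derivative f' k ?y) (at v within {-1..1})"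
      by simp
    then have "((\<lambda>u. f (clamp_seq n (x(k := u)))) has_real_derivative f' k ?y) (at v within {-1..1})"
      unfolding has_field_derivative_def
      by (rule has_derivative_transform[rotated 2]) (use v True in \<open>auto simp: clamp_seq_upd\<close>)
    then show ?thesis using True v by (simp add: clamp_seq_upd)
  next
    case False
    then have "clamp_seq n (x(k := u)) = clamp_seq n x" for u by (intro cyl) auto
    then show ?thesis using False by simp
  qed
  show ?thesis
    unfolding C1_cyl_def
  proof (intro conjI allI impI ballI)
    show "continuous_on UNIV (\<lambda>x. f (clamp_seq n x))" "bounded (range (\<lambda>x. f (clamp_seq n x)))"
      using f by (auto simp: C1b_on_cube_def intro: cont)
    show "continuous_on UNIV (\<lambda>x. if k \<le> n then f' k (clamp_seq n x) else 0)"
      "bounded (range (\<lambda>x. if k \<le> n then f' k (clamp_seq n x) else 0))" for k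
      using f by (cases "k \<le> n"; auto simp: C1b_on_cube_def intro: cont)+
    show "f (clamp_seq n x) = f (clamp_seq n y)" if "\<forall>i\<le>n. x i = y i" for x y
      by (simp only: cyl[OF that])
  qed (use deriv in auto)
qed

section \<open>Duality and integration by parts\<close>

context uniform_jumps
begin

lemma tilde_filtration_eq: "0 \<le> t \<Longrightarrow> tilde_filtration M U t = jump_filtration M U (2 * real (slot t))"
  by (simp add: tilde_filtration_def slot_def)

text \<open>The exceptional set, where some coordinate leaves the cube, does not depend on
  \<open>t\<close>; hence one null set and one constant for all times.\<close>

lemma grad_V_bound:
  assumes F: "C1_cyl n F F'"
  obtains B where "0 \<le> B" "AE \<omega> in M. \<forall>t. \<bar>grad F' t (V \<omega>)\<bar> \<le> B" "\<And>t x. \<bar>pgrad F t x\<bar> \<le> B"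
proof -
  obtain B where B: "\<And>x. \<bar>F x\<bar> \<le> B" "\<And>k x. \<bar>F' k x\<bar> \<le> B"
    by (rule C1_cyl_bounds[OF F]) blast
  have B0: "0 \<le> B" using B(1)[of undefined] by simp
  show thesis
  proof
    show "0 \<le> 2 * B" using B0 by simp
    show "AE \<omega> in M. \<forall>t. \<bar>grad F' t (V \<omega>)\<bar> \<le> 2 * B"
      using AE_V[OF AE_unif_seq_cube] by eventually_elim (use B in \<open>auto intro!: abs_grad_le\<close>)
    show "\<bar>pgrad F t x\<bar> \<le> 2 * B" for t x
      unfolding pgrad_def by (rule abs_zeta_le[OF C1_cyl_measurable(1)[OF F] B(1)])
  qed
qed

lemma integrable_bounded_mult:
  fixes Y G :: "'a \<Rightarrow> real"
  assumes "integrable M Y" "G \<in> borel_measurable M" "AE \<omega> in M. \<bar>G \<omega>\<bar> \<le> B"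
  shows "integrable M (\<lambda>\<omega>. Y \<omega> * G \<omega>)"
proof (rule Bochner_Integration.integrable_bound)
  show "integrable M (\<lambda>\<omega>. B * Y \<omega>)" using assms(1) by simp
  show "AE \<omega> in M. norm (Y \<omega> * G \<omega>) \<le> norm (B * Y \<omega>)"
    using assms(3)
  proof eventually_elim
    case (elim \<omega>)
    then have "\<bar>G \<omega>\<bar> \<le> \<bar>B\<bar>" by simp
    then show ?case by (simp add: abs_mult mult.commute mult_right_mono)
  qed
qed (use assms in auto)

text \<open>\<open>pgrad F t (V \<omega>)\<close> only depends on \<open>U j\<close> for \<open>j < slot t\<close>; replacing these by \<open>W j\<close>
  makes it measurable with respect to the filtration itself and not only up to null sets.\<close>

lemma real_cond_exp_grad:
  assumes F: "C1_cyl n F F'" and t: "0 \<le> t"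
  obtains P where "P \<in> borel_measurable (tilde_filtration M U t)"
    "AE \<omega> in M. P \<omega> = pgrad F t (V \<omega>)"
    "AE \<omega> in M. real_cond_exp M (tilde_filtration M U t) (\<lambda>\<omega>. grad F' t (V \<omega>)) \<omega> = P \<omega>"
proof -
  define k where "k = slot t"
  let ?F = "jump_filtration M U (2 * real k)"
  interpret finite_measure_subalgebra M ?F
    by unfold_locales (rule subalgebra_jump_filtration)
  note [measurable] = C1_cyl_measurable[OF F]
  obtain B where B: "0 \<le> B" "AE \<omega> in M. \<forall>t. \<bar>grad F' t (V \<omega>)\<bar> \<le> B" "\<And>t x. \<bar>pgrad F t x\<bar> \<le> B"
    by (rule grad_V_bound[OF F]) blast
  define P where "P \<omega> = pgrad F t (\<lambda>j. if j < k then W j \<omega> else 0)" for \<omega>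
  have P_meas: "P \<in> borel_measurable ?F"
  proof -
    have "(\<lambda>\<omega> j. if j < k then W j \<omega> else 0) \<in> ?F \<rightarrow>\<^sub>M borel"
    proof (rule measurable_seqI)
      show "(\<lambda>\<omega>. if j < k then W j \<omega> else 0) \<in> borel_measurable ?F" for j
        by (cases "j < k") (simp_all add: measurable_W)
    qed
    then show ?thesis unfolding P_def by measurable
  qed
  have pgrad_cong: "pgrad F t x = pgrad F t y" if "\<And>j. j < k \<Longrightarrow> x j = y j" for x y
    unfolding pgrad_def k_def[symmetric] by (rule zeta_cong) (rule that)
  have P_eq: "AE \<omega> in M. P \<omega> = pgrad F t (V \<omega>)"
    using AE_U
  proof eventually_elim
    case (elim \<omega>)
    then have W: "W j \<omega> = U j \<omega>" for j by (intro W_eq) auto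
    show ?case unfolding P_def by (rule pgrad_cong) (simp add: W V_def)
  qed
  have grad_int: "integrable M (\<lambda>\<omega>. grad F' t (V \<omega>))"
    using B(2) by (intro integrable_const_bound[where B = B]) auto
  have P_int: "integrable M P"
    using B(3) measurable_from_subalg[OF subalgebra_jump_filtration P_meas]
    by (intro integrable_const_bound[where B = B]) (auto simp: P_def)
  have "AE \<omega> in M. real_cond_exp M ?F (\<lambda>\<omega>. grad F' t (V \<omega>)) \<omega> = P \<omega>"
  proof (rule real_cond_exp_charact)
    fix A assume "A \<in> sets ?F"
    then have A_M: "A \<in> sets M"
      using subalgebra_jump_filtration by (auto simp: subalgebra_def)
    \<comment> \<open>Replacing \<open>A\<close> by a cylinder set moves the test to sequence space,
      where its indicator is an admissible \<open>I\<close>.\<close>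
    obtain C where "cyl_event k A C"
      using jump_filtration_cyl[OF \<open>A \<in> sets ?F\<close>] by blast
    then have C [measurable]: "C \<in> sets borel"
      and C_cyl: "\<And>x y. (\<And>i. i < k \<Longrightarrow> x i = y i) \<Longrightarrow> x \<in> C \<longleftrightarrow> y \<in> C"
      and AC: "AE \<omega> in M. \<omega> \<in> A \<longleftrightarrow> V \<omega> \<in> C"
      by (auto simp: cyl_event_def)
    have "(\<integral>\<omega>\<in>A. grad F' t (V \<omega>) \<partial>M) = (\<integral>\<omega>. indicator C (V \<omega>) * grad F' t (V \<omega>) \<partial>M)"
      unfolding set_lebesgue_integral_def
    proof (rule integral_cong_AE)
      show "AE \<omega> in M. indicat_real A \<omega> *\<^sub>R grad F' t (V \<omega>) = indicator C (V \<omega>) * grad F' t (V \<omega>)"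
        using AC by eventually_elim (auto simp: indicator_def)
    qed (use A_M in measurable)
    also have "\<dots> = (\<integral>x. indicator C x * grad F' t x \<partial>unif_seq)"
      by (rule integral_V) measurable
    also have "\<dots> = (\<integral>x. indicator C x * pgrad F t x \<partial>unif_seq)"
    proof (rule integral_cyl_grad[OF F t])
      show "indicat_real C x = indicator C y" if "\<And>i. i < slot t \<Longrightarrow> x i = y i" for x y
        using C_cyl[of x y] that by (auto simp: indicator_def k_def)
      show "\<bar>indicat_real C x\<bar> \<le> 1" for x by (auto simp: indicator_def)
    qed measurable
    also have "\<dots> = (\<integral>\<omega>. indicator C (V \<omega>) * pgrad F t (V \<omega>) \<partial>M)"
      by (rule integral_V[symmetric]) measurable
    also have "\<dots> = (\<integral>\<omega>\<in>A. P \<omega> \<partial>M)"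
      unfolding set_lebesgue_integral_def
    proof (rule integral_cong_AE)
      show "AE \<omega> in M. indicator C (V \<omega>) * pgrad F t (V \<omega>) = indicat_real A \<omega> *\<^sub>R P \<omega>"
        using AC P_eq by eventually_elim (auto simp: indicator_def)
      show "(\<lambda>\<omega>. indicat_real A \<omega> *\<^sub>R P \<omega>) \<in> borel_measurable M"
        using A_M P_int by measurable
    qed measurable
    finally show "(\<integral>\<omega>\<in>A. grad F' t (V \<omega>) \<partial>M) = (\<integral>\<omega>\<in>A. P \<omega> \<partial>M)" .
  qed (fact grad_int P_int P_meas)+
  with P_meas P_eq show thesis
    using that tilde_filtration_eq[OF t] by (simp add: k_def)
qed

text \<open>Self-adjointness of conditional expectation. It moves the conditioning from an arbitrary
  integrable \<open>Y\<close> to the gradient of a cylinder function, where it is known explicitly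
  as \<open>pgrad\<close>.\<close>

lemma integral_grad_cond_exp:
  assumes F: "C1_cyl n F F'" and t: "0 \<le> t" and Y: "integrable M Y"
  shows "(\<integral>\<omega>. grad F' t (V \<omega>) * real_cond_exp M (tilde_filtration M U t) Y \<omega> \<partial>M)
      = (\<integral>\<omega>. pgrad F t (V \<omega>) * Y \<omega> \<partial>M)"
proof -
  let ?F = "tilde_filtration M U t"
  interpret finite_measure_subalgebra M ?F
    by unfold_locales (simp add: tilde_filtration_eq[OF t] subalgebra_jump_filtration)
  note [measurable] = C1_cyl_measurable[OF F] borel_measurable_integrable[OF Y]
  obtain B where B: "0 \<le> B" "AE \<omega> in M. \<forall>t. \<bar>grad F' t (V \<omega>)\<bar> \<le> B" "\<And>t x. \<bar>pgrad F t x\<bar> \<le> B"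
    by (rule grad_V_bound[OF F]) blast
  obtain P where P: "P \<in> borel_measurable ?F" "AE \<omega> in M. P \<omega> = pgrad F t (V \<omega>)"
    "AE \<omega> in M. real_cond_exp M ?F (\<lambda>\<omega>. grad F' t (V \<omega>)) \<omega> = P \<omega>"
    by (rule real_cond_exp_grad[OF F t])
  have P_M [measurable]: "P \<in> borel_measurable M"
    by (rule measurable_from_subalg[OF subalg P(1)])
  have B': "AE \<omega> in M. \<bar>grad F' t (V \<omega>)\<bar> \<le> B" using B(2) by eventually_elim simp
  have PB: "AE \<omega> in M. \<bar>P \<omega>\<bar> \<le> B" using P(2) by eventually_elim (simp add: B(3))
  let ?C = "real_cond_exp M ?F Y"
  have C_int: "integrable M ?C" using Y by (rule real_cond_exp_int)
  have "(\<integral>\<omega>. grad F' t (V \<omega>) * ?C \<omega> \<partial>M) = (\<integral>\<omega>. ?C \<omega> * grad F' t (V \<omega>) \<partial>M)"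
    by (simp add: mult.commute)
  also have "\<dots> = (\<integral>\<omega>. ?C \<omega> * real_cond_exp M ?F (\<lambda>\<omega>. grad F' t (V \<omega>)) \<omega> \<partial>M)"
    by (rule real_cond_exp_intg(2)[symmetric])
      (use integrable_bounded_mult[OF C_int _ B'] in auto)
  also have "\<dots> = (\<integral>\<omega>. P \<omega> * ?C \<omega> \<partial>M)"
  proof (rule integral_cong_AE)
    show "AE \<omega> in M. ?C \<omega> * real_cond_exp M ?F (\<lambda>\<omega>. grad F' t (V \<omega>)) \<omega> = P \<omega> * ?C \<omega>"
      using P(3) by eventually_elim simp
  qed measurable
  also have "\<dots> = (\<integral>\<omega>. P \<omega> * Y \<omega> \<partial>M)"
    by (rule real_cond_exp_intg(2)[OF _ P(1)])
      (use integrable_bounded_mult[OF Y P_M PB] in \<open>auto simp: mult.commute\<close>)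
  also have "\<dots> = (\<integral>\<omega>. pgrad F t (V \<omega>) * Y \<omega> \<partial>M)"
  proof (rule integral_cong_AE)
    show "AE \<omega> in M. P \<omega> * Y \<omega> = pgrad F t (V \<omega>) * Y \<omega>"
      using P(2) by eventually_elim simp
  qed measurable
  finally show ?thesis .
qed

abbreviation MT :: "('a \<times> real) measure" where
  "MT \<equiv> M \<Otimes>\<^sub>M half_line"

sublocale MT: pair_sigma_finite M half_line
  by unfold_locales

lemma measurable_time [measurable]: "snd \<in> borel_measurable MT"
proof -
  have "(\<lambda>x. x) \<in> half_line \<rightarrow>\<^sub>M borel" by (rule measurable_restrict_space1) simp
  from measurable_compose[OF measurable_snd this] show ?thesis .
qed

text \<open>The half line has infinite measure, so boundedness is combined with vanishing after a
  deterministic time \<open>c\<close>.\<close>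

lemma sqint_bounded_support:
  assumes "G \<in> borel_measurable MT" and "AE z in MT. \<bar>G z\<bar> \<le> B"
    and "AE z in MT. snd z \<ge> c \<longrightarrow> G z = 0"
  shows "sqint MT G"
proof (rule sqint_bound)
  let ?S = "space M \<times> {0..<c}"
  have S: "?S \<in> sets MT" by (intro pair_measureI) (auto simp: sets_restrict_space_iff)
  have "emeasure MT ?S = emeasure M (space M) * emeasure half_line {0..<c}"
    by (rule half_line.emeasure_pair_measure_Times) (auto simp: sets_restrict_space_iff)
  also have "\<dots> < \<infinity>"
  proof -
    have "emeasure half_line {0..<c} = emeasure lborel {0..<c}"
      by (rule emeasure_restrict_space) auto
    also have "\<dots> < \<infinity>" by (cases "0 \<le> c") auto
    finally show ?thesis by (simp add: emeasure_space_1)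
  qed
  finally have fin: "emeasure MT ?S < \<infinity>" .
  have "integrable MT (\<lambda>z. B\<^sup>2 * indicator ?S z)"
    using S fin by (intro integrable_mult_right) (auto intro: integrable_real_indicator)
  moreover have "(\<lambda>z. (B * indicator ?S z)\<^sup>2) = (\<lambda>z. B\<^sup>2 * indicator ?S z :: real)"
    by (auto simp: indicator_def fun_eq_iff)
  ultimately show "sqint MT (\<lambda>z. B * indicator ?S z)"
    using S by (simp add: sqint_def)
  show "AE z in MT. \<bar>G z\<bar> \<le> \<bar>B * indicator ?S z\<bar>"
    using assms(2,3) AE_space
    by eventually_elim (auto simp: indicator_def space_pair_measure not_le)
qed (fact assms)

lemma sqint_grad:
  assumes F: "C1_cyl n F F'"
  shows "sqint MT (\<lambda>(\<omega>, t). grad F' t (V \<omega>))" "sqint MT (\<lambda>(\<omega>, t). pgrad F t (V \<omega>))"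
proof -
  note [measurable] = C1_cyl_measurable[OF F]
  obtain B where B: "0 \<le> B" "AE \<omega> in M. \<forall>t. \<bar>grad F' t (V \<omega>)\<bar> \<le> B" "\<And>t x. \<bar>pgrad F t x\<bar> \<le> B"
    by (rule grad_V_bound[OF F]) blast
  show "sqint MT (\<lambda>(\<omega>, t). grad F' t (V \<omega>))"
  proof (rule sqint_bounded_support[where B = B and c = "2 * real n + 2"])
    show "AE z in MT. \<bar>case z of (\<omega>, t) \<Rightarrow> grad F' t (V \<omega>)\<bar> \<le> B"
      using AE_pair_fst[OF sigma_finite_half_line B(2)] by eventually_elim (auto split: prod.split)
    show "AE z in MT. 2 * real n + 2 \<le> snd z \<longrightarrow> (case z of (\<omega>, t) \<Rightarrow> grad F' t (V \<omega>)) = 0"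
      using grad_eq_0[OF F less_slot] by (auto split: prod.split)
  qed measurable
  show "sqint MT (\<lambda>(\<omega>, t). pgrad F t (V \<omega>))"
  proof (rule sqint_bounded_support[where B = B and c = "2 * real n + 2"])
    show "AE z in MT. \<bar>case z of (\<omega>, t) \<Rightarrow> pgrad F t (V \<omega>)\<bar> \<le> B"
      using B(3) by (auto split: prod.split)
    show "AE z in MT. 2 * real n + 2 \<le> snd z \<longrightarrow> (case z of (\<omega>, t) \<Rightarrow> pgrad F t (V \<omega>)) = 0"
      using pgrad_eq_0[OF F less_slot] by (auto split: prod.split)
  qed measurable
qed

text \<open>The intervals of \<open>smooth_gradient\<close> are closed on the right, those of
  \<open>slot\<close> on the left; the two conventions disagree only at even times. Elsewhere, only
  the summand belonging to the slot of \<open>t\<close> is nonzero.\<close>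

lemma smooth_gradient_eq:
  assumes f: "C1b_on_cube n f f'" and U: "\<And>k. U k \<omega> \<in> {-1<..<1}"
    and t: "0 \<le> t" "\<And>k::nat. t \<noteq> 2 * real k"
  shows "smooth_gradient U n f' t \<omega> = grad (\<lambda>k x. if k \<le> n then f' k (clamp_seq n x) else 0) t (V \<omega>)"
proof -
  define j where "j = slot t"
  have j: "2 * real j < t" "t < 2 * real j + 2"
    using slot_eq_iff[OF t(1), of j] t(2)[of j] by (auto simp: j_def less_le)
  have V: "clamp_seq n (V \<omega>) = (\<lambda>j\<in>{..n}. U j \<omega>)"
    using U by (subst clamp_seq_restrict) (auto simp: V_def less_imp_le)
  have summand: "(1 - U k \<omega>) * indicator {2 * real k <.. 2 * real k + 1 + U k \<omega>} t
         - (1 + U k \<omega>) * indicator {2 * real k + 1 + U k \<omega> <.. 2 * real k + 2} t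
      = (if k = j then kern (pos t) (U j \<omega>) else 0)" for k
  proof (cases k j rule: linorder_cases)
    case less
    then have "real k + 1 \<le> real j" by simp
    then show ?thesis using less U[of k] j by (auto simp: indicator_def)
  next
    case greater
    then have "real j + 1 \<le> real k" by simp
    then show ?thesis using greater U[of k] j by (auto simp: indicator_def)
  next
    case equal
    then show ?thesis using U[of j] j by (auto simp: indicator_def kern_def pos_def j_def)
  qed
  show ?thesis
    unfolding smooth_gradient_def summand grad_def V
    by (auto simp: j_def[symmetric] V_def if_distrib[of "\<lambda>a. _ * a"] sum.delta cong: if_cong)
qed

end

lemma AE_half_line_not_even: "AE t in half_line. 0 \<le> t \<and> (\<forall>k::nat. t \<noteq> 2 * real k)"
proof -
  have "AE t in lborel. \<forall>k::nat. t \<noteq> 2 * real k"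
    unfolding AE_all_countable by (intro allI AE_lborel_singleton)
  then have "AE t in half_line. \<forall>k::nat. t \<noteq> 2 * real k"
    by (subst AE_restrict_space_iff) auto
  then show ?thesis using AE_space[of half_line] by eventually_elim (auto simp: space_restrict_space)
qed

lemma tendsto_AE_subseq_L2:
  assumes u: "\<And>m. sqint M (u m)" and lim: "(\<lambda>m. \<integral>x. (u m x)\<^sup>2 \<partial>M) \<longlonglongrightarrow> 0"
  obtains r where "strict_mono r" "AE x in M. (\<lambda>m. u (r m) x) \<longlonglongrightarrow> 0"
proof -
  have "\<exists>r. strict_mono r \<and> (AE x in M. (\<lambda>m. (u (r m) x)\<^sup>2) \<longlonglongrightarrow> 0)"
    using u lim by (intro tendsto_L1_AE_subseq) (auto simp: sqint_def)
  then obtain r where r: "strict_mono r" "AE x in M. (\<lambda>m. (u (r m) x)\<^sup>2) \<longlonglongrightarrow> 0" by blast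
  have "AE x in M. (\<lambda>m. u (r m) x) \<longlonglongrightarrow> 0"
    using r(2)
  proof eventually_elim
    case (elim x)
    then have "(\<lambda>m. sqrt ((u (r m) x)\<^sup>2)) \<longlonglongrightarrow> sqrt 0" by (rule tendsto_real_sqrt)
    then show ?case by (simp add: tendsto_rabs_zero_iff)
  qed
  with r(1) show thesis by (rule that)
qed

locale malliavin_setup = uniform_jumps M U for M :: "'a measure" and U +
  fixes X :: "'a \<Rightarrow> real" and DX Z :: "real \<Rightarrow> 'a \<Rightarrow> real"
  assumes DX: "closed_gradient M U X DX"
    and Z: "cond_gradient M U DX Z"
begin

lemma sqint_X: "sqint M X"
  and sqint_DX: "sqint MT (\<lambda>(\<omega>, t). DX t \<omega>)"
  using DX by (auto simp: closed_gradient_def in_L2_iff_sqint)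

lemma sqint_finite_integrable:
  assumes "sqint M f"
  shows "integrable M f"
proof (rule Bochner_Integration.integrable_bound)
  show "integrable M (\<lambda>x. 1 + (f x)\<^sup>2)" using assms by (simp add: sqint_def)
  have "\<bar>a\<bar> \<le> 1 + a\<^sup>2" for a :: real
  proof -
    have "0 \<le> (\<bar>a\<bar> - 1)\<^sup>2" by simp
    then have "2 * \<bar>a\<bar> \<le> 1 + a\<^sup>2" by (simp add: power2_diff)
    then show ?thesis by linarith
  qed
  then show "AE x in M. norm (f x) \<le> norm (1 + (f x)\<^sup>2)" by auto
qed (use assms in \<open>auto simp: sqint_def\<close>)

lemma integrable_X: "integrable M X"
  by (rule sqint_finite_integrable[OF sqint_X])

lemma measurable_DX [measurable]: "(\<lambda>(\<omega>, t). DX t \<omega>) \<in> borel_measurable MT"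
  using sqint_DX by (simp add: sqint_def)

lemma measurable_Z [measurable]: "(\<lambda>(\<omega>, t). Z t \<omega>) \<in> borel_measurable MT"
  using Z by (simp add: cond_gradient_def)

lemma AE_Z: "AE t in half_line. AE \<omega> in M. Z t \<omega> = real_cond_exp M (tilde_filtration M U t) (DX t) \<omega>"
  using Z by (simp add: cond_gradient_def)

lemma measurable_DX_t:
  assumes "t \<in> space half_line"
  shows "DX t \<in> borel_measurable M" "Z t \<in> borel_measurable M"
  using measurable_Pair1[OF measurable_DX assms] measurable_Pair1[OF measurable_Z assms]
  by simp_all

lemma AE_sqint_DX: "AE t in half_line. sqint M (DX t)"
proof -
  have "AE t in half_line. integrable M (\<lambda>\<omega>. (DX t \<omega>)\<^sup>2)"
    using sqint_DX by (intro MT.AE_integrable_snd) (simp add: sqint_def case_prod_unfold)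
  then show ?thesis
    using AE_space by eventually_elim (simp add: sqint_def measurable_DX_t)
qed

text \<open>Conditional Jensen for almost every \<open>t\<close>, then Tonelli; joint measurability
  of \<open>Z\<close> is what makes the second step legitimate.\<close>

lemma sqint_Z: "sqint MT (\<lambda>(\<omega>, t). Z t \<omega>)"
proof -
  have "(\<integral>\<^sup>+z. ennreal ((case z of (\<omega>, t) \<Rightarrow> Z t \<omega>)\<^sup>2) \<partial>MT)
      = (\<integral>\<^sup>+t. (\<integral>\<^sup>+\<omega>. ennreal ((Z t \<omega>)\<^sup>2) \<partial>M) \<partial>half_line)"
    by (subst MT.nn_integral_snd[symmetric]) auto
  also have "\<dots> \<le> (\<integral>\<^sup>+t. (\<integral>\<^sup>+\<omega>. ennreal ((DX t \<omega>)\<^sup>2) \<partial>M) \<partial>half_line)"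
  proof (rule nn_integral_mono_AE)
    show "AE t in half_line. (\<integral>\<^sup>+\<omega>. ennreal ((Z t \<omega>)\<^sup>2) \<partial>M) \<le> (\<integral>\<^sup>+\<omega>. ennreal ((DX t \<omega>)\<^sup>2) \<partial>M)"
      using AE_sqint_DX AE_Z AE_half_line_not_even
    proof eventually_elim
      case (elim t)
      let ?F = "tilde_filtration M U t"
      interpret finite_measure_subalgebra M ?F
        using elim by unfold_locales (simp add: tilde_filtration_eq subalgebra_jump_filtration)
      have sq: "integrable M (\<lambda>\<omega>. (DX t \<omega>)\<^sup>2)" using elim by (simp add: sqint_def)
      have "AE \<omega> in M. (real_cond_exp M ?F (DX t) \<omega>)\<^sup>2 \<le> real_cond_exp M ?F (\<lambda>\<omega>. (DX t \<omega>)\<^sup>2) \<omega>"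
        by (rule real_cond_exp_jensens_inequality(2)[where I = UNIV])
          (use elim sq sqint_finite_integrable convex_power2 in auto)
      then have "(\<integral>\<^sup>+\<omega>. ennreal ((Z t \<omega>)\<^sup>2) \<partial>M) \<le> (\<integral>\<^sup>+\<omega>. ennreal (real_cond_exp M ?F (\<lambda>\<omega>. (DX t \<omega>)\<^sup>2) \<omega>) \<partial>M)"
        using elim(2) by (intro nn_integral_mono_AE, eventually_elim) (auto intro: ennreal_leI)
      also have "\<dots> = ennreal (\<integral>\<omega>. real_cond_exp M ?F (\<lambda>\<omega>. (DX t \<omega>)\<^sup>2) \<omega> \<partial>M)"
        using sq by (intro nn_integral_eq_integral real_cond_exp_int real_cond_exp_pos) auto
      also have "\<dots> = ennreal (\<integral>\<omega>. (DX t \<omega>)\<^sup>2 \<partial>M)"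
        using sq by (simp add: real_cond_exp_int)
      also have "\<dots> = (\<integral>\<^sup>+\<omega>. ennreal ((DX t \<omega>)\<^sup>2) \<partial>M)"
        using sq by (intro nn_integral_eq_integral[symmetric]) auto
      finally show ?case .
    qed
  qed
  also have "\<dots> = (\<integral>\<^sup>+z. ennreal ((case z of (\<omega>, t) \<Rightarrow> DX t \<omega>)\<^sup>2) \<partial>MT)"
    by (subst MT.nn_integral_snd[symmetric]) auto
  also have "\<dots> < \<infinity>"
  proof -
    have "integrable MT (\<lambda>z. (case z of (\<omega>, t) \<Rightarrow> DX t \<omega>)\<^sup>2)"
      using sqint_DX by (simp add: sqint_def)
    then show ?thesis
      by (subst nn_integral_eq_integral) auto
  qed
  finally show ?thesis
    unfolding sqint_def by (intro conjI measurable_Z integrableI_nonneg) auto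
qed

lemma sqint_cyl:
  assumes "C1_cyl n F F'"
  shows "sqint M (\<lambda>\<omega>. F (V \<omega>))"
proof -
  obtain B where B: "\<And>x. \<bar>F x\<bar> \<le> B" by (rule C1_cyl_bounds[OF assms]) blast
  note [measurable] = C1_cyl_measurable(1)[OF assms]
  show ?thesis
  proof (rule sqint_bound)
    show "sqint M (\<lambda>_. B)" by (simp add: sqint_def)
    show "AE \<omega> in M. \<bar>F (V \<omega>)\<bar> \<le> \<bar>B\<bar>"
      by (intro AE_I2 order_trans[OF B abs_ge_self])
  qed measurable
qed

text \<open>A subsequence of the sequence given by closedness. Almost sure convergence is added
  because \<open>g' (F m)\<close> must converge for merely continuous \<open>g'\<close>.\<close>

lemma approximation:
  obtains n F F' where
    "\<forall>m::nat. C1_cyl (n m) (F m) (F' m)"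
    "(\<lambda>m. \<integral>\<omega>. (X \<omega> - F m (V \<omega>))\<^sup>2 \<partial>M) \<longlonglongrightarrow> 0"
    "(\<lambda>m. \<integral>(\<omega>, t). (DX t \<omega> - grad (F' m) t (V \<omega>))\<^sup>2 \<partial>MT) \<longlonglongrightarrow> 0"
    "AE \<omega> in M. (\<lambda>m. F m (V \<omega>)) \<longlonglongrightarrow> X \<omega>"
proof -
  obtain n f f' where f: "\<And>m::nat. C1b_on_cube (n m) (f m) (f' m)"
    and lim: "(\<lambda>m. L2norm M (\<lambda>\<omega>. X \<omega> - smooth_functional U (n m) (f m) \<omega>)) \<longlonglongrightarrow> 0"
    and lim': "(\<lambda>m. L2norm MT (\<lambda>(\<omega>, t). DX t \<omega> - smooth_gradient U (n m) (f' m) t \<omega>)) \<longlonglongrightarrow> 0"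
    using DX unfolding closed_gradient_def by blast
  define F where "F m x = f m (clamp_seq (n m) x)" for m x
  define F' where "F' m k x = (if k \<le> n m then f' m k (clamp_seq (n m) x) else 0)" for m k x
  have cyl: "C1_cyl (n m) (F m) (F' m)" for m
    using C1_cyl_clamp[OF f[of m]] unfolding F_def[abs_def] F'_def[abs_def] .
  note sqF = sqint_cyl[OF cyl]
  have "L2norm M (\<lambda>\<omega>. X \<omega> - smooth_functional U (n m) (f m) \<omega>) = L2norm M (\<lambda>\<omega>. X \<omega> - F m (V \<omega>))" for m
  proof (rule L2norm_cong_AE)
    show "AE \<omega> in M. X \<omega> - smooth_functional U (n m) (f m) \<omega> = X \<omega> - F m (V \<omega>)"
      using AE_U
    proof eventually_elim
      case (elim \<omega>)
      then have "clamp_seq (n m) (V \<omega>) = (\<lambda>k\<in>{..n m}. U k \<omega>)"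
        by (subst clamp_seq_restrict) (auto simp: V_def less_imp_le)
      then show ?case by (simp add: F_def smooth_functional_def)
    qed
  qed
  then have lim2: "(\<lambda>m. \<integral>\<omega>. (X \<omega> - F m (V \<omega>))\<^sup>2 \<partial>M) \<longlonglongrightarrow> 0"
    using lim by (intro L2norm_tendsto_0 sqint_diff sqint_X sqF) simp
  have "L2norm MT (\<lambda>(\<omega>, t). DX t \<omega> - smooth_gradient U (n m) (f' m) t \<omega>)
      = L2norm MT (\<lambda>z. (case z of (\<omega>, t) \<Rightarrow> DX t \<omega>) - (case z of (\<omega>, t) \<Rightarrow> grad (F' m) t (V \<omega>)))" for m
  proof (rule L2norm_cong_AE)
    show "AE z in MT. (case z of (\<omega>, t) \<Rightarrow> DX t \<omega> - smooth_gradient U (n m) (f' m) t \<omega>)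
        = (case z of (\<omega>, t) \<Rightarrow> DX t \<omega>) - (case z of (\<omega>, t) \<Rightarrow> grad (F' m) t (V \<omega>))"
      using AE_pair_fst[OF sigma_finite_half_line AE_U] AE_pair_snd[OF sigma_finite_half_line AE_half_line_not_even]
    proof eventually_elim
      case (elim z)
      then show ?case
        using smooth_gradient_eq[OF f[of m], of "fst z" "snd z"]
        by (auto simp: F'_def[abs_def] split: prod.split)
    qed
  qed
  then have "(\<lambda>m. \<integral>z. ((case z of (\<omega>, t) \<Rightarrow> DX t \<omega>) - (case z of (\<omega>, t) \<Rightarrow> grad (F' m) t (V \<omega>)))\<^sup>2 \<partial>MT) \<longlonglongrightarrow> 0"
    using lim' by (intro L2norm_tendsto_0 sqint_diff sqint_DX sqint_grad[OF cyl]) simp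
  then have lim2': "(\<lambda>m. \<integral>(\<omega>, t). (DX t \<omega> - grad (F' m) t (V \<omega>))\<^sup>2 \<partial>MT) \<longlonglongrightarrow> 0"
    by (simp add: case_prod_unfold)
  obtain r where r: "strict_mono r" "AE \<omega> in M. (\<lambda>m. X \<omega> - F (r m) (V \<omega>)) \<longlonglongrightarrow> 0"
    by (rule tendsto_AE_subseq_L2[OF sqint_diff[OF sqint_X sqF] lim2])
  show thesis
  proof (rule that[of "n \<circ> r" "F \<circ> r" "F' \<circ> r"])
    show "\<forall>m. C1_cyl ((n \<circ> r) m) ((F \<circ> r) m) ((F' \<circ> r) m)" using cyl by simp
    show "(\<lambda>m. \<integral>\<omega>. (X \<omega> - (F \<circ> r) m (V \<omega>))\<^sup>2 \<partial>M) \<longlonglongrightarrow> 0"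
      using LIMSEQ_subseq_LIMSEQ[OF lim2 r(1)] by (simp add: o_def)
    show "(\<lambda>m. \<integral>(\<omega>, t). (DX t \<omega> - grad ((F' \<circ> r) m) t (V \<omega>))\<^sup>2 \<partial>MT) \<longlonglongrightarrow> 0"
      using LIMSEQ_subseq_LIMSEQ[OF lim2' r(1)] by (simp add: o_def)
    show "AE \<omega> in M. (\<lambda>m. (F \<circ> r) m (V \<omega>)) \<longlonglongrightarrow> X \<omega>"
      using r(2)
    proof eventually_elim
      case (elim \<omega>)
      from tendsto_diff[OF tendsto_const[of "X \<omega>"] elim] show ?case by simp
    qed
  qed
qed

text \<open>Moving the conditioning onto \<open>F\<close> leaves the pairing of
  \<open>pgrad F\<close> with \<open>DX\<close>, which is linear and L2-continuous in
  \<open>DX\<close>. The covariance formula for cylinder functions therefore passes to the limit in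
  \<open>X\<close>, while \<open>F\<close> stays smooth.\<close>

lemma duality:
  assumes F: "C1_cyl n F F'" and X0: "(\<integral>\<omega>. X \<omega> \<partial>M) = 0"
  shows "(\<integral>(\<omega>, t). grad F' t (V \<omega>) * Z t \<omega> \<partial>MT) = 2 * (\<integral>\<omega>. F (V \<omega>) * X \<omega> \<partial>M)"
proof -
  note [measurable] = C1_cyl_measurable[OF F]
  obtain n' G G' where "\<forall>m::nat. C1_cyl (n' m) (G m) (G' m)"
    and lim: "(\<lambda>m. \<integral>\<omega>. (X \<omega> - G m (V \<omega>))\<^sup>2 \<partial>M) \<longlonglongrightarrow> 0"
    and lim': "(\<lambda>m. \<integral>(\<omega>, t). (DX t \<omega> - grad (G' m) t (V \<omega>))\<^sup>2 \<partial>MT) \<longlonglongrightarrow> 0"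
    and "AE \<omega> in M. (\<lambda>m. G m (V \<omega>)) \<longlonglongrightarrow> X \<omega>"
    by (rule approximation)
  then have G: "C1_cyl (n' m) (G m) (G' m)" for m by blast
  let ?p = "\<lambda>(\<omega>, t). pgrad F t (V \<omega>)" and ?g = "\<lambda>m (\<omega>, t). grad (G' m) t (V \<omega>)"
  have "(\<integral>(\<omega>, t). grad F' t (V \<omega>) * Z t \<omega> \<partial>MT) = (\<integral>t. (\<integral>\<omega>. grad F' t (V \<omega>) * Z t \<omega> \<partial>M) \<partial>half_line)"
    using sqint_mult_integrable[OF sqint_grad(1)[OF F] sqint_Z]
    by (intro MT.integral_snd[symmetric]) (simp add: case_prod_unfold)
  also have "\<dots> = (\<integral>t. (\<integral>\<omega>. pgrad F t (V \<omega>) * DX t \<omega> \<partial>M) \<partial>half_line)"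
  proof (rule integral_cong_AE)
    show "AE t in half_line. (\<integral>\<omega>. grad F' t (V \<omega>) * Z t \<omega> \<partial>M) = (\<integral>\<omega>. pgrad F t (V \<omega>) * DX t \<omega> \<partial>M)"
      using AE_sqint_DX AE_Z AE_half_line_not_even AE_space
    proof eventually_elim
      case (elim t)
      have "(\<integral>\<omega>. grad F' t (V \<omega>) * Z t \<omega> \<partial>M)
          = (\<integral>\<omega>. grad F' t (V \<omega>) * real_cond_exp M (tilde_filtration M U t) (DX t) \<omega> \<partial>M)"
      proof (rule integral_cong_AE)
        show "AE \<omega> in M. grad F' t (V \<omega>) * Z t \<omega>
            = grad F' t (V \<omega>) * real_cond_exp M (tilde_filtration M U t) (DX t) \<omega>"
          using elim(2) by eventually_elim simp
      next
        have [measurable]: "Z t \<in> borel_measurable M" by (rule measurable_DX_t[OF elim(4)])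
        have [measurable]: "(\<lambda>\<omega>. grad F' t (V \<omega>)) \<in> borel_measurable M" by measurable
        show "(\<lambda>\<omega>. grad F' t (V \<omega>) * Z t \<omega>) \<in> borel_measurable M"
          "(\<lambda>\<omega>. grad F' t (V \<omega>) * real_cond_exp M (tilde_filtration M U t) (DX t) \<omega>) \<in> borel_measurable M"
          by measurable
      qed
      also have "\<dots> = (\<integral>\<omega>. pgrad F t (V \<omega>) * DX t \<omega> \<partial>M)"
        by (rule integral_grad_cond_exp[OF F _ sqint_finite_integrable[OF elim(1)]]) (use elim(3) in simp)
      finally show ?case .
    qed
    have "(\<lambda>z. grad F' (snd z) (V (fst z)) * Z (snd z) (fst z)) \<in> borel_measurable MT"
      using sqint_mult_integrable[OF sqint_grad(1)[OF F] sqint_Z, THEN borel_measurable_integrable]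
      by (simp add: case_prod_unfold)
    from measurable_pair_swap[OF this] show "(\<lambda>t. \<integral>\<omega>. grad F' t (V \<omega>) * Z t \<omega> \<partial>M) \<in> borel_measurable half_line"
      by (intro borel_measurable_lebesgue_integral) (simp add: case_prod_unfold)
    have "(\<lambda>z. pgrad F (snd z) (V (fst z)) * DX (snd z) (fst z)) \<in> borel_measurable MT"
      using sqint_mult_integrable[OF sqint_grad(2)[OF F] sqint_DX, THEN borel_measurable_integrable]
      by (simp add: case_prod_unfold)
    from measurable_pair_swap[OF this] show "(\<lambda>t. \<integral>\<omega>. pgrad F t (V \<omega>) * DX t \<omega> \<partial>M) \<in> borel_measurable half_line"
      by (intro borel_measurable_lebesgue_integral) (simp add: case_prod_unfold)
  qed
  also have "\<dots> = (\<integral>(\<omega>, t). pgrad F t (V \<omega>) * DX t \<omega> \<partial>MT)"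
    using sqint_mult_integrable[OF sqint_grad(2)[OF F] sqint_DX]
    by (intro MT.integral_snd) (simp add: case_prod_unfold)
  \<comment> \<open>The factor 1 turns the mean of \<open>X\<close> into a pairing with a
    square-integrable function, so one limit lemma covers both terms.\<close>
  also have "\<dots> = 2 * ((\<integral>\<omega>. F (V \<omega>) * X \<omega> \<partial>M) - (\<integral>x. F x \<partial>unif_seq) * (\<integral>\<omega>. 1 * X \<omega> \<partial>M))"
  proof (rule LIMSEQ_unique)
    show "(\<lambda>m. \<integral>z. ?p z * ?g m z \<partial>MT) \<longlonglongrightarrow> (\<integral>(\<omega>, t). pgrad F t (V \<omega>) * DX t \<omega> \<partial>MT)"
      using tendsto_L2_mult[OF sqint_grad(1)[OF G] sqint_DX sqint_grad(2)[OF F]] lim'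
      by (simp add: case_prod_unfold)
    have "(\<integral>z. ?p z * ?g m z \<partial>MT) = 2 * ((\<integral>\<omega>. F (V \<omega>) * G m (V \<omega>) \<partial>M) -
        (\<integral>x. F x \<partial>unif_seq) * (\<integral>\<omega>. 1 * G m (V \<omega>) \<partial>M))" for m
    proof -
      note [measurable] = C1_cyl_measurable[OF G[of m]]
      have "(\<integral>z. ?p z * ?g m z \<partial>MT) = (\<integral>t. (\<integral>\<omega>. pgrad F t (V \<omega>) * grad (G' m) t (V \<omega>) \<partial>M) \<partial>half_line)"
        using sqint_mult_integrable[OF sqint_grad(2)[OF F] sqint_grad(1)[OF G[of m]]]
        by (subst MT.integral_snd) (simp_all add: case_prod_unfold)
      also have "\<dots> = (\<integral>t. (\<integral>x. pgrad F t x * grad (G' m) t x \<partial>unif_seq) \<partial>half_line)"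
      proof -
        have "(\<integral>\<omega>. pgrad F t (V \<omega>) * grad (G' m) t (V \<omega>) \<partial>M)
            = (\<integral>x. pgrad F t x * grad (G' m) t x \<partial>unif_seq)" for t
          by (rule integral_V) measurable
        then show ?thesis by (simp only:)
      qed
      also have "\<dots> = 2 * ((\<integral>x. F x * G m x \<partial>unif_seq) - (\<integral>x. F x \<partial>unif_seq) * (\<integral>x. G m x \<partial>unif_seq))"
        by (rule integral_pgrad_grad[OF F G])
      finally show ?thesis
        using integral_V[OF C1_cyl_measurable(1)[OF G[of m]]]
          integral_V[OF borel_measurable_times[OF C1_cyl_measurable(1)[OF F] C1_cyl_measurable(1)[OF G[of m]]]]
        by simp
    qed
    moreover have "(\<lambda>m. \<integral>\<omega>. F (V \<omega>) * G m (V \<omega>) \<partial>M) \<longlonglongrightarrow> (\<integral>\<omega>. F (V \<omega>) * X \<omega> \<partial>M)"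
      by (rule tendsto_L2_mult[OF sqint_cyl[OF G] sqint_X sqint_cyl[OF F] lim])
    moreover have "(\<lambda>m. \<integral>\<omega>. 1 * G m (V \<omega>) \<partial>M) \<longlonglongrightarrow> (\<integral>\<omega>. 1 * X \<omega> \<partial>M)"
      by (rule tendsto_L2_mult[OF sqint_cyl[OF G] sqint_X _ lim]) (simp add: sqint_def)
    ultimately show "(\<lambda>m. \<integral>z. ?p z * ?g m z \<partial>MT) \<longlonglongrightarrow>
        2 * ((\<integral>\<omega>. F (V \<omega>) * X \<omega> \<partial>M) - (\<integral>x. F x \<partial>unif_seq) * (\<integral>\<omega>. 1 * X \<omega> \<partial>M))"
      by (auto intro!: tendsto_intros)
  qed
  finally show ?thesis using X0 by simp
qed

end

context malliavin_setup
begin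

lemma integrable_DX_Z: "integrable MT (\<lambda>(\<omega>, t). DX t \<omega> * Z t \<omega>)"
  using sqint_mult_integrable[OF sqint_DX sqint_Z] by (simp add: case_prod_unfold)

lemma integrable_T: "integrable M (T_functional DX Z)"
  using MT.integrable_fst'[OF integrable_DX_Z] by (simp add: T_functional_def[abs_def])

text \<open>Duality is applied to the cylinder functions \<open>g (F m)\<close>, whose gradient is
  \<open>g' (F m)\<close> times that of \<open>F m\<close>, and \<open>m\<close> tends to infinity
  on both sides. On the left the integrand is split into an error with
  \<open>grad (F' m) - DX\<close> and a main term with \<open>DX\<close>.\<close>

theorem integration_by_parts:
  assumes X0: "(\<integral>\<omega>. X \<omega> \<partial>M) = 0"
    and g: "\<And>x. (g has_real_derivative g' x) (at x)" "continuous_on UNIV g'" "\<And>x. \<bar>g' x\<bar> \<le> L"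
  shows "(\<integral>\<omega>. g' (X \<omega>) * T_functional DX Z \<omega> \<partial>M) = 2 * (\<integral>\<omega>. g (X \<omega>) * X \<omega> \<partial>M)"
    and "integrable M (\<lambda>\<omega>. g (X \<omega>) * X \<omega>)"
    and "integrable M (\<lambda>\<omega>. g' (X \<omega>) * T_functional DX Z \<omega>)"
proof -
  have contg: "continuous_on UNIV g"
    using g(1) by (meson DERIV_continuous continuous_at_imp_continuous_on)
  have [measurable]: "g \<in> borel_measurable borel" "g' \<in> borel_measurable borel"
    using contg g(2) by (auto intro: borel_measurable_continuous_onI)
  have [measurable]: "X \<in> borel_measurable M" using integrable_X by auto
  have lip: "\<bar>g x - g y\<bar> \<le> L * \<bar>x - y\<bar>" for x y
    using field_differentiable_bound[of UNIV g g' L x y] g(1,3) by auto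
  have L0: "0 \<le> L" using g(3)[of 0] by simp
  obtain n F F' where "\<forall>m::nat. C1_cyl (n m) (F m) (F' m)"
    and lim: "(\<lambda>m. \<integral>\<omega>. (X \<omega> - F m (V \<omega>))\<^sup>2 \<partial>M) \<longlonglongrightarrow> 0"
    and lim': "(\<lambda>m. \<integral>(\<omega>, t). (DX t \<omega> - grad (F' m) t (V \<omega>))\<^sup>2 \<partial>MT) \<longlonglongrightarrow> 0"
    and lim_AE: "AE \<omega> in M. (\<lambda>m. F m (V \<omega>)) \<longlonglongrightarrow> X \<omega>"
    by (rule approximation)
  then have F: "C1_cyl (n m) (F m) (F' m)" for m by blast
  have sq_gX: "sqint M (\<lambda>\<omega>. g (X \<omega>))"
  proof (rule sqint_bound)
    show "sqint M (\<lambda>\<omega>. \<bar>g 0\<bar> + L * \<bar>X \<omega>\<bar>)"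
      using sqint_cmult[OF sqint_abs[OF sqint_X], of L] by (intro sqint_add) (auto simp: sqint_def)
    show "AE \<omega> in M. \<bar>g (X \<omega>)\<bar> \<le> \<bar>\<bar>g 0\<bar> + L * \<bar>X \<omega>\<bar>\<bar>"
    proof (rule AE_I2)
      fix \<omega> show "\<bar>g (X \<omega>)\<bar> \<le> \<bar>\<bar>g 0\<bar> + L * \<bar>X \<omega>\<bar>\<bar>"
        using lip[of "X \<omega>" 0] by simp
    qed
  qed measurable
  show "integrable M (\<lambda>\<omega>. g (X \<omega>) * X \<omega>)"
    by (rule sqint_mult_integrable[OF sq_gX sqint_X])
  have gF: "C1_cyl (n m) (\<lambda>x. g (F m x)) (\<lambda>k x. g' (F m x) * F' m k x)" for m
    by (rule C1_cyl_compose[OF F g(1,2)])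
  have int_T: "integrable M (\<lambda>\<omega>. T_functional DX Z \<omega> * g' (X \<omega>))"
    by (rule integrable_bounded_mult[OF integrable_T, where B = L]) (use g(3) in auto)
  then show "integrable M (\<lambda>\<omega>. g' (X \<omega>) * T_functional DX Z \<omega>)"
    by (simp add: mult.commute)
  let ?DX = "\<lambda>(\<omega>, t). DX t \<omega>" and ?Z = "\<lambda>(\<omega>, t). Z t \<omega>" and ?G = "\<lambda>m (\<omega>, t). grad (F' m) t (V \<omega>)"
  have meas: "?DX \<in> borel_measurable MT" "?Z \<in> borel_measurable MT" "\<And>m. ?G m \<in> borel_measurable MT"
    "\<And>m. F m \<in> borel_measurable borel" "X \<in> borel_measurable M"
    using sqint_DX sqint_Z sqint_grad(1)[OF F] C1_cyl_measurable[OF F] by (auto simp: sqint_def)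
  note [measurable] = meas
  have int_DXZ: "integrable MT (\<lambda>z. ?DX z * ?Z z)"
    by (rule sqint_mult_integrable[OF sqint_DX sqint_Z])
  have bounded_int: "integrable MT (\<lambda>z. q z * h z)"
    if "integrable MT h" "q \<in> borel_measurable MT" "\<And>z. \<bar>q z\<bar> \<le> L" for q h :: "'a \<times> real \<Rightarrow> real"
  proof (rule Bochner_Integration.integrable_bound)
    show "integrable MT (\<lambda>z. L * h z)" using that(1) by simp
    show "AE z in MT. norm (q z * h z) \<le> norm (L * h z)"
      using that(3) L0 by (intro AE_I2) (auto simp: abs_mult intro!: mult_right_mono)
  qed (use that borel_measurable_integrable[OF that(1)] in auto)
  \<comment> \<open>The error term: \<open>g'\<close> is bounded by \<open>L\<close>, and
    Cauchy-Schwarz against \<open>Z\<close> uses the L2 convergence of the gradients.\<close>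
  have lim1: "(\<lambda>m. \<integral>z. g' (F m (V (fst z))) * ((?G m z - ?DX z) * ?Z z) \<partial>MT) \<longlonglongrightarrow> 0"
  proof (rule Lim_null_comparison)
    have sq: "sqint MT (\<lambda>z. ?G m z - ?DX z)" for m
      by (rule sqint_diff[OF sqint_grad(1)[OF F] sqint_DX])
    have "(\<lambda>m. \<integral>z. (?G m z - ?DX z)\<^sup>2 \<partial>MT) \<longlonglongrightarrow> 0"
      using lim' by (simp add: case_prod_unfold power2_commute)
    from tendsto_L2_abs_mult[OF sq sqint_Z this]
    have "(\<lambda>m. L * (\<integral>z. \<bar>?G m z - ?DX z\<bar> * \<bar>?Z z\<bar> \<partial>MT)) \<longlonglongrightarrow> L * 0"
      by (intro tendsto_intros)
    then show "(\<lambda>m. L * (\<integral>z. \<bar>?G m z - ?DX z\<bar> * \<bar>?Z z\<bar> \<partial>MT)) \<longlonglongrightarrow> 0" by simp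
    show "\<forall>\<^sub>F m in sequentially. norm (\<integral>z. g' (F m (V (fst z))) * ((?G m z - ?DX z) * ?Z z) \<partial>MT)
        \<le> L * (\<integral>z. \<bar>?G m z - ?DX z\<bar> * \<bar>?Z z\<bar> \<partial>MT)"
    proof (intro always_eventually allI)
      fix m
      have i: "integrable MT (\<lambda>z. (?G m z - ?DX z) * ?Z z)"
        by (rule sqint_mult_integrable[OF sq sqint_Z])
      have "norm (\<integral>z. g' (F m (V (fst z))) * ((?G m z - ?DX z) * ?Z z) \<partial>MT)
          \<le> (\<integral>z. norm (g' (F m (V (fst z))) * ((?G m z - ?DX z) * ?Z z)) \<partial>MT)"
        by (rule integral_norm_bound)
      also have "\<dots> \<le> (\<integral>z. L * norm ((?G m z - ?DX z) * ?Z z) \<partial>MT)"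
      proof (rule integral_mono)
        show "integrable MT (\<lambda>z. norm (g' (F m (V (fst z))) * ((?G m z - ?DX z) * ?Z z)))"
          by (rule integrable_norm[OF bounded_int[OF i _ g(3)]]) measurable
        show "integrable MT (\<lambda>z. L * norm ((?G m z - ?DX z) * ?Z z))"
          using i by (intro integrable_mult_right integrable_norm)
        show "norm (g' (F m (V (fst z))) * ((?G m z - ?DX z) * ?Z z)) \<le> L * norm ((?G m z - ?DX z) * ?Z z)" for z
          unfolding norm_mult by (rule mult_right_mono) (use g(3) in auto)
      qed
      finally show "norm (\<integral>z. g' (F m (V (fst z))) * ((?G m z - ?DX z) * ?Z z) \<partial>MT)
        \<le> L * (\<integral>z. \<bar>?G m z - ?DX z\<bar> * \<bar>?Z z\<bar> \<partial>MT)"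
        by (simp add: abs_mult)
    qed
  qed
  \<comment> \<open>The main term: \<open>DX * Z\<close> is integrable and fixed, so almost sure
    convergence of \<open>g' (F m)\<close> suffices by domination.\<close>
  have lim2: "(\<lambda>m. \<integral>z. g' (F m (V (fst z))) * (?DX z * ?Z z) \<partial>MT) \<longlonglongrightarrow> (\<integral>z. g' (X (fst z)) * (?DX z * ?Z z) \<partial>MT)"
  proof (rule integral_dominated_convergence[where w = "\<lambda>z. L * \<bar>?DX z * ?Z z\<bar>"])
    show "integrable MT (\<lambda>z. L * \<bar>?DX z * ?Z z\<bar>)" using int_DXZ by simp
    show "AE z in MT. (\<lambda>m. g' (F m (V (fst z))) * (?DX z * ?Z z)) \<longlonglongrightarrow> g' (X (fst z)) * (?DX z * ?Z z)"
      using AE_pair_fst[OF sigma_finite_half_line lim_AE]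
    proof eventually_elim
      case (elim z)
      have "isCont g' (X (fst z))" using g(2) by (simp add: continuous_on_eq_continuous_at)
      from isCont_tendsto_compose[OF this elim] show ?case by (intro tendsto_intros)
    qed
    show "AE z in MT. norm (g' (F m (V (fst z))) * (?DX z * ?Z z)) \<le> L * \<bar>?DX z * ?Z z\<bar>" for m
      using g(3) by (intro AE_I2) (simp add: abs_mult mult_right_mono)
  qed measurable
  have limL: "(\<lambda>m. \<integral>(\<omega>, t). grad (\<lambda>k x. g' (F m x) * F' m k x) t (V \<omega>) * Z t \<omega> \<partial>MT)
      \<longlonglongrightarrow> 0 + (\<integral>z. g' (X (fst z)) * (?DX z * ?Z z) \<partial>MT)"
  proof (rule Lim_transform_eventually[OF tendsto_add[OF lim1 lim2]], intro always_eventually allI)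
    fix m
    have i1: "integrable MT (\<lambda>z. g' (F m (V (fst z))) * ((?G m z - ?DX z) * ?Z z))"
      by (rule bounded_int[OF sqint_mult_integrable[OF sqint_diff[OF sqint_grad(1)[OF F] sqint_DX] sqint_Z] _ g(3)])
        measurable
    have i2: "integrable MT (\<lambda>z. g' (F m (V (fst z))) * (?DX z * ?Z z))"
      by (rule bounded_int[OF int_DXZ _ g(3)]) measurable
    show "(\<integral>z. g' (F m (V (fst z))) * ((?G m z - ?DX z) * ?Z z) \<partial>MT) +
        (\<integral>z. g' (F m (V (fst z))) * (?DX z * ?Z z) \<partial>MT)
      = (\<integral>(\<omega>, t). grad (\<lambda>k x. g' (F m x) * F' m k x) t (V \<omega>) * Z t \<omega> \<partial>MT)"
    proof (subst Bochner_Integration.integral_add[OF i1 i2, symmetric],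
        rule Bochner_Integration.integral_cong[OF refl])
      fix z :: "'a \<times> real"
      obtain \<omega> t where z: "z = (\<omega>, t)" by (cases z)
      have "grad (\<lambda>k x. g' (F m x) * F' m k x) t (V \<omega>) = g' (F m (V \<omega>)) * grad (F' m) t (V \<omega>)"
        by (simp add: grad_def)
      then show "g' (F m (V (fst z))) * ((?G m z - ?DX z) * ?Z z) + g' (F m (V (fst z))) * (?DX z * ?Z z)
          = (case z of (\<omega>, t) \<Rightarrow> grad (\<lambda>k x. g' (F m x) * F' m k x) t (V \<omega>) * Z t \<omega>)"
        by (simp add: z left_diff_distrib right_diff_distrib)
    qed
  qed
  have dual: "(\<integral>(\<omega>, t). grad (\<lambda>k x. g' (F m x) * F' m k x) t (V \<omega>) * Z t \<omega> \<partial>MT)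
      = 2 * (\<integral>\<omega>. X \<omega> * g (F m (V \<omega>)) \<partial>M)" for m
    using duality[OF gF X0, of m] by (simp add: mult.commute)
  have limR: "(\<lambda>m. 2 * (\<integral>\<omega>. X \<omega> * g (F m (V \<omega>)) \<partial>M)) \<longlonglongrightarrow> 2 * (\<integral>\<omega>. X \<omega> * g (X \<omega>) \<partial>M)"
  proof (intro tendsto_intros tendsto_L2_mult[OF sqint_cyl[OF gF] sq_gX sqint_X])
    \<comment> \<open>The bound on \<open>g'\<close> makes \<open>g\<close> Lipschitz, so L2
      convergence of \<open>F m\<close> to \<open>X\<close> is inherited by
      \<open>g (F m)\<close>.\<close>
    show "(\<lambda>m. \<integral>\<omega>. (g (X \<omega>) - g (F m (V \<omega>)))\<^sup>2 \<partial>M) \<longlonglongrightarrow> 0"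
    proof (rule tendsto_sandwich[OF _ _ tendsto_const])
      have "(\<lambda>m. L\<^sup>2 * (\<integral>\<omega>. (X \<omega> - F m (V \<omega>))\<^sup>2 \<partial>M)) \<longlonglongrightarrow> L\<^sup>2 * 0"
        by (intro tendsto_intros lim)
      then show "(\<lambda>m. L\<^sup>2 * (\<integral>\<omega>. (X \<omega> - F m (V \<omega>))\<^sup>2 \<partial>M)) \<longlonglongrightarrow> 0" by simp
      show "\<forall>\<^sub>F m in sequentially. (\<integral>\<omega>. (g (X \<omega>) - g (F m (V \<omega>)))\<^sup>2 \<partial>M)
          \<le> L\<^sup>2 * (\<integral>\<omega>. (X \<omega> - F m (V \<omega>))\<^sup>2 \<partial>M)"
      proof (intro always_eventually allI)
        fix m
        have "(\<integral>\<omega>. (g (X \<omega>) - g (F m (V \<omega>)))\<^sup>2 \<partial>M) \<le> (\<integral>\<omega>. L\<^sup>2 * (X \<omega> - F m (V \<omega>))\<^sup>2 \<partial>M)"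
        proof (rule integral_mono)
          show "integrable M (\<lambda>\<omega>. (g (X \<omega>) - g (F m (V \<omega>)))\<^sup>2)"
            using sqint_diff[OF sq_gX sqint_cyl[OF gF[of m]]] by (simp add: sqint_def)
          show "integrable M (\<lambda>\<omega>. L\<^sup>2 * (X \<omega> - F m (V \<omega>))\<^sup>2)"
            using sqint_diff[OF sqint_X sqint_cyl[OF F[of m]]] by (simp add: sqint_def)
          show "(g (X \<omega>) - g (F m (V \<omega>)))\<^sup>2 \<le> L\<^sup>2 * (X \<omega> - F m (V \<omega>))\<^sup>2" for \<omega>
            using power_mono[OF lip[of "X \<omega>" "F m (V \<omega>)"], of 2] by (simp add: power_mult_distrib)
        qed
        then show "(\<integral>\<omega>. (g (X \<omega>) - g (F m (V \<omega>)))\<^sup>2 \<partial>M) \<le> L\<^sup>2 * (\<integral>\<omega>. (X \<omega> - F m (V \<omega>))\<^sup>2 \<partial>M)"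
          by simp
      qed
    qed auto
  qed
  have "(\<integral>z. g' (X (fst z)) * (?DX z * ?Z z) \<partial>MT) = 2 * (\<integral>\<omega>. X \<omega> * g (X \<omega>) \<partial>M)"
    using LIMSEQ_unique[OF limL[unfolded dual] limR] by simp
  moreover have "(\<integral>z. g' (X (fst z)) * (?DX z * ?Z z) \<partial>MT) = (\<integral>\<omega>. g' (X \<omega>) * T_functional DX Z \<omega> \<partial>M)"
  proof -
    have "integrable MT (\<lambda>z. g' (X (fst z)) * (?DX z * ?Z z))"
      by (rule bounded_int[OF int_DXZ _ g(3)]) measurable
    from MT.integral_fst'[OF this] show ?thesis
      by (simp add: T_functional_def)
  qed
  ultimately show "(\<integral>\<omega>. g' (X \<omega>) * T_functional DX Z \<omega> \<partial>M) = 2 * (\<integral>\<omega>. g (X \<omega>) * X \<omega> \<partial>M)"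
    by (simp add: mult.commute)
qed

text \<open>The case of the identity function. It converts the distance of T_X from 2 into a
  variance defect plus the fluctuation of T_X.\<close>

lemma expectation_T:
  assumes X0: "(\<integral>\<omega>. X \<omega> \<partial>M) = 0"
  shows "(\<integral>\<omega>. T_functional DX Z \<omega> \<partial>M) = 2 * (\<integral>\<omega>. (X \<omega>)\<^sup>2 \<partial>M)"
  using integration_by_parts(1)[OF X0, of "\<lambda>x. x" "\<lambda>_. 1" 1] by (simp add: power2_eq_square)

end

section \<open>Stein's equation for the normal law\<close>

definition upper_int :: "(real \<Rightarrow> real) \<Rightarrow> real \<Rightarrow> real" where
  "upper_int q x = (\<integral>t. indicator {x..} t * q t \<partial>lborel)"

lemma integrable_indicator_mult:
  fixes q :: "real \<Rightarrow> real"
  assumes "integrable lborel q" "A \<in> sets borel"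
  shows "integrable lborel (\<lambda>t. indicator A t * q t)"
proof (rule Bochner_Integration.integrable_bound[OF assms(1)])
  show "AE t in lborel. norm (indicator A t * q t) \<le> norm (q t)"
    by (auto simp: indicator_def)
qed (use assms in measurable)

lemma upper_int_split:
  fixes q :: "real \<Rightarrow> real"
  assumes q: "integrable lborel q" and cont: "continuous_on {y..b} q" and "y \<le> b"
  shows "upper_int q y = upper_int q b + integral {y..b} q"
proof -
  have si: "set_integrable lborel {y..b} q"
    using integrable_indicator_mult[OF q, of "{y..b}"] by (simp add: set_integrable_def)
  have "integral {y..b} q = (\<integral>t. indicator {y..b} t * q t \<partial>lborel)"
    using set_borel_integral_eq_integral(2)[OF si] by (simp add: set_lebesgue_integral_def)
  moreover have "upper_int q y = (\<integral>t. indicator {b..} t * q t + indicator {y..b} t * q t \<partial>lborel)"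
    unfolding upper_int_def
  proof (rule integral_cong_AE)
    show "AE t in lborel. indicator {y..} t * q t = indicator {b..} t * q t + indicator {y..b} t * q t"
      using AE_lborel_singleton[of b]
      by eventually_elim (use \<open>y \<le> b\<close> in \<open>auto simp: indicator_def\<close>)
  qed (use borel_measurable_integrable[OF q] in simp_all)
  ultimately show ?thesis
    using integrable_indicator_mult[OF q] by (simp add: upper_int_def)
qed

text \<open>Continuity is asked on an open half line only, because the gamma density may be
  unbounded at 0. The splitting point \<open>b\<close> reduces the claim to the fundamental theorem
  on a compact interval around \<open>x\<close>.\<close>

lemma upper_int_has_real_derivative:
  assumes q: "integrable lborel q" and cont: "continuous_on {c<..} q" and x: "c < x"
  shows "(upper_int q has_real_derivative - q x) (at x)"
proof -
  define a where "a = (c + x) / 2"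
  define b where "b = x + 1"
  have ab: "c < a" "a < x" "x < b" using x by (auto simp: a_def b_def field_simps)
  have cont': "continuous_on {y..b} q" if "a \<le> y" for y
    by (rule continuous_on_subset[OF cont]) (use ab that in auto)
  have "((\<lambda>y. integral {y..b} q) has_real_derivative - q x) (at x within {a..b})"
    by (rule integral_has_real_derivative') (use ab cont' in auto)
  then have "((\<lambda>y. upper_int q b + integral {y..b} q) has_real_derivative - q x) (at x)"
    using ab by (auto simp: at_within_Icc_at intro!: derivative_eq_intros)
  then show ?thesis
  proof (rule has_field_derivative_transform_within_open[of _ _ _ "{a<..<b}"])
    show "upper_int q b + integral {y..b} q = upper_int q y" if "y \<in> {a<..<b}" for y
      using upper_int_split[OF q cont', of y] that by simp
  qed (use ab in auto)
qed

lemma upper_int_tendsto_0: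
  assumes q: "integrable lborel q"
  shows "(upper_int q \<longlongrightarrow> 0) at_top"
proof -
  have "((\<lambda>x. \<integral>t. indicator {x..} t * q t \<partial>lborel) \<longlongrightarrow> (\<integral>t. 0 \<partial>(lborel :: real measure))) at_top"
  proof (rule integral_dominated_convergence_at_top[where w = "\<lambda>t. \<bar>q t\<bar>"])
    show "AE t in lborel. ((\<lambda>x. indicator {x..} t * q t) \<longlongrightarrow> 0) at_top"
    proof (rule AE_I2)
      fix t :: real
      have "\<forall>\<^sub>F x in at_top. indicator {x..} t * q t = 0"
        using eventually_gt_at_top[of t] by eventually_elim (simp add: indicator_def)
      then show "((\<lambda>x. indicator {x..} t * q t) \<longlongrightarrow> 0) at_top"
        by (rule tendsto_eventually)
    qed
    show "\<forall>\<^sub>F x in at_top. AE t in lborel. norm (indicator {x..} t * q t) \<le> \<bar>q t\<bar>"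
      by (intro always_eventually allI AE_I2) (simp add: indicator_def)
  qed (use q in \<open>auto\<close>)
  then show ?thesis by (simp add: upper_int_def[abs_def])
qed

lemma upper_int_mono:
  assumes "integrable lborel p" "integrable lborel q" "\<And>t. x \<le> t \<Longrightarrow> p t \<le> q t"
  shows "upper_int p x \<le> upper_int q x"
  unfolding upper_int_def using assms
  by (intro integral_mono integrable_indicator_mult) (auto simp: indicator_def)

lemma abs_upper_int_le:
  assumes "integrable lborel p" "integrable lborel q" "\<And>t. x \<le> t \<Longrightarrow> \<bar>p t\<bar> \<le> q t"
  shows "\<bar>upper_int p x\<bar> \<le> upper_int q x"
proof -
  have "upper_int p x \<le> upper_int q x"
    by (rule upper_int_mono) (use assms in \<open>auto simp: abs_le_iff\<close>)
  moreover have "upper_int (\<lambda>t. - q t) x \<le> upper_int p x"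
    by (rule upper_int_mono) (use assms in \<open>auto simp: abs_le_iff minus_le_iff\<close>)
  moreover have "upper_int (\<lambda>t. - q t) x = - upper_int q x"
    by (simp add: upper_int_def)
  ultimately show ?thesis by (simp add: abs_le_iff)
qed

lemma upper_int_lin:
  assumes "integrable lborel p" "integrable lborel q"
  shows "upper_int (\<lambda>t. c * p t + d * q t) x = c * upper_int p x + d * upper_int q x"
  using integrable_indicator_mult[OF assms(1), of "{x..}"] integrable_indicator_mult[OF assms(2), of "{x..}"]
  by (simp add: upper_int_def distrib_left mult.left_commute[of _ c] mult.left_commute[of _ d])

text \<open>As the total integral is 0, the upper tail is minus the lower tail, and reflection makes
  that an upper tail again. Estimates for nonnegative arguments thus extend to negative
  ones.\<close>

lemma upper_int_minus:
  assumes q: "integrable lborel q" and zero: "(\<integral>t. q t \<partial>lborel) = 0"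
  shows "upper_int q (- x) = - upper_int (\<lambda>t. q (- t)) x"
proof -
  have "upper_int (\<lambda>t. q (- t)) x = (\<integral>t. indicator {..-x} t * q t \<partial>lborel)"
    using lborel_integral_real_affine[of "-1" "\<lambda>t. indicator {..-x} t * q t" 0]
    by (simp add: upper_int_def indicator_def minus_le_iff)
  moreover have "upper_int q (- x) + (\<integral>t. indicator {..-x} t * q t \<partial>lborel)
      = (\<integral>t. indicator {-x..} t * q t + indicator {..-x} t * q t \<partial>lborel)"
    using integrable_indicator_mult[OF q] by (simp add: upper_int_def)
  moreover have "\<dots> = (\<integral>t. q t \<partial>lborel)"
  proof (rule integral_cong_AE)
    show "AE t in lborel. indicator {-x..} t * q t + indicator {..-x} t * q t = q t"
      using AE_lborel_singleton[of "-x"] by eventually_elim (auto simp: indicator_def)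
  qed (use borel_measurable_integrable[OF q] in simp_all)
  ultimately show ?thesis using zero by simp
qed

section \<open>The Gaussian density and its Mills ratio\<close>

abbreviation (input) phi :: "real \<Rightarrow> real" where "phi \<equiv> std_normal_density"

lemma phi_pos: "0 < phi x"
  by (simp add: normal_density_pos)

lemma phi_deriv: "(phi has_real_derivative - x * phi x) (at x)"
proof -
  have "((\<lambda>x. (1 / sqrt (2 * pi)) * exp (- x\<^sup>2 / 2)) has_real_derivative - x * ((1 / sqrt (2 * pi)) * exp (- x\<^sup>2 / 2))) (at x)"
    by (auto intro!: derivative_eq_intros simp: field_simps)
  then show ?thesis by (simp add: std_normal_density_def[abs_def])
qed

lemma continuous_phi: "continuous_on A phi"
  using phi_deriv by (meson DERIV_continuous continuous_at_imp_continuous_on)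

lemma integrable_phi: "integrable lborel phi" "integrable lborel (\<lambda>t. phi t * t)"
  "integrable lborel (\<lambda>t. phi t * t\<^sup>2)"
  using integrable_std_normal_moment[of 0] integrable_std_normal_moment[of 1] integrable_std_normal_moment[of 2]
  by simp_all

lemma integral_phi: "(\<integral>t. phi t \<partial>lborel) = 1" "(\<integral>t. phi t * t \<partial>lborel) = 0" "(\<integral>t. phi t * t\<^sup>2 \<partial>lborel) = 1"
  using integral_std_normal_moment_even[of 0] integral_std_normal_moment_odd[of 0]
    integral_std_normal_moment_even[of 1]
  by simp_all

lemma phi_tendsto_0: "(phi \<longlongrightarrow> 0) at_top"
proof -
  have "((\<lambda>x::real. exp (- x)) \<longlongrightarrow> 0) at_top"
    by (rule filterlim_compose[OF exp_at_bot filterlim_uminus_at_bot_at_top])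
  then have "((\<lambda>x::real. (1 / sqrt (2 * pi)) * exp (1/2) * exp (- x)) \<longlongrightarrow> (1 / sqrt (2 * pi)) * exp (1/2) * 0) at_top"
    by (intro tendsto_intros)
  then have lim: "((\<lambda>x::real. (1 / sqrt (2 * pi)) * exp (1/2) * exp (- x)) \<longlongrightarrow> 0) at_top" by simp
  show ?thesis
  proof (rule tendsto_sandwich[OF _ _ tendsto_const lim])
    show "\<forall>\<^sub>F x in at_top. 0 \<le> phi x" using phi_pos by (auto intro: always_eventually less_imp_le)
    have "phi x \<le> (1 / sqrt (2 * pi)) * exp (1/2) * exp (- x)" for x
    proof -
      have "0 \<le> (x - 1)\<^sup>2" by simp
      then have "- x\<^sup>2 / 2 \<le> 1/2 + - x" by (simp add: power2_diff)
      then have "exp (- x\<^sup>2 / 2) \<le> exp (1/2) * exp (- x)" by (simp only: exp_add[symmetric] exp_le_cancel_iff)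
      then have "(1 / sqrt (2 * pi)) * exp (- x\<^sup>2 / 2) \<le> (1 / sqrt (2 * pi)) * (exp (1/2) * exp (- x))"
        by (rule mult_left_mono) simp
      then show ?thesis by (simp add: std_normal_density_def)
    qed
    then show "\<forall>\<^sub>F x in at_top. phi x \<le> (1 / sqrt (2 * pi)) * exp (1/2) * exp (- x)"
      by (auto intro: always_eventually)
  qed
qed

text \<open>Both sides have derivative \<open>- x * phi x\<close> and vanish at infinity.\<close>

lemma upper_int_phi_mult: "upper_int (\<lambda>t. phi t * t) x = phi x"
proof -
  have d: "((\<lambda>x. upper_int (\<lambda>t. phi t * t) x - phi x) has_real_derivative 0) (at x)" for x
  proof -
    have "(upper_int (\<lambda>t. phi t * t) has_real_derivative - (phi x * x)) (at x)"
      by (rule upper_int_has_real_derivative[OF integrable_phi(2), of "x - 1"])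
        (auto intro!: continuous_intros continuous_phi)
    from DERIV_diff[OF this phi_deriv] show ?thesis by simp
  qed
  have const: "upper_int (\<lambda>t. phi t * t) y - phi y = upper_int (\<lambda>t. phi t * t) x - phi x" for y
    using DERIV_isconst_all[of "\<lambda>x. upper_int (\<lambda>t. phi t * t) x - phi x" y x] d by blast
  have "((\<lambda>x. upper_int (\<lambda>t. phi t * t) x - phi x) \<longlongrightarrow> 0 - 0) at_top"
    by (intro tendsto_diff upper_int_tendsto_0 integrable_phi phi_tendsto_0)
  from Lim_transform_eventually[OF this always_eventually[OF allI[OF const]]]
  have "((\<lambda>y::real. upper_int (\<lambda>t. phi t * t) x - phi x) \<longlongrightarrow> 0) at_top"
    by (simp only: diff_zero)
  then have "upper_int (\<lambda>t. phi t * t) x - phi x = 0"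
    by (subst (asm) tendsto_const_iff) auto
  then show ?thesis by simp
qed

text \<open>The classical upper bound for the Mills ratio: \<open>x \<le> t\<close> throughout the
  tail, and the tail integral of \<open>t * phi t\<close> is \<open>phi x\<close>.\<close>

lemma x_upper_int_phi_le: "x * upper_int phi x \<le> phi x"
proof -
  have "upper_int (\<lambda>t. x * phi t) x \<le> upper_int (\<lambda>t. phi t * t) x"
  proof (rule upper_int_mono)
    show "x * phi t \<le> phi t * t" if "x \<le> t" for t
      by (subst mult.commute) (rule mult_left_mono[OF that less_imp_le[OF phi_pos]])
    show "integrable lborel (\<lambda>t. x * phi t)"
      by (intro integrable_mult_right integrable_phi)
  qed (rule integrable_phi)
  moreover have "upper_int (\<lambda>t. x * phi t) x = x * upper_int phi x"
    unfolding upper_int_def by (subst mult.left_commute) (rule integral_mult_right_zero)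
  ultimately show ?thesis by (simp only: upper_int_phi_mult)
qed

text \<open>Birnbaum's lower bound for the Mills ratio.\<close>

definition mills :: "real \<Rightarrow> real" where
  "mills x = (sqrt (4 + x\<^sup>2) - x) / 2"

lemma mills_root: "(mills x)\<^sup>2 + x * mills x = 1"
  by (simp add: mills_def power2_eq_square field_simps)

lemma mills_pos: "0 < mills x"
proof -
  have "x \<le> \<bar>x\<bar>" by simp
  also have "\<bar>x\<bar> = sqrt (x\<^sup>2)" by simp
  also have "\<dots> < sqrt (4 + x\<^sup>2)" by (rule real_sqrt_less_mono) simp
  finally show ?thesis by (simp add: mills_def)
qed

lemma mills_le_1: "0 \<le> x \<Longrightarrow> mills x \<le> 1"
proof (rule ccontr)
  assume "0 \<le> x" "\<not> mills x \<le> 1"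
  then have "1 < (mills x)\<^sup>2" by (simp add: one_less_power)
  moreover have "0 \<le> x * mills x" using \<open>0 \<le> x\<close> mills_pos[of x] by simp
  ultimately show False using mills_root[of x] by simp
qed

text \<open>The difference of the two sides tends to 0 at infinity and is strictly decreasing, hence
  positive. By \<open>mills_root\<close> its derivative factors, and the sign is that of
  \<open>1 / S - mills y\<close>.\<close>

lemma mills_le: "mills x * phi x \<le> upper_int phi x"
proof -
  have "0 < upper_int phi x - mills x * phi x"
  proof (rule DERIV_neg_imp_decreasing_at_top[where f = "\<lambda>x. upper_int phi x - mills x * phi x"])
    fix y :: real
    define S where "S = sqrt (4 + y\<^sup>2)"
    have S: "0 < S" "S\<^sup>2 = 4 + y\<^sup>2" by (auto simp: S_def add_pos_nonneg)
    have m: "mills y = (S - y) / 2" by (simp add: mills_def S_def)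
    have dm: "(mills has_real_derivative - mills y / S) (at y)"
    proof -
      have "((\<lambda>x. (sqrt (4 + x\<^sup>2) - x) / 2) has_real_derivative ((2 * y) * (inverse (sqrt (4 + y\<^sup>2)) / 2) - 1) / 2) (at y)"
        using S(1) by (auto intro!: derivative_eq_intros simp: S_def)
      moreover have "((2 * y) * (inverse (sqrt (4 + y\<^sup>2)) / 2) - 1) / 2 = - mills y / S"
        using S(1) by (simp add: mills_def S_def[symmetric] field_simps)
      ultimately show ?thesis unfolding mills_def[abs_def] by (simp only:)
    qed
    have "(upper_int phi has_real_derivative - phi y) (at y)"
      by (rule upper_int_has_real_derivative[OF integrable_phi(1), of "y - 1"]) (auto intro: continuous_phi)
    from DERIV_diff[OF this DERIV_mult[OF dm phi_deriv]]
    have "((\<lambda>x. upper_int phi x - mills x * phi x) has_real_derivative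
        (1 / S - mills y) * mills y * phi y) (at y)"
    proof (rule DERIV_cong)
      have "- phi y - (- mills y / S * phi y + - y * phi y * mills y)
          = (mills y / S - (1 - y * mills y)) * phi y" by (simp add: algebra_simps)
      also have "1 - y * mills y = mills y * mills y"
        using mills_root[of y] by (simp add: power2_eq_square)
      finally show "- phi y - (- mills y / S * phi y + - y * phi y * mills y) = (1 / S - mills y) * mills y * phi y"
        by (simp add: algebra_simps)
    qed
    moreover have "1 / S - mills y < 0"
    proof -
      \<comment> \<open>Equivalent to \<open>mills y * S > 1\<close>; after squaring, the two sides
        differ by exactly 4.\<close>
      have "y * S < 2 + y\<^sup>2"
      proof (rule power2_less_imp_less)
        show "(y * S)\<^sup>2 < (2 + y\<^sup>2)\<^sup>2"
          by (simp add: power_mult_distrib S(2)) (simp add: power2_eq_square algebra_simps)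
      qed simp
      then have "1 < mills y * S" using S(2) by (simp add: m power2_eq_square algebra_simps)
      then show ?thesis using S(1) by (simp add: field_simps)
    qed
    ultimately show "\<exists>z. ((\<lambda>x. upper_int phi x - mills x * phi x) has_real_derivative z) (at y) \<and> z < 0"
      using mills_pos[of y] phi_pos[of y] by (intro exI conjI) (auto simp: mult_less_0_iff zero_less_mult_iff)
  next
    have "((\<lambda>x. mills x * phi x) \<longlongrightarrow> 0) at_top"
    proof (rule tendsto_sandwich[OF _ _ tendsto_const phi_tendsto_0])
      show "\<forall>\<^sub>F x in at_top. 0 \<le> mills x * phi x"
        using mills_pos phi_pos by (intro always_eventually allI) (simp add: less_imp_le)
      show "\<forall>\<^sub>F x in at_top. mills x * phi x \<le> phi x"
        using eventually_ge_at_top[of 0]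
        by eventually_elim (use mills_le_1 phi_pos in \<open>simp add: mult_left_le_one_le less_imp_le mills_pos\<close>)
    qed
    from tendsto_diff[OF upper_int_tendsto_0[OF integrable_phi(1)] this]
    show "((\<lambda>x. upper_int phi x - mills x * phi x) \<longlongrightarrow> 0) at_top" by simp
  qed
  then show ?thesis by simp
qed

text \<open>The estimate behind the constant 1 for Lipschitz test functions. Birnbaum's bound and
  the equation of \<open>m\<close> give the factor \<open>1 - x * m = m\<^sup>2\<close>, and
  \<open>m\<^sup>2 \<le> R - x\<close> is then conjugated with \<open>R + x\<close>.\<close>

lemma mills_bound:
  assumes x: "0 \<le> x"
  shows "(phi x - x * upper_int phi x) * (sqrt (1 + x\<^sup>2) + x) \<le> phi x"
proof -
  define m R where "m = mills x" and "R = sqrt (1 + x\<^sup>2)"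
  have m: "0 < m" "m \<le> 1" "m\<^sup>2 + x * m = 1"
    using mills_pos mills_le_1[OF x] mills_root by (auto simp: m_def)
  have R: "0 < R" "R\<^sup>2 = 1 + x\<^sup>2" by (auto simp: R_def add_pos_nonneg)
  have key: "m\<^sup>2 \<le> R - x"
  proof -
    have "m\<^sup>2 + x \<le> R" unfolding R_def
    proof (rule real_le_rsqrt)
      have "(m\<^sup>2 + x)\<^sup>2 = m^4 + 2 * m * (x * m) + x\<^sup>2" by (simp add: power2_eq_square power4_eq_xxxx algebra_simps)
      also have "x * m = 1 - m\<^sup>2" using m(3) by simp
      \<comment> \<open>The identity exhibits the defect from 1 as
        \<open>(1 - m)^3 * (m + 1)\<close>, nonnegative because \<open>m\<close> lies in (0,
        1].\<close>
      also have "m^4 + 2 * m * (1 - m\<^sup>2) = 1 - (1 - m)^3 * (m + 1)"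
        by (simp add: power2_eq_square power3_eq_cube power4_eq_xxxx algebra_simps)
      also have "\<dots> \<le> 1" using m by simp
      finally show "(m\<^sup>2 + x)\<^sup>2 \<le> 1 + x\<^sup>2" by simp
    qed
    then show ?thesis by simp
  qed
  have "phi x - x * upper_int phi x \<le> phi x - x * (m * phi x)"
    using mult_left_mono[OF mills_le x] by (simp add: m_def)
  also have "\<dots> = (1 - x * m) * phi x" by (simp add: algebra_simps)
  also have "\<dots> = m\<^sup>2 * phi x"
  proof -
    have "1 - x * m = m\<^sup>2" using m(3) by linarith
    then show ?thesis by (rule arg_cong)
  qed
  also have "\<dots> \<le> (R - x) * phi x"
    using key phi_pos[of x] by (intro mult_right_mono) auto
  finally have "(phi x - x * upper_int phi x) * (R + x) \<le> (R - x) * phi x * (R + x)"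
    using R(1) x by (intro mult_right_mono) auto
  also have "\<dots> = (R\<^sup>2 - x\<^sup>2) * phi x" by (simp add: power2_eq_square algebra_simps)
  finally show ?thesis using R(2) by (simp add: R_def)
qed

text \<open>Variation of constants for \<open>f' x - x * f x = k x\<close>, integrated from
  infinity. For centred \<open>k\<close>, integrating from minus infinity gives the same
  function.\<close>

definition stein_sol :: "(real \<Rightarrow> real) \<Rightarrow> real \<Rightarrow> real" where
  "stein_sol k x = - upper_int (\<lambda>t. phi t * k t) x / phi x"

definition stein_class :: "(real \<Rightarrow> real) \<Rightarrow> bool" where
  "stein_class k \<longleftrightarrow> continuous_on UNIV k \<and> integrable lborel (\<lambda>t. phi t * k t) \<and>
     (\<integral>t. phi t * k t \<partial>lborel) = 0"

lemma stein_sol_deriv: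
  assumes k: "stein_class k"
  shows "(stein_sol k has_real_derivative k x + x * stein_sol k x) (at x)"
proof -
  have "continuous_on {x - 1<..} k"
    by (rule continuous_on_subset[of UNIV]) (use k in \<open>simp_all add: stein_class_def\<close>)
  then have "continuous_on {x - 1<..} (\<lambda>t. phi t * k t)"
    by (rule continuous_on_mult[OF continuous_phi])
  moreover have "integrable lborel (\<lambda>t. phi t * k t)" using k by (simp add: stein_class_def)
  ultimately have "(upper_int (\<lambda>t. phi t * k t) has_real_derivative - (phi x * k x)) (at x)"
    by (intro upper_int_has_real_derivative[of _ "x - 1"]) simp_all
  then show ?thesis
    unfolding stein_sol_def[abs_def] using phi_pos[of x]
    by (auto intro!: derivative_eq_intros phi_deriv simp: field_simps power2_eq_square)
qed

lemma phi_minus: "phi (- t) = phi t"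
  by (simp add: std_normal_density_def)

lemma stein_sol_minus:
  assumes "stein_class k"
  shows "stein_sol k (- x) = - stein_sol (\<lambda>t. k (- t)) x"
proof -
  have "upper_int (\<lambda>t. phi t * k t) (- x) = - upper_int (\<lambda>t. phi (- t) * k (- t)) x"
    by (rule upper_int_minus) (use assms in \<open>simp_all only: stein_class_def\<close>)
  then show ?thesis unfolding stein_sol_def phi_minus by (simp only: minus_divide_left)
qed

lemma stein_class_minus:
  assumes k: "stein_class k"
  shows "stein_class (\<lambda>t. k (- t))"
proof -
  have cont: "continuous_on UNIV k" and int: "integrable lborel (\<lambda>t. phi t * k t)"
    and zero: "(\<integral>t. phi t * k t \<partial>lborel) = 0"
    using k unfolding stein_class_def by blast+
  have "continuous_on UNIV (\<lambda>t. k (- t))"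
    by (rule continuous_on_compose2[OF cont]) (auto intro!: continuous_intros)
  moreover have "integrable lborel (\<lambda>t. phi (- t) * k (- t))"
    using lborel_integrable_real_affine[OF int, of "-1" 0] by simp
  moreover have "(\<integral>t. phi (- t) * k (- t) \<partial>lborel) = 0"
    using lborel_integral_real_affine[of "-1" "\<lambda>t. phi t * k t" 0] zero by simp
  ultimately show ?thesis unfolding stein_class_def phi_minus by blast
qed

text \<open>The Mills upper bound gives \<open>\<bar>x * stein_sol k x\<bar> \<le> 1\<close> for
  \<open>x \<ge> 0\<close>, reflection covers \<open>x < 0\<close>, and
  \<open>\<bar>k x\<bar> \<le> 1\<close> contributes the rest.\<close>

lemma stein_sol_deriv_bounded:
  assumes k: "stein_class k" and K: "\<And>x. \<bar>k x\<bar> \<le> 1"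
  shows "\<bar>k x + x * stein_sol k x\<bar> \<le> 2"
proof -
  have pos: "\<bar>x * stein_sol k x\<bar> \<le> 1"
    if "0 \<le> x" "stein_class k" "\<And>x. \<bar>k x\<bar> \<le> 1" for x and k :: "real \<Rightarrow> real"
  proof -
    have "\<bar>upper_int (\<lambda>t. phi t * k t) x\<bar> \<le> upper_int phi x"
    proof (rule abs_upper_int_le)
      show "\<bar>phi t * k t\<bar> \<le> phi t" for t
        using mult_left_mono[OF that(3)[of t] less_imp_le[OF phi_pos[of t]]] phi_pos[of t] by (simp add: abs_mult)
    qed (use that(2) integrable_phi in \<open>auto simp: stein_class_def\<close>)
    then have "x * \<bar>upper_int (\<lambda>t. phi t * k t) x\<bar> \<le> x * upper_int phi x"
      using that(1) by (rule mult_left_mono)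
    also have "\<dots> \<le> phi x" by (rule x_upper_int_phi_le)
    finally show ?thesis
      using that(1) phi_pos[of x] by (simp add: stein_sol_def abs_mult field_simps)
  qed
  have "\<bar>x * stein_sol k x\<bar> \<le> 1"
  proof (cases "0 \<le> x")
    case False
    then have "\<bar>(- x) * stein_sol (\<lambda>t. k (- t)) (- x)\<bar> \<le> 1"
      using K by (intro pos stein_class_minus k) auto
    then show ?thesis
      using stein_sol_minus[OF k, of "- x"] by simp
  qed (use pos k K in auto)
  then show ?thesis using K[of x] by linarith
qed

text \<open>\<open>c\<close> is the tail integral of \<open>(t - x) * phi t\<close>. The Lipschitz
  property bounds the tail of \<open>k - k x\<close> by \<open>c\<close>, and centring gives
  \<open>\<bar>k x\<bar> \<le> R\<close>, the L2 distance from \<open>x\<close> to a standard normal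
  variable. What is left, \<open>(R + x) * c \<le> phi x\<close>, is
  \<open>mills_bound\<close>.\<close>

lemma stein_sol_deriv_lipschitz_nonneg:
  assumes k: "stein_class k" and lip: "\<And>x y. \<bar>k x - k y\<bar> \<le> \<bar>x - y\<bar>" and x: "0 \<le> x"
  shows "\<bar>k x + x * stein_sol k x\<bar> \<le> 1"
proof -
  define R where "R = sqrt (1 + x\<^sup>2)"
  have R: "0 < R" "R\<^sup>2 = 1 + x\<^sup>2" by (auto simp: R_def add_pos_nonneg)
  define c where "c = phi x - x * upper_int phi x"
  have c: "0 \<le> c" "c * (R + x) \<le> phi x"
    using x_upper_int_phi_le[of x] mills_bound[OF x] by (auto simp: c_def R_def)
  have int_k: "integrable lborel (\<lambda>t. phi t * k t)" and zero: "(\<integral>t. phi t * k t \<partial>lborel) = 0"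
    using k by (auto simp: stein_class_def)
  have kx: "\<bar>k x\<bar> \<le> R"
  proof -
    have "k x = (\<integral>t. k x * phi t - phi t * k t \<partial>lborel)"
      using int_k integrable_phi(1) zero integral_phi(1) by simp
    also have "\<bar>\<dots>\<bar> \<le> (\<integral>t. \<bar>k x * phi t - phi t * k t\<bar> \<partial>lborel)"
      by (rule integral_abs_bound)
    also have "\<dots> \<le> (\<integral>t. (R / 2 + x\<^sup>2 / (2 * R)) * phi t - (x / R) * (phi t * t) + (phi t * t\<^sup>2) / (2 * R) \<partial>lborel)"
    proof (rule integral_mono)
      show "integrable lborel (\<lambda>t. \<bar>k x * phi t - phi t * k t\<bar>)"
        using int_k integrable_phi(1) by simp
      show "integrable lborel (\<lambda>t. (R / 2 + x\<^sup>2 / (2 * R)) * phi t - (x / R) * (phi t * t) + (phi t * t\<^sup>2) / (2 * R))"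
        using integrable_phi by simp
      fix t :: real
      \<comment> \<open>The arithmetic-geometric mean inequality with weight \<open>R\<close>: since
        \<open>(x - t)\<^sup>2\<close> has Gaussian mean \<open>1 + x\<^sup>2 = R\<^sup>2\<close>,
        the resulting bound integrates to exactly \<open>R\<close>.\<close>
      have "0 \<le> (\<bar>x - t\<bar> - R)\<^sup>2" by simp
      then have "2 * \<bar>x - t\<bar> * R \<le> (x - t)\<^sup>2 + R\<^sup>2" by (simp add: power2_diff[of "\<bar>x - t\<bar>"])
      then have "\<bar>x - t\<bar> \<le> (R\<^sup>2 + (x - t)\<^sup>2) / (2 * R)" using R(1) by (simp add: pos_le_divide_eq algebra_simps)
      then have "phi t * \<bar>k x - k t\<bar> \<le> phi t * ((R\<^sup>2 + (x - t)\<^sup>2) / (2 * R))"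
        using lip[of x t] phi_pos[of t] by (intro mult_left_mono) auto
      moreover have "\<bar>k x * phi t - phi t * k t\<bar> = phi t * \<bar>k x - k t\<bar>"
      proof -
        have "k x * phi t - phi t * k t = phi t * (k x - k t)" by (simp add: algebra_simps)
        then show ?thesis using phi_pos[of t] by (simp add: abs_mult)
      qed
      moreover have "phi t * ((R\<^sup>2 + (x - t)\<^sup>2) / (2 * R))
          = (R / 2 + x\<^sup>2 / (2 * R)) * phi t - (x / R) * (phi t * t) + (phi t * t\<^sup>2) / (2 * R)"
        using R(1) by (simp add: power2_eq_square field_simps)
      ultimately show "\<bar>k x * phi t - phi t * k t\<bar>
          \<le> (R / 2 + x\<^sup>2 / (2 * R)) * phi t - (x / R) * (phi t * t) + (phi t * t\<^sup>2) / (2 * R)" by simp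
    qed
    also have "\<dots> = R / 2 + x\<^sup>2 / (2 * R) + 1 / (2 * R)"
      using integrable_phi integral_phi by simp
    also have "\<dots> = (R\<^sup>2 + (1 + x\<^sup>2)) / (2 * R)"
      using R(1) by (simp add: power2_eq_square field_simps)
    also have "R\<^sup>2 + (1 + x\<^sup>2) = R * (2 * R)" using R(2) by (simp add: power2_eq_square)
    also have "R * (2 * R) / (2 * R) = R" using R(1) by simp
    finally show ?thesis .
  qed
  have rest: "\<bar>upper_int (\<lambda>t. phi t * k t) x - k x * upper_int phi x\<bar> \<le> c"
  proof -
    have "upper_int (\<lambda>t. phi t * k t) x - k x * upper_int phi x = upper_int (\<lambda>t. 1 * (phi t * k t) + - k x * phi t) x"
      by (subst upper_int_lin[OF int_k integrable_phi(1)]) simp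
    also have "\<bar>\<dots>\<bar> \<le> upper_int (\<lambda>t. 1 * (phi t * t) + - x * phi t) x"
    proof (rule abs_upper_int_le)
      show "integrable lborel (\<lambda>t. 1 * (phi t * k t) + - k x * phi t)"
        "integrable lborel (\<lambda>t. 1 * (phi t * t) + - x * phi t)"
        using int_k integrable_phi by simp_all
      fix t assume "x \<le> t"
      have "1 * (phi t * k t) + - k x * phi t = phi t * (k t - k x)" by (simp add: algebra_simps)
      moreover have "\<bar>phi t * (k t - k x)\<bar> \<le> phi t * (t - x)"
        using lip[of t x] \<open>x \<le> t\<close> phi_pos[of t] by (auto simp: abs_mult intro!: mult_left_mono)
      ultimately show "\<bar>1 * (phi t * k t) + - k x * phi t\<bar> \<le> 1 * (phi t * t) + - x * phi t"
        by (simp add: algebra_simps)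
    qed
    also have "\<dots> = c"
      by (subst upper_int_lin[OF integrable_phi(2,1)]) (simp add: c_def upper_int_phi_mult)
    finally show ?thesis .
  qed
  \<comment> \<open>Adding and subtracting \<open>x * k x * upper_int phi x\<close> isolates the
    fluctuation of \<open>k\<close> from its value at \<open>x\<close>.\<close>
  have "phi x * (k x + x * stein_sol k x) = k x * c - x * (upper_int (\<lambda>t. phi t * k t) x - k x * upper_int phi x)"
    using phi_pos[of x] by (simp add: stein_sol_def c_def algebra_simps)
  also have "\<bar>\<dots>\<bar> \<le> \<bar>k x * c\<bar> + \<bar>x * (upper_int (\<lambda>t. phi t * k t) x - k x * upper_int phi x)\<bar>"
    by (rule abs_triangle_ineq4)
  also have "\<dots> \<le> R * c + x * c"
    unfolding abs_mult using kx rest c(1) x by (intro add_mono mult_mono) auto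
  also have "\<dots> \<le> phi x" using c(2) by (simp add: algebra_simps)
  finally show ?thesis
    using phi_pos[of x] by (simp add: abs_mult)
qed

lemma stein_sol_deriv_lipschitz:
  assumes k: "stein_class k" and lip: "\<And>x y. \<bar>k x - k y\<bar> \<le> \<bar>x - y\<bar>"
  shows "\<bar>k x + x * stein_sol k x\<bar> \<le> 1"
proof (cases "0 \<le> x")
  case False
  have "\<bar>k (- y) - k (- z)\<bar> \<le> \<bar>y - z\<bar>" for y z using lip[of "-y" "-z"] by simp
  then have "\<bar>k (- (- x)) + (- x) * stein_sol (\<lambda>t. k (- t)) (- x)\<bar> \<le> 1"
    using False by (intro stein_sol_deriv_lipschitz_nonneg stein_class_minus k) auto
  then show ?thesis
    using stein_sol_minus[OF k, of "- x"] by simp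
qed (use stein_sol_deriv_lipschitz_nonneg[OF k lip] in auto)

section \<open>Stein's equation for the gamma law\<close>

text \<open>\<open>v'\<close> is differentiable at \<open>x\<close> with no continuity of its
  derivative assumed; a positive value would still make \<open>v'\<close> positive just to the right
  of \<open>x\<close> and \<open>v\<close> increasing there.\<close>

lemma local_max_second_deriv_le_0:
  fixes v v' :: "real \<Rightarrow> real"
  assumes d1: "\<And>y. a < y \<Longrightarrow> y < b \<Longrightarrow> (v has_real_derivative v' y) (at y)"
    and d2: "(v' has_real_derivative l) (at x)" and x: "a < x" "x < b"
    and max: "\<And>y. a < y \<Longrightarrow> y < b \<Longrightarrow> v y \<le> v x"
  shows "v' x = 0" "l \<le> 0"
proof -
  show v'0: "v' x = 0"
  proof (rule DERIV_local_max[OF d1[OF x]])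
    show "0 < min (x - a) (b - x)" using x by simp
    show "\<forall>y. \<bar>x - y\<bar> < min (x - a) (b - x) \<longrightarrow> v y \<le> v x" by (auto intro!: max)
  qed
  show "l \<le> 0"
  proof (rule ccontr)
    assume "\<not> l \<le> 0"
    then have "0 < l" by simp
    from DERIV_pos_inc_right[OF d2 this]
    obtain d where d: "0 < d" "\<And>h. 0 < h \<Longrightarrow> h < d \<Longrightarrow> v' x < v' (x + h)" by blast
    define z where "z = x + min d (b - x) / 2"
    have z: "x < z" "z < x + d" "z < b" using d(1) x by (auto simp: z_def min_def field_simps)
    have "v x < v z"
    proof (rule DERIV_pos_imp_increasing_open[OF z(1)])
      fix y assume y: "x < y" "y < z"
      then have "0 < v' y" using d(2)[of "y - x"] v'0 z by simp
      then show "\<exists>m. DERIV v y :> m \<and> 0 < m" using d1[of y] y x z by (intro exI[of _ "v' y"]) auto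
    next
      show "continuous_on {x..z} v"
        by (intro continuous_at_imp_continuous_on ballI DERIV_isCont[OF d1]) (use x z in auto)
    qed
    then show False using max[of z] x z by simp
  qed
qed

text \<open>The barrier \<open>w + w\<^bsup>-b\<^esup> + c\<close> is a supersolution which dominates \<open>u\<close> at both ends of
  \<open>(0, \<infinity>)\<close>, so that a maximum of \<open>u - \<epsilon> \<cdot> barrier\<close> is attained.\<close>

lemma laguerre_max_principle:
  fixes u u' u'' g :: "real \<Rightarrow> real"
  assumes a: "0 < a"
    and d1: "\<And>w. 0 < w \<Longrightarrow> (u has_real_derivative u' w) (at w)"
    and d2: "\<And>w. 0 < w \<Longrightarrow> (u' has_real_derivative u'' w) (at w)"
    and eq: "\<And>w. 0 < w \<Longrightarrow> w * u'' w + (a + 2 - w) * u' w - 2 * u w = g w"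
    and g: "\<And>w. 0 < w \<Longrightarrow> - K \<le> g w" and K: "0 \<le> K"
    and near0: "0 < \<delta>" "\<And>w. 0 < w \<Longrightarrow> w < \<delta> \<Longrightarrow> w * u w \<le> C"
    and inf: "\<And>w. R < w \<Longrightarrow> u w \<le> C"
    and w0: "0 < w0"
  shows "2 * u w0 \<le> K"
proof (rule ccontr)
  assume "\<not> 2 * u w0 \<le> K"
  \<comment> \<open>\<open>b > 1\<close> lets \<open>w powr (-b)\<close> dominate a singularity of
    order \<open>1 / w\<close> at 0, while \<open>b \<le> 2\<close> and \<open>b \<le> a + 1\<close>
    keep the coefficients in the final estimate nonnegative.\<close>
  define b where "b = 1 + min 1 a"
  have b: "1 < b" "b \<le> 2" "b \<le> a + 1" using a by (auto simp: b_def)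
  \<comment> \<open>The constant \<open>(a + 2) / 2\<close> cancels the drift \<open>a + 2\<close>
    acting on the linear term, because the zeroth-order coefficient is -2.\<close>
  define B where "B w = w + w powr (-b) + (a + 2) / 2" for w :: real
  have B_pos: "0 < B w" if "0 < w" for w
    using that a by (auto simp: B_def intro!: add_pos_nonneg)
  \<comment> \<open>The barrier at \<open>w0\<close> costs a quarter of the excess
    \<open>2 * u w0 - K\<close>, so \<open>2 * v w0\<close> still exceeds \<open>K\<close>.\<close>
  define \<epsilon> where "\<epsilon> = (2 * u w0 - K) / (4 * B w0)"
  have \<epsilon>: "0 < \<epsilon>" using \<open>\<not> 2 * u w0 \<le> K\<close> B_pos[OF w0] by (simp add: \<epsilon>_def)
  define v where "v w = u w - \<epsilon> * B w" for w
  have "\<epsilon> * B w0 = (2 * u w0 - K) / 4" using B_pos[OF w0] by (simp add: \<epsilon>_def)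
  then have v0: "K < 2 * v w0" using \<open>\<not> 2 * u w0 \<le> K\<close> by (simp add: v_def field_simps)
  define C' where "C' = max C 1"
  have C': "0 < C'" "C \<le> C'" by (auto simp: C'_def)
  \<comment> \<open>The last entry ensures \<open>C' \<le> \<epsilon> * l powr (1 - b)\<close>, so
    that the barrier beats \<open>u\<close> at \<open>l\<close>; likewise
    \<open>C' / \<epsilon> < r\<close> below does so at \<open>r\<close>.\<close>
  define l where "l = min (min (\<delta> / 2) (w0 / 2)) ((\<epsilon> / C') powr (1 / (b - 1)))"
  define r where "r = max (max R w0) (C' / \<epsilon>) + 1"
  have l: "0 < l" "l < \<delta>" "l < w0" "l \<le> (\<epsilon> / C') powr (1 / (b - 1))"
    using near0(1) w0 \<epsilon> C' by (auto simp: l_def)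
  have r: "R < r" "w0 < r" "C' / \<epsilon> < r" by (auto simp: r_def)
  have vl: "v l \<le> 0"
  proof -
    have "l powr (b - 1) \<le> ((\<epsilon> / C') powr (1 / (b - 1))) powr (b - 1)"
      using l b by (intro powr_mono2) auto
    also have "\<dots> = \<epsilon> / C'" using b \<epsilon> C' by (simp add: powr_powr)
    finally have "C' * l powr (b - 1) \<le> \<epsilon>" using C' by (simp add: field_simps)
    have "l * u l \<le> C'" using near0(2)[of l] l C' by simp
    also have "C' \<le> \<epsilon> * l powr (1 - b)"
    proof -
      have "l powr (b - 1) * l powr (1 - b) = 1" using l by (simp flip: powr_add)
      then have "C' = (C' * l powr (b - 1)) * l powr (1 - b)" by simp
      also have "\<dots> \<le> \<epsilon> * l powr (1 - b)"
        by (rule mult_right_mono) (use \<open>C' * l powr (b - 1) \<le> \<epsilon>\<close> in auto)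
      finally show ?thesis .
    qed
    also have "\<dots> = l * (\<epsilon> * l powr (-b))"
      using l by (simp add: powr_diff powr_minus field_simps)
    also have "\<dots> \<le> l * (\<epsilon> * B l)"
      using l \<epsilon> a by (intro mult_left_mono) (auto simp: B_def)
    finally show ?thesis using l by (simp add: v_def)
  qed
  have vr: "v r \<le> 0"
  proof -
    have "u r \<le> C'" using inf[OF r(1)] C' by simp
    also have "C' \<le> \<epsilon> * r" using r(3) \<epsilon> by (simp add: field_simps)
    also have "\<dots> \<le> \<epsilon> * B r" using \<epsilon> a by (intro mult_left_mono) (auto simp: B_def)
    finally show ?thesis by (simp add: v_def)
  qed
  define v' where "v' w = u' w - \<epsilon> * (1 - b * w powr (-b - 1))" for w
  have dv: "(v has_real_derivative v' w) (at w)" if "0 < w" for w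
    unfolding v_def[abs_def] v'_def B_def
    using that by (auto intro!: derivative_eq_intros d1 simp: algebra_simps)
  have dv': "(v' has_real_derivative u'' w - \<epsilon> * (b * (b + 1) * w powr (-b - 2))) (at w)" if "0 < w" for w
  proof -
    have "((\<lambda>w. w powr (-b - 1)) has_real_derivative (-b - 1) * w powr (-b - 1 - 1)) (at w)"
      using that by (rule has_real_derivative_powr)
    then have "((\<lambda>w. w powr (-b - 1)) has_real_derivative (-b - 1) * w powr (-b - 2)) (at w)"
      by (simp add: algebra_simps)
    then show ?thesis
      unfolding v'_def[abs_def]
      using that by (auto intro!: derivative_eq_intros d2 simp: algebra_simps)
  qed
  have "\<exists>x\<in>{l..r}. \<forall>y\<in>{l..r}. v y \<le> v x"
  proof (rule continuous_attains_sup)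
    show "continuous_on {l..r} v"
      by (intro continuous_at_imp_continuous_on ballI DERIV_isCont[OF dv]) (use l in auto)
  qed (use l r in auto)
  then obtain x where x: "l \<le> x" "x \<le> r" and max: "\<And>y. l \<le> y \<Longrightarrow> y \<le> r \<Longrightarrow> v y \<le> v x" by auto
  have vx: "K < 2 * v x" using v0 max[of w0] l r by simp
  \<comment> \<open>The maximum is positive because \<open>K \<ge> 0\<close>, whereas
    \<open>v\<close> is nonpositive at both ends; so the maximum is interior.\<close>
  then have "x \<noteq> l" "x \<noteq> r" using vl vr K by auto
  then have x': "l < x" "x < r" "0 < x" using x l by auto
  have crit: "v' x = 0" "u'' x - \<epsilon> * (b * (b + 1) * x powr (-b - 2)) \<le> 0"
    using local_max_second_deriv_le_0[of l r v v', OF _ dv'[OF x'(3)] x'(1,2)] dv max l(1) by auto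
  define s where "s = x powr (-b - 1)"
  have s: "0 \<le> s" "x * x powr (-b - 2) = s" "x powr (-b) = x * s"
  proof -
    have "x * x powr (-b - 2) = x powr (1 + (-b - 2))"
      using x'(3) by (intro powr_mult_base) simp
    also have "1 + (-b - 2) = -b - 1" by simp
    finally show "x * x powr (-b - 2) = s" by (simp only: s_def)
    show "x powr (-b) = x * s"
      using x'(3) powr_mult_base[of x "-b - 1"] by (simp add: s_def)
  qed (simp add: s_def)
  have "x * (u'' x - \<epsilon> * (b * (b + 1) * x powr (-b - 2))) \<le> 0"
    using crit(2) x'(3) by (simp add: mult_le_0_iff)
  then have 1: "x * u'' x \<le> \<epsilon> * (b * (b + 1)) * s"
    using s(2) by (simp add: algebra_simps)
  have 2: "u' x = \<epsilon> * (1 - b * s)" using crit(1) by (simp add: v'_def s_def)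
  have 3: "2 * u x > K + 2 * \<epsilon> * (x + x * s + (a + 2) / 2)"
    using vx s(3) by (simp add: v_def B_def algebra_simps)
  have "- K \<le> x * u'' x + (a + 2 - x) * u' x - 2 * u x"
    using eq[OF x'(3)] g[OF x'(3)] by simp
  also have "\<dots> < \<epsilon> * (b * (b + 1)) * s + (a + 2 - x) * (\<epsilon> * (1 - b * s)) - (K + 2 * \<epsilon> * (x + x * s + (a + 2) / 2))"
    using 1 2 3 by simp
  also have "\<dots> = - K - \<epsilon> * (b * s * (a + 1 - b) + x * s * (2 - b) + 3 * x)"
    by (simp add: field_simps)
  also have "\<dots> \<le> - K"
    using \<epsilon> b s(1) x'(3) by (simp add: mult_nonneg_nonneg add_nonneg_nonneg)
  finally show False by simp
qed

text \<open>The final bound depends on \<open>L\<close> alone. \<open>K\<close> enters only in the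
  growth estimates at 0 and at infinity that make the maximum principle applicable.\<close>

locale gamma_stein =
  fixes a K L :: real and k k' k'' :: "real \<Rightarrow> real"
  assumes a: "0 < a"
    and int_p: "integrable lborel (gamma_density a)" and mass: "(\<integral>w. gamma_density a w \<partial>lborel) = 1"
    and k1: "\<And>w. (k has_real_derivative k' w) (at w)"
    and k2: "\<And>w. (k' has_real_derivative k'' w) (at w)"
    and K: "\<And>w. \<bar>k w\<bar> \<le> K" and L: "\<And>w. \<bar>k'' w\<bar> \<le> L"
    and zero: "(\<integral>w. gamma_density a w * k w \<partial>lborel) = 0"
begin

abbreviation p :: "real \<Rightarrow> real" where "p \<equiv> gamma_density a"

text \<open>Solution of \<open>w * G' w + (a - w) * G w = k w\<close>. The integrating factor is
  \<open>w * p w\<close>, whose derivative is \<open>(a - w) * p w\<close>.\<close>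

definition G :: "real \<Rightarrow> real" where
  "G w = - upper_int (\<lambda>t. p t * k t) w / (w * p w)"

text \<open>The derivative of \<open>G\<close>, solved for from the Stein equation, so that it can
  be differentiated again.\<close>

definition u :: "real \<Rightarrow> real" where
  "u w = (k w - (a - w) * G w) / w"

lemma p_pos: "0 < w \<Longrightarrow> 0 < p w"
  using a by (simp add: gamma_density_def Gamma_real_pos)

lemma p_nonneg: "0 \<le> p w"
  using p_pos[of w] by (cases "0 < w") (auto simp: gamma_density_def)

lemma continuous_p: "continuous_on {0<..} p"
proof -
  have "continuous_on {0<..} (\<lambda>w. w powr (a - 1) * exp (- w) / Gamma a)"
    using a by (auto intro!: continuous_intros simp: Gamma_real_pos less_imp_neq[symmetric])
  then show ?thesis
    by (rule continuous_on_eq) (simp add: gamma_density_def)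
qed

lemma continuous_k: "continuous_on A k"
  using k1 by (meson DERIV_continuous continuous_at_imp_continuous_on)

lemma int_pk: "integrable lborel (\<lambda>w. p w * k w)"
proof (rule Bochner_Integration.integrable_bound[of _ "\<lambda>w. K * p w"])
  have "k \<in> borel_measurable borel"
    by (rule borel_measurable_continuous_onI[OF continuous_k])
  then show "(\<lambda>w. p w * k w) \<in> borel_measurable lborel"
    using borel_measurable_integrable[OF int_p] by measurable
  show "AE w in lborel. norm (p w * k w) \<le> norm (K * p w)"
  proof (rule AE_I2)
    fix w
    have "0 \<le> K" using K[of w] by linarith
    then show "norm (p w * k w) \<le> norm (K * p w)"
      using mult_left_mono[OF K[of w] p_nonneg[of w]] p_nonneg[of w] by (simp add: abs_mult mult.commute)
  qed
qed (use int_p in simp)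

lemma K_nonneg: "0 \<le> K" using K[of 0] by linarith

lemma wp_deriv:
  assumes "0 < w"
  shows "((\<lambda>w. w * p w) has_real_derivative (a - w) * p w) (at w)"
proof -
  have Ga: "0 < Gamma a" using a by (rule Gamma_real_pos)
  have "((\<lambda>w. w powr a * exp (- w) / Gamma a) has_real_derivative
      (a * w powr (a - 1) * exp (- w) - w powr a * exp (- w)) / Gamma a) (at w)"
  proof (rule DERIV_cdivide)
    show "((\<lambda>w. w powr a * exp (- w)) has_real_derivative
        a * w powr (a - 1) * exp (- w) - w powr a * exp (- w)) (at w)"
      using assms by (auto intro!: derivative_eq_intros simp: algebra_simps)
  qed
  moreover have "(a * w powr (a - 1) * exp (- w) - w powr a * exp (- w)) / Gamma a = (a - w) * p w"
    using assms powr_mult_base[of w "a - 1"] Ga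
    by (simp add: gamma_density_def field_simps)
  ultimately have "((\<lambda>w. w powr a * exp (- w) / Gamma a) has_real_derivative (a - w) * p w) (at w)"
    by (simp only:)
  then show ?thesis
  proof (rule has_field_derivative_transform_within_open[of _ _ _ "{0<..}"])
    fix y :: real assume "y \<in> {0<..}"
    then show "y powr a * exp (- y) / Gamma a = y * p y"
      using powr_mult_base[of y "a - 1"] by (simp add: gamma_density_def)
  qed (use assms in auto)
qed

lemma upper_p_deriv:
  assumes "0 < w"
  shows "(upper_int p has_real_derivative - p w) (at w)"
  by (rule upper_int_has_real_derivative[OF int_p continuous_p assms])

lemma G_deriv:
  assumes w: "0 < w"
  shows "(G has_real_derivative u w) (at w)"
proof -
  have "(upper_int (\<lambda>t. p t * k t) has_real_derivative - (p w * k w)) (at w)"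
    by (rule upper_int_has_real_derivative[OF int_pk continuous_on_mult[OF continuous_p continuous_k] w])
  from DERIV_divide[OF DERIV_minus[OF this] wp_deriv[OF w]]
  have "((\<lambda>w. - upper_int (\<lambda>t. p t * k t) w / (w * p w)) has_real_derivative
      ((- (- (p w * k w))) * (w * p w) - (- upper_int (\<lambda>t. p t * k t) w) * ((a - w) * p w)) / ((w * p w) * (w * p w))) (at w)"
    using w p_pos[OF w] by simp
  moreover have "((- (- (p w * k w))) * (w * p w) - (- upper_int (\<lambda>t. p t * k t) w) * ((a - w) * p w)) / ((w * p w) * (w * p w)) = u w"
    using w p_pos[OF w] by (simp add: u_def G_def divide_simps) (simp add: algebra_simps)
  ultimately show ?thesis unfolding G_def[abs_def] by (simp only:)
qed

lemma G_eq: "0 < w \<Longrightarrow> w * u w + (a - w) * G w = k w"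
  by (simp add: u_def)

text \<open>The Stein equation \<open>G_eq\<close>, differentiated once and twice, is solved for its top derivative.\<close>

definition u' :: "real \<Rightarrow> real" where
  "u' w = (k' w + G w - (a + 1 - w) * u w) / w"

definition u'' :: "real \<Rightarrow> real" where
  "u'' w = (k'' w + 2 * u w - (a + 2 - w) * u' w) / w"

lemma u_deriv:
  assumes w: "0 < w"
  shows "(u has_real_derivative u' w) (at w)"
proof -
  have "((\<lambda>w. (k w - (a - w) * G w) / w) has_real_derivative
      ((k' w - ((0 - 1) * G w + u w * (a - w))) * w - (k w - (a - w) * G w) * 1) / (w * w)) (at w)"
    using w by (intro DERIV_divide DERIV_diff DERIV_mult k1 G_deriv DERIV_const DERIV_ident) auto
  moreover have "k w - (a - w) * G w = w * u w" using w by (simp add: u_def)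
  then have "((k' w - ((0 - 1) * G w + u w * (a - w))) * w - (k w - (a - w) * G w) * 1) / (w * w) = u' w"
    using w by (simp only:) (simp add: u'_def divide_simps, simp add: algebra_simps)
  ultimately show ?thesis unfolding u_def[abs_def] by (simp only:)
qed

lemma u'_deriv:
  assumes w: "0 < w"
  shows "(u' has_real_derivative u'' w) (at w)"
proof -
  have "((\<lambda>w. (k' w + G w - (a + 1 - w) * u w) / w) has_real_derivative
      ((k'' w + u w - ((0 - 1) * u w + u' w * (a + 1 - w))) * w - (k' w + G w - (a + 1 - w) * u w) * 1) / (w * w)) (at w)"
    using w by (intro DERIV_divide DERIV_diff DERIV_add DERIV_mult k2 G_deriv u_deriv DERIV_const DERIV_ident) auto
  moreover have "k' w + G w - (a + 1 - w) * u w = w * u' w" using w by (simp add: u'_def)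
  then have "((k'' w + u w - ((0 - 1) * u w + u' w * (a + 1 - w))) * w - (k' w + G w - (a + 1 - w) * u w) * 1) / (w * w) = u'' w"
    using w by (simp only:) (simp add: u''_def divide_simps, simp add: algebra_simps)
  ultimately show ?thesis unfolding u'_def[abs_def] by (simp only:)
qed

text \<open>At an interior maximum of \<open>u\<close> the first two terms are nonpositive, which
  gives \<open>2 * u w \<le> - k'' w\<close>. This is why test functions with bounded second
  derivative are the natural class here.\<close>

lemma u_eq: "0 < w \<Longrightarrow> w * u'' w + (a + 2 - w) * u' w - 2 * u w = k'' w"
  by (simp add: u''_def)

lemma upper_pk_le: "\<bar>upper_int (\<lambda>t. p t * k t) w\<bar> \<le> K * upper_int p w"
proof -
  have "\<bar>upper_int (\<lambda>t. p t * k t) w\<bar> \<le> upper_int (\<lambda>t. K * p t + 0 * p t) w"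
  proof (rule abs_upper_int_le[OF int_pk])
    show "integrable lborel (\<lambda>t. K * p t + 0 * p t)" using int_p by simp
    show "\<bar>p t * k t\<bar> \<le> K * p t + 0 * p t" for t
      using mult_left_mono[OF K[of t] p_nonneg[of t]] p_nonneg[of t] by (simp add: abs_mult mult.commute)
  qed
  also have "\<dots> = K * upper_int p w"
    by (subst upper_int_lin[OF int_p int_p]) simp
  finally show ?thesis .
qed

text \<open>The difference \<open>2 * (y * p y) - upper_int p y\<close> has derivative
  \<open>(2 * a + 1 - 2 * y) * p y\<close>, hence is nonincreasing from \<open>a + 1 / 2\<close>
  on.\<close>

lemma upper_p_le:
  assumes w: "a + 1 / 2 \<le> w"
  shows "upper_int p w \<le> 2 * (w * p w)"
proof -
  have w0: "0 < w" using w a by linarith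
  have mono: "2 * (y * p y) - upper_int p y \<le> 2 * (w * p w) - upper_int p w" if "w \<le> y" for y
  proof (rule DERIV_nonpos_imp_nonincreasing[OF that])
    fix z assume z: "w \<le> z" "z \<le> y"
    then have z0: "0 < z" using w0 by simp
    have "((\<lambda>y. 2 * (y * p y) - upper_int p y) has_real_derivative 2 * ((a - z) * p z) - (- p z)) (at z)"
      by (intro DERIV_diff DERIV_cmult wp_deriv upper_p_deriv z0)
    moreover have "2 * ((a - z) * p z) - (- p z) = (2 * a + 1 - 2 * z) * p z" by (simp add: algebra_simps)
    moreover have "(2 * a + 1 - 2 * z) * p z \<le> 0"
      using w z p_pos[OF z0] by (intro mult_nonpos_nonneg) auto
    ultimately show "\<exists>l. ((\<lambda>y. 2 * (y * p y) - upper_int p y) has_real_derivative l) (at z) \<and> l \<le> 0"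
      by auto
  qed
  \<comment> \<open>The difference is compared with its values at large \<open>y\<close>; there the
    nonnegative \<open>y * p y\<close> may be dropped and the tail vanishes.\<close>
  have "0 - 0 \<le> 2 * (w * p w) - upper_int p w"
  proof (rule tendsto_upperbound)
    show "((\<lambda>y. 0 - upper_int p y) \<longlongrightarrow> 0 - 0) at_top"
      by (intro tendsto_diff tendsto_const upper_int_tendsto_0 int_p)
    show "\<forall>\<^sub>F y in at_top. 0 - upper_int p y \<le> 2 * (w * p w) - upper_int p w"
      using eventually_ge_at_top[of w]
    proof eventually_elim
      case (elim y)
      have "0 \<le> y * p y" using elim w0 p_nonneg[of y] by simp
      then show ?case using mono[OF elim] by linarith
    qed
  qed simp
  then show ?thesis by simp
qed

text \<open>The mass near 0 vanishes by dominated convergence, although the density itself may be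
  unbounded there.\<close>

lemma upper_p_tendsto: "(\<lambda>n. upper_int p (c / real (Suc n))) \<longlonglongrightarrow> 1" if c: "0 < c"
proof -
  have "(\<lambda>n. \<integral>t. indicator {c / real (Suc n)..} t * p t \<partial>lborel) \<longlonglongrightarrow> (\<integral>t. p t \<partial>lborel)"
  proof (rule integral_dominated_convergence[where w = p])
    show "AE t in lborel. (\<lambda>n. indicator {c / real (Suc n)..} t * p t) \<longlonglongrightarrow> p t"
    proof (rule AE_I2)
      fix t :: real
      show "(\<lambda>n. indicator {c / real (Suc n)..} t * p t) \<longlonglongrightarrow> p t"
      proof (cases "0 < t")
        case True
        have "(\<lambda>n. c / real (Suc n)) \<longlonglongrightarrow> 0"
          using LIMSEQ_Suc[OF lim_const_over_n[of c]] by simp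
        then have "\<forall>\<^sub>F n in sequentially. c / real (Suc n) < t"
          using True by (rule order_tendstoD)
        then have "\<forall>\<^sub>F n in sequentially. indicator {c / real (Suc n)..} t * p t = p t"
          by eventually_elim (simp add: indicator_def)
        then show ?thesis by (rule tendsto_eventually)
      qed (simp add: gamma_density_def)
    qed
    show "AE t in lborel. norm (indicator {c / real (Suc n)..} t * p t) \<le> p t" for n
      using p_nonneg by (intro AE_I2) (simp add: indicator_def)
  qed (use int_p borel_measurable_integrable[OF int_p] in auto)
  then show ?thesis by (simp add: upper_int_def mass)
qed

text \<open>Mirror image of \<open>upper_p_le\<close>: below \<open>a / 2\<close> the function
  \<open>2 / a * (y * p y) + upper_int p y\<close> is nondecreasing, and along
  \<open>w / (n + 1)\<close> its second term tends to 1.\<close>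

lemma lower_p_le:
  assumes w: "0 < w" "w \<le> a / 2"
  shows "1 - upper_int p w \<le> 2 / a * (w * p w)"
proof -
  have mono: "2 / a * (y * p y) + upper_int p y \<le> 2 / a * (w * p w) + upper_int p w" if y: "0 < y" "y \<le> w" for y
  proof (rule DERIV_nonneg_imp_nondecreasing[OF y(2)])
    fix z assume z: "y \<le> z" "z \<le> w"
    then have z0: "0 < z" using y by simp
    have "((\<lambda>y. 2 / a * (y * p y) + upper_int p y) has_real_derivative 2 / a * ((a - z) * p z) + - p z) (at z)"
      by (intro DERIV_add DERIV_cmult wp_deriv upper_p_deriv z0)
    moreover have "2 / a * ((a - z) * p z) + - p z = (a - 2 * z) / a * p z"
      using a by (simp add: field_simps)
    moreover have "0 \<le> (a - 2 * z) / a * p z"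
      using w z p_pos[OF z0] a by (intro mult_nonneg_nonneg divide_nonneg_nonneg) auto
    ultimately show "\<exists>l. ((\<lambda>y. 2 / a * (y * p y) + upper_int p y) has_real_derivative l) (at z) \<and> 0 \<le> l"
      by auto
  qed
  have "1 \<le> 2 / a * (w * p w) + upper_int p w"
  proof (rule LIMSEQ_le_const2[OF upper_p_tendsto[OF w(1)]])
    have "upper_int p (w / real (Suc n)) \<le> 2 / a * (w * p w) + upper_int p w" for n
    proof -
      have y: "0 < w / real (Suc n)" "w / real (Suc n) \<le> w" using w by (auto simp: field_simps)
      have "0 \<le> 2 / a * (w / real (Suc n) * p (w / real (Suc n)))"
        using y(1) p_nonneg[of "w / real (Suc n)"] a by (intro mult_nonneg_nonneg) auto
      then show ?thesis using mono[OF y] by linarith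
    qed
    then show "\<exists>N. \<forall>n\<ge>N. upper_int p (w / real (Suc n)) \<le> 2 / a * (w * p w) + upper_int p w" by blast
  qed
  then show ?thesis by simp
qed

lemma G_bound_inf: "a + 1 / 2 \<le> w \<Longrightarrow> \<bar>G w\<bar> \<le> 2 * K"
proof -
  assume w: "a + 1 / 2 \<le> w"
  then have w0: "0 < w" using a by linarith
  have "\<bar>upper_int (\<lambda>t. p t * k t) w\<bar> \<le> K * (2 * (w * p w))"
    using upper_pk_le mult_left_mono[OF upper_p_le[OF w] K_nonneg] by (rule order_trans)
  then show ?thesis
    using w0 p_pos[OF w0] by (simp add: G_def abs_mult pos_divide_le_eq algebra_simps)
qed

text \<open>Near 0 the upper tail gives no control after division by \<open>w * p w\<close>;
  centring of \<open>k\<close> replaces it by the lower tail, which is small enough.\<close>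

lemma G_bound_0: "0 < w \<Longrightarrow> w \<le> a / 2 \<Longrightarrow> \<bar>G w\<bar> \<le> 2 * K / a"
proof -
  assume w: "0 < w" "w \<le> a / 2"
  have split: "upper_int f w + (\<integral>t. indicator {..<w} t * f t \<partial>lborel) = (\<integral>t. f t \<partial>lborel)"
    if f: "integrable lborel f" for f :: "real \<Rightarrow> real"
  proof -
    have "(\<integral>t. f t \<partial>lborel) = (\<integral>t. indicator {w..} t * f t + indicator {..<w} t * f t \<partial>lborel)"
      by (intro Bochner_Integration.integral_cong refl) (auto simp: indicator_def)
    then show ?thesis using integrable_indicator_mult[OF f] by (simp add: upper_int_def)
  qed
  have "\<bar>upper_int (\<lambda>t. p t * k t) w\<bar> = \<bar>\<integral>t. indicator {..<w} t * (p t * k t) \<partial>lborel\<bar>"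
    using split[OF int_pk] zero by linarith
  also have "\<dots> \<le> (\<integral>t. \<bar>indicator {..<w} t * (p t * k t)\<bar> \<partial>lborel)"
    by (rule integral_abs_bound)
  also have "\<dots> \<le> (\<integral>t. K * (indicator {..<w} t * p t) \<partial>lborel)"
  proof (rule integral_mono)
    show "integrable lborel (\<lambda>t. \<bar>indicator {..<w} t * (p t * k t)\<bar>)"
      by (intro integrable_abs integrable_indicator_mult int_pk) simp
    show "integrable lborel (\<lambda>t. K * (indicator {..<w} t * p t))"
      by (intro integrable_mult_right integrable_indicator_mult int_p) simp
    show "\<bar>indicator {..<w} t * (p t * k t)\<bar> \<le> K * (indicator {..<w} t * p t)" for t
      using mult_left_mono[OF K[of t] p_nonneg[of t]] p_nonneg[of t]
      by (simp add: abs_mult mult.commute indicator_def)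
  qed
  also have "\<dots> = K * (1 - upper_int p w)"
    using split[OF int_p] mass by simp
  also have "\<dots> \<le> K * (2 / a * (w * p w))"
    by (rule mult_left_mono[OF lower_p_le[OF w] K_nonneg])
  finally have *: "\<bar>upper_int (\<lambda>t. p t * k t) w\<bar> \<le> (2 * K / a) * (w * p w)" by (simp add: algebra_simps)
  have "0 < w * p w" using w p_pos[OF w(1)] by simp
  then show ?thesis
    using * by (simp add: G_def abs_divide pos_divide_le_eq del: mult_pos_pos)
qed

text \<open>Only \<open>w * u w\<close> is controlled near 0. The barrier of the maximum principle
  is singular there for this reason.\<close>

lemma u_bound_0: "0 < w \<Longrightarrow> w \<le> a / 2 \<Longrightarrow> \<bar>w * u w\<bar> \<le> 3 * K"
proof -
  assume w: "0 < w" "w \<le> a / 2"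
  have "\<bar>(a - w) * G w\<bar> \<le> a * (2 * K / a)"
    unfolding abs_mult using w a G_bound_0[OF w] by (intro mult_mono) auto
  also have "\<dots> = 2 * K" using a by simp
  finally have "\<bar>k w - (a - w) * G w\<bar> \<le> K + 2 * K" using K[of w] by linarith
  then show ?thesis using w by (simp add: u_def)
qed

text \<open>Dividing by \<open>w\<close> compensates the growth of the coefficient
  \<open>a - w\<close>, so a bound on \<open>G\<close> passes to \<open>u\<close>.\<close>

lemma u_bound_inf: "a + 1 \<le> w \<Longrightarrow> \<bar>u w\<bar> \<le> 3 * K"
proof -
  assume w: "a + 1 \<le> w"
  then have w1: "1 \<le> w" using a by linarith
  have "\<bar>(a - w) * G w\<bar> \<le> w * (2 * K)"
    unfolding abs_mult using w a G_bound_inf[of w] by (intro mult_mono) auto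
  moreover have "K \<le> w * K" using w1 K_nonneg mult_right_mono[of 1 w K] by simp
  ultimately have "\<bar>k w - (a - w) * G w\<bar> \<le> (3 * K) * w" using K[of w] by (simp add: algebra_simps)
  then show ?thesis using w1 by (simp add: u_def pos_divide_le_eq)
qed

lemma u_upper: "0 < w \<Longrightarrow> 2 * u w \<le> L"
proof (rule laguerre_max_principle[OF a u_deriv u'_deriv u_eq])
  show "- L \<le> k'' w" for w using L[of w] by linarith
  show "0 \<le> L" using L[of 0] by linarith
  show "0 < a / 2" using a by simp
  show "w * u w \<le> 3 * K" if "0 < w" "w < a / 2" for w using u_bound_0[of w] that by simp
  show "u w \<le> 3 * K" if "a + 1 < w" for w using u_bound_inf[of w] that by simp
qed

lemma u_lower: "0 < w \<Longrightarrow> 2 * (- u w) \<le> L"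
proof (rule laguerre_max_principle[OF a, where u = "\<lambda>w. - u w" and u' = "\<lambda>w. - u' w" and u'' = "\<lambda>w. - u'' w" and g = "\<lambda>w. - k'' w"])
  show "((\<lambda>w. - u w) has_real_derivative - u' w) (at w)" if "0 < w" for w
    by (rule DERIV_minus[OF u_deriv[OF that]])
  show "((\<lambda>w. - u' w) has_real_derivative - u'' w) (at w)" if "0 < w" for w
    by (rule DERIV_minus[OF u'_deriv[OF that]])
  show "w * - u'' w + (a + 2 - w) * - u' w - 2 * - u w = - k'' w" if "0 < w" for w
    using u_eq[OF that] by (simp add: algebra_simps)
  show "- L \<le> - k'' w" for w using L[of w] by linarith
  show "0 \<le> L" using L[of 0] by linarith
  show "0 < a / 2" using a by simp
  show "w * - u w \<le> 3 * K" if "0 < w" "w < a / 2" for w using u_bound_0[of w] that by simp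
  show "- u w \<le> 3 * K" if "a + 1 < w" for w using u_bound_inf[of w] that by simp
qed

lemma abs_u_le: "0 < w \<Longrightarrow> \<bar>u w\<bar> \<le> L / 2"
  using u_upper[of w] u_lower[of w] by (simp add: abs_le_iff)

end

section \<open>Bounds on the distances\<close>

lemma continuous_infdist_bump: "continuous_on UNIV (\<lambda>x::real. max 0 (1 - real n * infdist x C))"
  by (intro continuous_intros)

lemma compact_indicator_approx:
  fixes C :: "real set"
  assumes "compact C" "C \<noteq> {}"
  shows "(\<lambda>n. max 0 (1 - real n * infdist x C)) \<longlonglongrightarrow> indicator C x"
proof (cases "x \<in> C")
  case False
  have "0 < infdist x C"
    using False assms infdist_pos_not_in_closed[of C x] compact_imp_closed by auto
  obtain N where N: "1 / infdist x C < real N" using reals_Archimedean2 by blast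
  have "\<forall>\<^sub>F n in sequentially. max 0 (1 - real n * infdist x C) = 0"
    using eventually_ge_at_top[of N]
  proof eventually_elim
    case (elim n)
    then have "1 / infdist x C < real n" using N by linarith
    then show ?case using \<open>0 < infdist x C\<close> by (simp add: field_simps)
  qed
  then show ?thesis using False by (simp add: tendsto_eventually)
qed simp

text \<open>The Stein argument yields a C1 solution only for continuous test functions. Bump
  functions of the distance converge to the indicator of a compact set, and inner regularity of
  \<open>P\<close> extends the estimate to Borel sets.\<close>

lemma tv_upper_bound:
  fixes P Q :: "real measure"
  assumes P: "prob_space P" "sets P = sets borel" and Q: "prob_space Q" "sets Q = sets borel"
    and h: "\<And>h. continuous_on UNIV h \<Longrightarrow> (\<And>x. 0 \<le> h x) \<Longrightarrow> (\<And>x. h x \<le> 1) \<Longrightarrow>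
      (\<integral>x. h x \<partial>P) - (\<integral>x. h x \<partial>Q) \<le> c"
    and A: "A \<in> sets borel"
  shows "measure P A - measure Q A \<le> c"
proof -
  interpret P: prob_space P by fact
  interpret Q: prob_space Q by fact
  have c0: "0 \<le> c" using h[of "\<lambda>_. 0"] by simp
  have compact_le: "measure P C - measure Q C \<le> c" if C: "compact C" for C
  proof (cases "C = {}")
    case False
    let ?h = "\<lambda>n x. max 0 (1 - real n * infdist x C)"
    have meas: "?h n \<in> borel_measurable borel" for n
      by (rule borel_measurable_continuous_onI[OF continuous_infdist_bump])
    have C_borel: "C \<in> sets borel" using C by (simp add: borel_compact)
    have lim: "(\<lambda>n. \<integral>x. ?h n x \<partial>R) \<longlonglongrightarrow> measure R C" if R: "prob_space R" "sets R = sets borel" for R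
    proof -
      interpret R: prob_space R by fact
      have "(\<lambda>n. \<integral>x. ?h n x \<partial>R) \<longlonglongrightarrow> (\<integral>x. indicator C x \<partial>R)"
      proof (rule integral_dominated_convergence[where w = "\<lambda>_. 1"])
        show "AE x in R. (\<lambda>n. ?h n x) \<longlonglongrightarrow> indicator C x"
          using compact_indicator_approx[OF C False] by simp
        show "AE x in R. norm (?h n x) \<le> 1" for n
          by (intro AE_I2) (auto simp: infdist_nonneg)
        show "?h n \<in> borel_measurable R" for n
          using meas R(2) by (simp cong: measurable_cong_sets)
        show "indicator C \<in> borel_measurable R"
          using C_borel R(2) by (simp cong: measurable_cong_sets)
      qed simp
      then show ?thesis using C_borel R(2) by simp
    qed
    show ?thesis
    proof (rule LIMSEQ_le_const2[OF tendsto_diff[OF lim[OF P] lim[OF Q]]])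
      show "\<exists>N. \<forall>n\<ge>N. (\<integral>x. ?h n x \<partial>P) - (\<integral>x. ?h n x \<partial>Q) \<le> c"
        by (intro exI allI impI h continuous_infdist_bump) (auto simp: infdist_nonneg)
    qed
  qed (use c0 in simp)
  show ?thesis
  proof (rule field_le_epsilon)
    \<comment> \<open>Regularity is used for \<open>P\<close> alone: shrinking \<open>A\<close> to a
      compact \<open>K\<close> loses at most \<open>e\<close> under \<open>P\<close>, and under
      \<open>Q\<close> the change has the favourable sign.\<close>
    fix e :: real assume e: "0 < e"
    have "emeasure P A = (SUP K\<in>{K. K \<subseteq> A \<and> compact K}. emeasure P K)"
      using P(2) A by (intro inner_regular) auto
    have "\<exists>K. K \<subseteq> A \<and> compact K \<and> measure P A - e < measure P K"
    proof (cases "measure P A - e < 0")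
      case True
      then show ?thesis by (intro exI[of _ "{}"]) simp
    next
      case False
      have "ennreal (measure P A - e) < emeasure P A"
        using e False by (simp add: P.emeasure_eq_measure ennreal_less_iff)
      also note \<open>emeasure P A = _\<close>
      finally obtain K where "K \<subseteq> A" "compact K" "ennreal (measure P A - e) < emeasure P K"
        by (auto simp: less_SUP_iff)
      then show ?thesis
        using False by (intro exI[of _ K]) (simp add: P.emeasure_eq_measure ennreal_less_iff)
    qed
    then obtain K where K: "K \<subseteq> A" "compact K" "measure P A - e < measure P K" by blast
    have "measure Q K \<le> measure Q A"
      using K A Q(2) by (intro Q.finite_measure_mono) auto
    then show "measure P A - measure Q A \<le> c + e"
      using compact_le[OF K(2)] K(3) by linarith
  qed
qed

lemma L2norm_triangle:
  assumes f: "f \<in> borel_measurable M" and g: "g \<in> borel_measurable M"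
  shows "L2norm M (\<lambda>x. f x + g x) \<le> L2norm M f + L2norm M g"
proof (cases "sqint M f \<and> sqint M g")
  case True
  then have fg: "sqint M f" "sqint M g" by auto
  let ?a = "sqrt (\<integral>x. (f x)\<^sup>2 \<partial>M)" and ?b = "sqrt (\<integral>x. (g x)\<^sup>2 \<partial>M)"
  have "(\<integral>x. (f x + g x)\<^sup>2 \<partial>M) = (\<integral>x. (f x)\<^sup>2 + 2 * (f x * g x) + (g x)\<^sup>2 \<partial>M)"
    by (simp add: power2_sum algebra_simps)
  also have "\<dots> = ?a\<^sup>2 + 2 * (\<integral>x. f x * g x \<partial>M) + ?b\<^sup>2"
    using fg sqint_mult_integrable[OF fg] by (simp add: sqint_def)
  also have "\<dots> \<le> ?a\<^sup>2 + 2 * (?a * ?b) + ?b\<^sup>2"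
    using Cauchy_Schwarz_sqint[OF fg] by linarith
  also have "\<dots> = (?a + ?b)\<^sup>2" by (simp add: power2_sum)
  finally have "sqrt (\<integral>x. (f x + g x)\<^sup>2 \<partial>M) \<le> sqrt ((?a + ?b)\<^sup>2)"
    by (rule real_sqrt_le_mono)
  also have "\<dots> = ?a + ?b" by (subst real_sqrt_abs) simp
  finally have "sqrt (\<integral>x. (f x + g x)\<^sup>2 \<partial>M) \<le> ?a + ?b" .
  then show ?thesis
    using fg by (simp add: L2norm_eq sqint_add ennreal_plus[symmetric] ennreal_leI del: ennreal_plus)
next
  case False
  then have "L2norm M f + L2norm M g = \<infinity>"
    using L2norm_infinite[OF f] L2norm_infinite[OF g] by auto
  then show ?thesis by (simp only: infinity_ennreal_def top_greatest)
qed

lemma L2norm_mono: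
  assumes "g \<in> borel_measurable M" "f \<in> borel_measurable M" "\<And>x. \<bar>f x\<bar> \<le> \<bar>g x\<bar>"
  shows "L2norm M f \<le> L2norm M g"
proof (cases "sqint M g")
  case True
  then have "sqint M f" by (rule sqint_bound) (use assms in auto)
  moreover have "(\<integral>x. (f x)\<^sup>2 \<partial>M) \<le> (\<integral>x. (g x)\<^sup>2 \<partial>M)"
    using True \<open>sqint M f\<close> assms(3)
    by (intro integral_mono) (auto simp: sqint_def abs_le_square_iff)
  ultimately show ?thesis using True by (simp add: L2norm_eq ennreal_leI)
next
  case False
  then show ?thesis using L2norm_infinite[OF assms(1)] by simp
qed

lemma L2norm_minus: "L2norm M (\<lambda>x. - f x) = L2norm M f"
  by (simp add: L2norm_def)

lemma (in prob_space) L2norm_const: "L2norm M (\<lambda>_. c) = ennreal \<bar>c\<bar>"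
proof -
  have "sqint M (\<lambda>_. c)" by (simp add: sqint_def)
  then show ?thesis by (simp add: L2norm_eq prob_space)
qed

lemma (in prob_space) expectation_abs_le_L2norm:
  assumes "f \<in> borel_measurable M"
  shows "ennreal (\<integral>x. \<bar>f x\<bar> \<partial>M) \<le> L2norm M f"
proof (cases "sqint M f")
  case True
  have one: "sqint M (\<lambda>_. 1)" by (simp add: sqint_def)
  have "\<bar>\<integral>x. \<bar>f x\<bar> * 1 \<partial>M\<bar> \<le> sqrt (\<integral>x. (f x)\<^sup>2 \<partial>M)"
    using Cauchy_Schwarz_sqint[OF sqint_abs[OF True] one] by (simp add: prob_space)
  then show ?thesis using True by (simp add: L2norm_eq ennreal_leI)
next
  case False
  then show ?thesis using L2norm_infinite[OF assms] by simp
qed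

text \<open>Continuing by the tangent keeps the derivative continuous whenever \<open>f'\<close> is,
  and adds no new values of it. A function on a half line thus becomes a test function on the whole
  line.\<close>

lemma DERIV_linear_continuation:
  fixes f f' :: "real \<Rightarrow> real"
  assumes d: "\<And>x. c \<le> x \<Longrightarrow> (f has_real_derivative f' x) (at x)"
  shows "((\<lambda>x. if c \<le> x then f x else f c + f' c * (x - c)) has_real_derivative f' (max x c)) (at x)"
    (is "(?g has_real_derivative _) _")
proof (cases x c rule: linorder_cases)
  case greater
  have "(f has_real_derivative f' x) (at x)" using d greater by simp
  then have "(?g has_real_derivative f' x) (at x)"
    by (rule has_field_derivative_transform_within_open[of _ _ _ "{c<..}"]) (use greater in auto)
  then show ?thesis using greater by (simp add: max_def)
next
  case less
  have "((\<lambda>x. f c + f' c * (x - c)) has_real_derivative f' c) (at x)"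
    by (auto intro!: derivative_eq_intros)
  then have "(?g has_real_derivative f' c) (at x)"
    by (rule has_field_derivative_transform_within_open[of _ _ _ "{..<c}"]) (use less in auto)
  then show ?thesis using less by (simp add: max_def)
next
  case equal
  have "((\<lambda>y. (f y - f c) / (y - c)) \<longlongrightarrow> f' c) (at c)"
    using d[of c] by (simp add: has_field_derivative_iff)
  then have "((\<lambda>y. (f y - f c) / (y - c)) \<longlongrightarrow> f' c) (at_right c)"
    by (simp add: filterlim_at_split)
  then have right: "((\<lambda>y. (?g y - ?g c) / (y - c)) \<longlongrightarrow> f' c) (at_right c)"
    by (rule Lim_transform_eventually)
      (auto simp: eventually_at_right_field intro!: exI[of _ "c + 1"])
  have left: "((\<lambda>y. (?g y - ?g c) / (y - c)) \<longlongrightarrow> f' c) (at_left c)"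
    by (rule Lim_transform_eventually[OF tendsto_const])
      (auto simp: eventually_at_left_field intro!: exI[of _ "c - 1"])
  show ?thesis
    using left right equal by (simp add: has_field_derivative_iff filterlim_at_split)
qed

lemma stein_class_centered:
  assumes "continuous_on UNIV h" "integrable lborel (\<lambda>t. phi t * h t)"
  shows "stein_class (\<lambda>t. h t - (\<integral>t. phi t * h t \<partial>lborel))"
proof -
  let ?m = "\<integral>t. phi t * h t \<partial>lborel"
  have eq: "(\<lambda>t. phi t * (h t - ?m)) = (\<lambda>t. phi t * h t - ?m * phi t)"
    by (simp add: fun_eq_iff algebra_simps)
  have "continuous_on UNIV (\<lambda>t. h t - ?m)"
    by (intro continuous_on_diff assms continuous_on_const)
  moreover have "integrable lborel (\<lambda>t. phi t * h t - ?m * phi t)"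
    by (intro Bochner_Integration.integrable_diff integrable_mult_right assms integrable_phi)
  moreover have "(\<integral>t. phi t * h t - ?m * phi t \<partial>lborel) = 0"
    by (subst Bochner_Integration.integral_diff[OF assms(2) integrable_mult_right[OF integrable_phi(1)]])
      (simp add: integral_phi(1))
  ultimately show ?thesis
    unfolding stein_class_def by (simp only: eq simp_thms)
qed

context malliavin_setup
begin

abbreviation T :: "'a \<Rightarrow> real" where "T \<equiv> T_functional DX Z"

lemma measurable_X [measurable]: "X \<in> borel_measurable M"
  using integrable_X by auto

lemma measurable_T [measurable]: "T \<in> borel_measurable M"
  using integrable_T by auto

text \<open>Inserting \<open>X\<close> into the Stein equation and replacing \<open>X f(X)\<close>
  by \<open>f'(X) T / 2\<close> leaves the mean of \<open>f'(X) (2 - T) / 2\<close>.\<close>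

lemma stein_normal:
  assumes X0: "(\<integral>\<omega>. X \<omega> \<partial>M) = 0" and k: "stein_class k"
    and C: "\<And>x. \<bar>k x + x * stein_sol k x\<bar> \<le> C"
  shows "\<bar>\<integral>\<omega>. k (X \<omega>) \<partial>M\<bar> \<le> C / 2 * (\<integral>\<omega>. \<bar>2 - T \<omega>\<bar> \<partial>M)"
proof -
  let ?f = "stein_sol k" and ?f' = "\<lambda>x. k x + x * stein_sol k x"
  have contk: "continuous_on UNIV k" using k by (simp add: stein_class_def)
  have contf: "continuous_on UNIV ?f"
    using stein_sol_deriv[OF k] by (meson DERIV_continuous continuous_at_imp_continuous_on)
  have contf': "continuous_on UNIV ?f'"
    by (intro continuous_on_add continuous_on_mult continuous_on_id contk contf)
  have [measurable]: "?f' \<in> borel_measurable borel"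
    by (rule borel_measurable_continuous_onI[OF contf'])
  note ibp = integration_by_parts[OF X0 stein_sol_deriv[OF k] contf' C]
  have int_f': "integrable M (\<lambda>\<omega>. ?f' (X \<omega>))"
    using C by (intro integrable_const_bound[where B = C]) auto
  have "(\<integral>\<omega>. k (X \<omega>) \<partial>M) = (\<integral>\<omega>. ?f' (X \<omega>) - ?f (X \<omega>) * X \<omega> \<partial>M)"
    by (intro Bochner_Integration.integral_cong refl) (simp add: mult.commute)
  also have "\<dots> = (\<integral>\<omega>. ?f' (X \<omega>) \<partial>M) - (\<integral>\<omega>. ?f (X \<omega>) * X \<omega> \<partial>M)"
    by (rule Bochner_Integration.integral_diff[OF int_f' ibp(2)])
  also have "\<dots> = (\<integral>\<omega>. ?f' (X \<omega>) \<partial>M) - (\<integral>\<omega>. ?f' (X \<omega>) * T \<omega> \<partial>M) / 2"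
    unfolding ibp(1) by simp
  also have "\<dots> = (\<integral>\<omega>. ?f' (X \<omega>) - (?f' (X \<omega>) * T \<omega>) / 2 \<partial>M)"
    by (subst Bochner_Integration.integral_diff[OF int_f' integrable_divide[OF ibp(3)]]) simp
  also have "\<dots> = (\<integral>\<omega>. ?f' (X \<omega>) * (2 - T \<omega>) / 2 \<partial>M)"
    by (intro Bochner_Integration.integral_cong refl) (simp add: field_simps)
  finally have "(\<integral>\<omega>. k (X \<omega>) \<partial>M) = (\<integral>\<omega>. ?f' (X \<omega>) * (2 - T \<omega>) / 2 \<partial>M)" .
  then have "\<bar>\<integral>\<omega>. k (X \<omega>) \<partial>M\<bar> \<le> (\<integral>\<omega>. \<bar>?f' (X \<omega>) * (2 - T \<omega>) / 2\<bar> \<partial>M)"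
    by (simp only: integral_abs_bound)
  also have "\<dots> \<le> (\<integral>\<omega>. C / 2 * \<bar>2 - T \<omega>\<bar> \<partial>M)"
  proof (rule integral_mono')
    show "integrable M (\<lambda>\<omega>. C / 2 * \<bar>2 - T \<omega>\<bar>)"
      by (intro integrable_mult_right integrable_abs Bochner_Integration.integrable_diff integrable_const
          integrable_T)
    show "\<bar>?f' (X \<omega>) * (2 - T \<omega>) / 2\<bar> \<le> C / 2 * \<bar>2 - T \<omega>\<bar>" for \<omega>
    proof -
      have "\<bar>x * y / 2\<bar> \<le> C / 2 * \<bar>y\<bar>" if "\<bar>x\<bar> \<le> C" for x y :: real
        using mult_right_mono[OF that abs_ge_zero[of y]] by (simp add: abs_mult)
      from this[OF C] show ?thesis .
    qed
    show "0 \<le> C / 2 * \<bar>2 - T \<omega>\<bar>" for \<omega>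
      by (intro mult_nonneg_nonneg divide_nonneg_nonneg order_trans[OF abs_ge_zero C]) simp_all
  qed
  finally show ?thesis by simp
qed

lemma lipschitz_le:
  assumes "1-lipschitz_on UNIV (h :: real \<Rightarrow> real)"
  shows "\<bar>h x - h y\<bar> \<le> \<bar>x - y\<bar>"
  using lipschitz_onD[OF assms, of x y] by (simp add: dist_real_def)

text \<open>Lipschitz test functions have linear growth, hence are integrable under both laws, and
  the Stein derivative bound 1 gives the factor 1/2.\<close>

theorem dist_W_le:
  assumes X0: "(\<integral>\<omega>. X \<omega> \<partial>M) = 0"
    and Q: "prob_space Q" and N: "distributed Q lborel N std_normal_density"
  shows "dist_W M X Q N \<le> L2norm M (\<lambda>\<omega>. 2 - T \<omega>) / 2"
  unfolding dist_W_def dist_class_def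
proof (rule SUP_least)
  fix h :: "real \<Rightarrow> real" assume "h \<in> {h. 1-lipschitz_on UNIV h}"
  then have lip: "\<bar>h x - h y\<bar> \<le> \<bar>x - y\<bar>" for x y by (simp add: lipschitz_le)
  have cont: "continuous_on UNIV h"
    using \<open>h \<in> _\<close> lipschitz_on_continuous_on by blast
  have [measurable]: "h \<in> borel_measurable borel" by (rule borel_measurable_continuous_onI[OF cont])
  have int: "integrable lborel (\<lambda>t. phi t * h t)"
  proof (rule Bochner_Integration.integrable_bound)
    show "integrable lborel (\<lambda>t. phi t * \<bar>h 0\<bar> + phi t * \<bar>t\<bar>)"
      using integrable_phi(1) integrable_std_normal_moment_abs[of 1] by simp
    show "AE t in lborel. norm (phi t * h t) \<le> norm (phi t * \<bar>h 0\<bar> + phi t * \<bar>t\<bar>)"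
    proof (rule AE_I2)
      fix t
      have "\<bar>h t\<bar> \<le> \<bar>h 0\<bar> + \<bar>t\<bar>" using lip[of t 0] by simp
      then have "phi t * \<bar>h t\<bar> \<le> phi t * (\<bar>h 0\<bar> + \<bar>t\<bar>)" using phi_pos[of t] by (intro mult_left_mono) auto
      then show "norm (phi t * h t) \<le> norm (phi t * \<bar>h 0\<bar> + phi t * \<bar>t\<bar>)"
        using phi_pos[of t] by (simp add: abs_mult distrib_left[symmetric] del: distrib_left)
    qed
  qed measurable
  let ?m = "\<integral>t. phi t * h t \<partial>lborel"
  have hN: "(LINT y|Q. h (N y)) = ?m"
    by (rule distributed_integral[OF N, symmetric]) auto
  have int_hX: "integrable M (\<lambda>\<omega>. h (X \<omega>))"
  proof (rule Bochner_Integration.integrable_bound)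
    show "integrable M (\<lambda>\<omega>. \<bar>h 0\<bar> + \<bar>X \<omega>\<bar>)" using integrable_X by simp
    show "AE \<omega> in M. norm (h (X \<omega>)) \<le> norm (\<bar>h 0\<bar> + \<bar>X \<omega>\<bar>)"
    proof (rule AE_I2)
      fix \<omega> show "norm (h (X \<omega>)) \<le> norm (\<bar>h 0\<bar> + \<bar>X \<omega>\<bar>)" using lip[of "X \<omega>" 0] by simp
    qed
  qed measurable
  have k: "stein_class (\<lambda>t. h t - ?m)" by (rule stein_class_centered[OF cont int])
  have "\<bar>(h x - ?m) + x * stein_sol (\<lambda>t. h t - ?m) x\<bar> \<le> 1" for x
    by (rule stein_sol_deriv_lipschitz[OF k]) (simp add: lip)
  from stein_normal[OF X0 k this]
  have "\<bar>(\<integral>\<omega>. h (X \<omega>) \<partial>M) - ?m\<bar> \<le> (\<integral>\<omega>. \<bar>2 - T \<omega>\<bar> \<partial>M) / 2"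
    using int_hX by (simp add: prob_space)
  then have "ennreal \<bar>(LINT \<omega>|M. h (X \<omega>)) - (LINT y|Q. h (N y))\<bar> \<le> ennreal ((\<integral>\<omega>. \<bar>2 - T \<omega>\<bar> \<partial>M) / 2)"
    unfolding hN by (rule ennreal_leI)
  also have "\<dots> = ennreal (\<integral>\<omega>. \<bar>2 - T \<omega>\<bar> \<partial>M) / 2"
    by (simp add: divide_ennreal[symmetric])
  also have "\<dots> \<le> L2norm M (\<lambda>\<omega>. 2 - T \<omega>) / 2"
    by (intro divide_right_mono_ennreal expectation_abs_le_L2norm) measurable
  finally show "ennreal \<bar>(LINT \<omega>|M. h (X \<omega>)) - (LINT y|Q. h (N y))\<bar> \<le> L2norm M (\<lambda>\<omega>. 2 - T \<omega>) / 2" .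
qed

text \<open>For continuous \<open>h\<close> with values in [0, 1] the Stein derivative bound is 2,
  hence the factor 1; \<open>tv_upper_bound\<close> is then used in both directions.\<close>

theorem dist_TV_le:
  assumes X0: "(\<integral>\<omega>. X \<omega> \<partial>M) = 0"
    and Q: "prob_space Q" and N: "distributed Q lborel N std_normal_density"
  shows "dist_TV M X Q N \<le> L2norm M (\<lambda>\<omega>. 2 - T \<omega>)"
  unfolding dist_TV_def
proof (rule SUP_least)
  interpret Q: prob_space Q by fact
  have N_meas [measurable]: "N \<in> borel_measurable Q"
    using distributed_measurable[OF N] by simp
  let ?PX = "distr M borel X" and ?PN = "distr Q borel N"
  let ?c = "\<integral>\<omega>. \<bar>2 - T \<omega>\<bar> \<partial>M"
  have key: "\<bar>(\<integral>x. h x \<partial>?PX) - (\<integral>x. h x \<partial>?PN)\<bar> \<le> ?c"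
    if cont: "continuous_on UNIV h" and h: "\<And>x. 0 \<le> h x" "\<And>x. h x \<le> 1" for h
  proof -
    have [measurable]: "h \<in> borel_measurable borel" by (rule borel_measurable_continuous_onI[OF cont])
    have int: "integrable lborel (\<lambda>t. phi t * h t)"
    proof (rule Bochner_Integration.integrable_bound[OF integrable_phi(1)])
      show "AE t in lborel. norm (phi t * h t) \<le> norm (phi t)"
        using h phi_pos by (intro AE_I2) (simp add: abs_mult mult_left_le less_imp_le)
    qed measurable
    let ?m = "\<integral>t. phi t * h t \<partial>lborel"
    have "0 \<le> ?m" by (intro Bochner_Integration.integral_nonneg mult_nonneg_nonneg h(1) less_imp_le[OF phi_pos])
    moreover have "?m \<le> 1"
    proof -
      have "?m \<le> (\<integral>t. phi t \<partial>lborel)"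
        using int integrable_phi(1) h phi_pos by (intro integral_mono) (auto intro!: mult_left_le less_imp_le)
      then show ?thesis by (simp only: integral_phi)
    qed
    \<comment> \<open>The values of \<open>h\<close> and its Gaussian mean lie in the same unit
      interval, so centring does not enlarge the bound.\<close>
    ultimately have bound: "\<bar>h x - ?m\<bar> \<le> 1" for x using h(1)[of x] h(2)[of x] by linarith
    have k: "stein_class (\<lambda>t. h t - ?m)" by (rule stein_class_centered[OF cont int])
    have "\<bar>(h x - ?m) + x * stein_sol (\<lambda>t. h t - ?m) x\<bar> \<le> 2" for x
      by (rule stein_sol_deriv_bounded[OF k bound])
    from stein_normal[OF X0 k this]
    have "\<bar>(\<integral>\<omega>. h (X \<omega>) - ?m \<partial>M)\<bar> \<le> ?c" by simp
    moreover have "integrable M (\<lambda>\<omega>. h (X \<omega>))"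
      using h by (intro integrable_const_bound[where B = 1]) auto
    ultimately have "\<bar>(\<integral>\<omega>. h (X \<omega>) \<partial>M) - ?m\<bar> \<le> ?c" by (simp add: prob_space)
    moreover have "(\<integral>x. h x \<partial>?PX) = (\<integral>\<omega>. h (X \<omega>) \<partial>M)"
      by (rule integral_distr) measurable
    moreover have "(\<integral>x. h x \<partial>?PN) = (\<integral>y. h (N y) \<partial>Q)"
      by (rule integral_distr) measurable
    moreover have "(\<integral>y. h (N y) \<partial>Q) = ?m"
      by (rule distributed_integral[OF N, symmetric]) auto
    ultimately show ?thesis by simp
  qed
  fix A :: "real set" assume A: "A \<in> sets borel"
  have "measure ?PX A - measure ?PN A \<le> ?c"
  proof (rule tv_upper_bound[OF _ _ _ _ _ A])
    show "(\<integral>x. h x \<partial>?PX) - (\<integral>x. h x \<partial>?PN) \<le> ?c"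
      if "continuous_on UNIV h" "\<And>x. 0 \<le> h x" "\<And>x. h x \<le> 1" for h
      using key[OF that] by linarith
  qed (auto intro: prob_space_distr Q.prob_space_distr)
  moreover have "measure ?PN A - measure ?PX A \<le> ?c"
  proof (rule tv_upper_bound[OF _ _ _ _ _ A])
    show "(\<integral>x. h x \<partial>?PN) - (\<integral>x. h x \<partial>?PX) \<le> ?c"
      if "continuous_on UNIV h" "\<And>x. 0 \<le> h x" "\<And>x. h x \<le> 1" for h
      using key[OF that] by linarith
  qed (auto intro: prob_space_distr Q.prob_space_distr)
  ultimately have "\<bar>measure ?PX A - measure ?PN A\<bar> \<le> ?c" by linarith
  moreover have "measure ?PX A = measure M {x \<in> space M. X x \<in> A}"
    using A by (subst measure_distr) (auto simp: vimage_def Int_def conj_commute)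
  moreover have "measure ?PN A = measure Q {y \<in> space Q. N y \<in> A}"
    using A by (subst measure_distr) (auto simp: vimage_def Int_def conj_commute)
  ultimately have "ennreal \<bar>measure M {x \<in> space M. X x \<in> A} - measure Q {y \<in> space Q. N y \<in> A}\<bar> \<le> ennreal ?c"
    by (simp add: ennreal_leI)
  also have "\<dots> \<le> L2norm M (\<lambda>\<omega>. 2 - T \<omega>)"
    by (rule expectation_abs_le_L2norm) measurable
  finally show "ennreal \<bar>measure M {x \<in> space M. X x \<in> A} - measure Q {y \<in> space Q. N y \<in> A}\<bar>
      \<le> L2norm M (\<lambda>\<omega>. 2 - T \<omega>)" .
qed

text \<open>By \<open>expectation_T\<close>, \<open>2 - T\<close> is the constant
  \<open>2 * (1 - E[X\<^sup>2])\<close> minus the centred \<open>T\<close>.\<close>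

lemma L2norm_2_minus_T:
  assumes X0: "(\<integral>\<omega>. X \<omega> \<partial>M) = 0"
  shows "L2norm M (\<lambda>\<omega>. 2 - T \<omega>)
    \<le> 2 * ennreal \<bar>1 - (\<integral>\<omega>. (X \<omega>)\<^sup>2 \<partial>M)\<bar> + L2norm M (\<lambda>\<omega>. T \<omega> - (\<integral>\<omega>. T \<omega> \<partial>M))"
proof -
  let ?v = "\<integral>\<omega>. (X \<omega>)\<^sup>2 \<partial>M"
  have "L2norm M (\<lambda>\<omega>. 2 - T \<omega>) = L2norm M (\<lambda>\<omega>. (2 * (1 - ?v)) + (- (T \<omega> - (\<integral>\<omega>. T \<omega> \<partial>M))))"
    by (simp add: expectation_T[OF X0] algebra_simps)
  also have "\<dots> \<le> L2norm M (\<lambda>_. 2 * (1 - ?v)) + L2norm M (\<lambda>\<omega>. - (T \<omega> - (\<integral>\<omega>. T \<omega> \<partial>M)))"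
    by (rule L2norm_triangle) measurable
  also have "\<dots> = ennreal \<bar>2 * (1 - ?v)\<bar> + L2norm M (\<lambda>\<omega>. T \<omega> - (\<integral>\<omega>. T \<omega> \<partial>M))"
    by (simp only: L2norm_const L2norm_minus)
  also have "ennreal \<bar>2 * (1 - ?v)\<bar> = 2 * ennreal \<bar>1 - ?v\<bar>"
    by (subst abs_mult) (simp add: ennreal_mult)
  finally show ?thesis .
qed

lemma L2norm_half_2_minus_T:
  assumes X0: "(\<integral>\<omega>. X \<omega> \<partial>M) = 0"
  shows "L2norm M (\<lambda>\<omega>. 2 - T \<omega>) / 2
    \<le> ennreal \<bar>1 - (\<integral>\<omega>. (X \<omega>)\<^sup>2 \<partial>M)\<bar> + L2norm M (\<lambda>\<omega>. T \<omega> - (\<integral>\<omega>. T \<omega> \<partial>M)) / 2"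
proof -
  have "2 * ennreal x / 2 = ennreal x" for x
  proof -
    have "2 * ennreal x / 2 = ennreal x * 2 / 2" by (simp only: mult.commute)
    also have "\<dots> = ennreal x" by (rule ennreal_mult_divide_eq) simp_all
    finally show ?thesis .
  qed
  then show ?thesis
    using divide_right_mono_ennreal[OF L2norm_2_minus_T[OF X0], of 2]
    by (simp add: add_divide_distrib_ennreal)
qed

text \<open>Here \<open>T / 2\<close> has mean \<open>E[X\<^sup>2]\<close>, the squared norm of
  \<open>X\<close>; the factor 1/2 left on the centred part is estimated by 1.\<close>

lemma L2norm_gamma:
  assumes X0: "(\<integral>\<omega>. X \<omega> \<partial>M) = 0"
  shows "L2norm M (\<lambda>\<omega>. 2 * (X \<omega> + \<nu>) - T \<omega> / 2)
    \<le> L2norm M (\<lambda>\<omega>. 2 * (X \<omega> + \<nu>) - (enn2real (L2norm M X))\<^sup>2) + L2norm M (\<lambda>\<omega>. T \<omega> - (\<integral>\<omega>. T \<omega> \<partial>M))"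
proof -
  let ?v = "\<integral>\<omega>. (X \<omega>)\<^sup>2 \<partial>M"
  have v: "(enn2real (L2norm M X))\<^sup>2 = ?v"
    by (simp add: L2norm_eq[OF sqint_X])
  have "L2norm M (\<lambda>\<omega>. 2 * (X \<omega> + \<nu>) - T \<omega> / 2)
      = L2norm M (\<lambda>\<omega>. (2 * (X \<omega> + \<nu>) - ?v) + (- (T \<omega> - (\<integral>\<omega>. T \<omega> \<partial>M)) / 2))"
    by (simp add: expectation_T[OF X0] field_simps)
  also have "\<dots> \<le> L2norm M (\<lambda>\<omega>. 2 * (X \<omega> + \<nu>) - ?v) + L2norm M (\<lambda>\<omega>. - (T \<omega> - (\<integral>\<omega>. T \<omega> \<partial>M)) / 2)"
    by (rule L2norm_triangle) measurable
  also have "\<dots> \<le> L2norm M (\<lambda>\<omega>. 2 * (X \<omega> + \<nu>) - ?v) + L2norm M (\<lambda>\<omega>. T \<omega> - (\<integral>\<omega>. T \<omega> \<partial>M))"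
  proof (intro add_left_mono L2norm_mono)
    have "\<bar>- y / 2\<bar> \<le> \<bar>y\<bar>" for y :: real by simp
    then show "\<bar>- (T \<omega> - (\<integral>\<omega>. T \<omega> \<partial>M)) / 2\<bar> \<le> \<bar>T \<omega> - (\<integral>\<omega>. T \<omega> \<partial>M)\<bar>" for \<omega> .
  qed measurable
  finally show ?thesis by (simp only: v)
qed

end

context malliavin_setup
begin

text \<open>The substitution \<open>w = (x + \<nu>) / 2\<close> carries the Stein equation of the
  gamma law with parameter \<open>\<nu> / 2\<close> to
  \<open>2 * (x + \<nu>) * f' x - x * f x = h x - E\<close> on the support of the centred
  law.\<close>

theorem dist_C2_le:
  assumes X0: "(\<integral>\<omega>. X \<omega> \<partial>M) = 0" and nu: "0 < \<nu>" and X_gt: "AE \<omega> in M. - \<nu> < X \<omega>"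
    and R: "prob_space R" and G: "distributed R lborel G (gamma_density (\<nu> / 2))"
  shows "dist_C2 M X R (\<lambda>\<omega>. 2 * G \<omega> - \<nu>) \<le> L2norm M (\<lambda>\<omega>. 2 * (X \<omega> + \<nu>) - T \<omega> / 2)"
  unfolding dist_C2_def dist_class_def
proof (rule SUP_least)
  interpret R: prob_space R by fact
  define a where "a = \<nu> / 2"
  have a: "0 < a" using nu by (simp add: a_def)
  have G': "distributed R lborel G (gamma_density a)" using G by (simp add: a_def)
  have p_nonneg: "0 \<le> gamma_density a w" for w
    using a by (simp add: gamma_density_def Gamma_real_pos less_imp_le)
  \<comment> \<open>Integrability and total mass are read off from the existence of \<open>G\<close>
    on a probability space instead of evaluating the gamma integral.\<close>
  have int_p: "integrable lborel (gamma_density a)"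
    using distributed_integrable[OF G', of "\<lambda>_. 1 :: real"] p_nonneg by simp
  have mass: "(\<integral>w. gamma_density a w \<partial>lborel) = 1"
    using distributed_integral[OF G', of "\<lambda>_. 1 :: real"] p_nonneg by (simp add: R.prob_space)
  fix h :: "real \<Rightarrow> real" assume "h \<in> C2b_unit"
  then obtain h' h'' where h1: "\<And>x. (h has_real_derivative h' x) (at x)"
    and h2: "\<And>x. (h' has_real_derivative h'' x) (at x)"
    and hb: "\<And>x. \<bar>h x\<bar> \<le> 1" "\<And>x. \<bar>h'' x\<bar> \<le> 1"
    unfolding C2b_unit_def by blast
  have cont_h: "continuous_on UNIV h"
    using h1 by (meson DERIV_continuous continuous_at_imp_continuous_on)
  have [measurable]: "h \<in> borel_measurable borel" by (rule borel_measurable_continuous_onI[OF cont_h])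
  define E where "E = (\<integral>w. gamma_density a w * h (2 * w - \<nu>) \<partial>lborel)"
  have E_G: "(LINT y|R. h (2 * G y - \<nu>)) = E"
    unfolding E_def by (rule distributed_integral[OF G', symmetric]) (auto simp: p_nonneg)
  have int_ph: "integrable lborel (\<lambda>w. gamma_density a w * h (2 * w - \<nu>))"
  proof (rule Bochner_Integration.integrable_bound[OF int_p])
    show "AE w in lborel. norm (gamma_density a w * h (2 * w - \<nu>)) \<le> norm (gamma_density a w)"
      using hb(1) p_nonneg by (intro AE_I2) (simp add: abs_mult mult_left_le)
  qed (use borel_measurable_integrable[OF int_p] in measurable)
  have E_bound: "\<bar>E\<bar> \<le> 1"
  proof -
    have "\<bar>E\<bar> \<le> (\<integral>w. \<bar>gamma_density a w * h (2 * w - \<nu>)\<bar> \<partial>lborel)"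
      unfolding E_def by (rule integral_abs_bound)
    also have "\<dots> \<le> (\<integral>w. gamma_density a w \<partial>lborel)"
    proof (rule integral_mono[OF integrable_abs[OF int_ph] int_p])
      show "\<bar>gamma_density a w * h (2 * w - \<nu>)\<bar> \<le> gamma_density a w" for w
        using hb(1) p_nonneg by (simp add: abs_mult mult_left_le)
    qed
    finally show ?thesis by (simp add: mass)
  qed
  define k where "k w = h (2 * w - \<nu>) - E" for w
  \<comment> \<open>Both \<open>h\<close> and its mean \<open>E\<close> are bounded by 1, whence 2;
    the inner factor 2 of \<open>h (2 * w - \<nu>)\<close>, differentiated twice, gives 4.\<close>
  interpret gs: gamma_stein a 2 4 k "\<lambda>w. 2 * h' (2 * w - \<nu>)" "\<lambda>w. 4 * h'' (2 * w - \<nu>)"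
  proof
    show "(k has_real_derivative 2 * h' (2 * w - \<nu>)) (at w)" for w
      unfolding k_def[abs_def]
      by (auto intro!: derivative_eq_intros DERIV_chain2[OF h1])
    show "((\<lambda>w. 2 * h' (2 * w - \<nu>)) has_real_derivative 4 * h'' (2 * w - \<nu>)) (at w)" for w
      by (auto intro!: derivative_eq_intros DERIV_chain2[OF h2])
    show "\<bar>k w\<bar> \<le> 2" for w using hb(1)[of "2 * w - \<nu>"] E_bound by (simp add: k_def)
    show "\<bar>4 * h'' (2 * w - \<nu>)\<bar> \<le> 4" for w using hb(2)[of "2 * w - \<nu>"] by (simp add: abs_mult)
    have "(\<integral>w. gamma_density a w * k w \<partial>lborel)
        = (\<integral>w. gamma_density a w * h (2 * w - \<nu>) - E * gamma_density a w \<partial>lborel)"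
      by (intro Bochner_Integration.integral_cong refl) (simp add: k_def algebra_simps)
    then show "(\<integral>w. gamma_density a w * k w \<partial>lborel) = 0"
      using int_ph int_p by (simp add: mass E_def)
  qed (fact a int_p mass)+
  \<comment> \<open>The division by 2 normalises the coefficients; with the chain rule
    \<open>f'\<close> becomes \<open>gs.u / 4\<close>, and \<open>\<bar>gs.u\<bar> \<le> 2\<close>
    yields the bound 1/2.\<close>
  define f where "f x = gs.G ((x + \<nu>) / 2) / 2" for x
  define f' where "f' x = gs.u ((x + \<nu>) / 2) / 4" for x
  have f_deriv: "(f has_real_derivative f' x) (at x)" if "- \<nu> < x" for x
  proof -
    have "((\<lambda>x. gs.G ((x + \<nu>) / 2)) has_real_derivative gs.u ((x + \<nu>) / 2) * (1 / 2)) (at x)"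
      by (rule DERIV_chain2[OF gs.G_deriv]) (use that in \<open>auto intro!: derivative_eq_intros\<close>)
    from DERIV_cdivide[OF this, of 2] show ?thesis unfolding f_def[abs_def] f'_def by simp
  qed
  have f'_bound: "\<bar>f' x\<bar> \<le> 1 / 2" if "- \<nu> < x" for x
    using gs.abs_u_le[of "(x + \<nu>) / 2"] that by (simp add: f'_def)
  have f'_cont: "isCont f' x" if "- \<nu> < x" for x
  proof -
    have "isCont gs.u ((x + \<nu>) / 2)"
      by (rule DERIV_isCont[OF gs.u_deriv]) (use that in simp)
    then show ?thesis
      unfolding f'_def[abs_def] by (intro continuous_intros isCont_o2[of x "\<lambda>x. (x + \<nu>) / 2"]) auto
  qed
  have stein: "2 * (x + \<nu>) * f' x - x * f x = h x - E" if "- \<nu> < x" for x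
  proof -
    have "2 * ((x + \<nu>) / 2) - \<nu> = x" by (simp add: field_simps)
    then have "h x - E = (x + \<nu>) / 2 * gs.u ((x + \<nu>) / 2) + (a - (x + \<nu>) / 2) * gs.G ((x + \<nu>) / 2)"
      using gs.G_eq[of "(x + \<nu>) / 2"] that by (simp add: k_def)
    then show ?thesis by (simp add: f_def f'_def a_def field_simps)
  qed
  \<comment> \<open>\<open>f\<close> solves the Stein equation only on \<open>(-\<nu>, \<infinity>)\<close>; it is continued linearly to the left
    of \<open>c n\<close>, and \<open>c n\<close> tends to \<open>-\<nu>\<close>.\<close>
  define c where "c n = - \<nu> + \<nu> / real (n + 2)" for n :: nat
  have c: "- \<nu> < c n" "c n < 0" for n
  proof -
    have "\<nu> / real (n + 2) < \<nu> / 1"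
      using nu by (intro divide_strict_left_mono) auto
    then show "- \<nu> < c n" "c n < 0" using nu by (simp_all add: c_def)
  qed
  have c_lim: "c \<longlonglongrightarrow> - \<nu>"
  proof -
    have "(\<lambda>n. - \<nu> + \<nu> / real (n + 2)) \<longlonglongrightarrow> - \<nu> + 0"
      by (intro tendsto_intros LIMSEQ_ignore_initial_segment[OF lim_const_over_n])
    then show ?thesis by (simp add: c_def[abs_def])
  qed
  define g where "g n x = (if c n \<le> x then f x else f (c n) + f' (c n) * (x - c n))" for n x
  define g' where "g' n x = f' (max x (c n))" for n x
  have g_deriv: "(g n has_real_derivative g' n x) (at x)" for n x
    unfolding g_def[abs_def] g'_def
    by (rule DERIV_linear_continuation) (use c[of n] in \<open>auto intro: f_deriv\<close>)
  have g'_cont: "continuous_on UNIV (g' n)" for n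
  proof -
    have "isCont (g' n) x" for x
      unfolding g'_def[abs_def]
      by (rule isCont_o2[where g = f']) (use c[of n] in \<open>auto intro!: continuous_intros f'_cont\<close>)
    then show ?thesis by (simp add: continuous_at_imp_continuous_on)
  qed
  have g'_bound: "\<bar>g' n x\<bar> \<le> 1 / 2" for n x
    unfolding g'_def by (rule f'_bound) (use c[of n] in auto)
  note ibp = integration_by_parts[OF X0 g_deriv g'_cont g'_bound]
  have g_meas [measurable]: "g n \<in> borel_measurable borel" "g' n \<in> borel_measurable borel" for n
    using g_deriv g'_cont[of n]
    by (auto intro!: borel_measurable_continuous_onI continuous_at_imp_continuous_on DERIV_isCont)
  \<comment> \<open>Because \<open>c n < 0\<close>, every \<open>g n\<close> coincides with
    \<open>f\<close> at 0; with the common Lipschitz bound this gives a majorant independent of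
    \<open>n\<close>.\<close>
  have g_bound: "\<bar>g n x\<bar> \<le> \<bar>f 0\<bar> + \<bar>x\<bar>" for n x
  proof -
    have "\<bar>g n x - g n 0\<bar> \<le> 1 / 2 * \<bar>x - 0\<bar>"
      using field_differentiable_bound[of UNIV "g n" "g' n" "1 / 2" x 0] g_deriv g'_bound by auto
    also have "\<dots> \<le> \<bar>x\<bar>" by simp
    finally have "\<bar>g n x\<bar> - \<bar>g n 0\<bar> \<le> \<bar>x\<bar>"
      using abs_triangle_ineq2[of "g n x" "g n 0"] by linarith
    moreover have "g n 0 = f 0" using c(2)[of n] by (simp add: g_def)
    ultimately show ?thesis by simp
  qed
  let ?D = "\<integral>\<omega>. \<bar>2 * (X \<omega> + \<nu>) - T \<omega> / 2\<bar> \<partial>M"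
  \<comment> \<open>The Stein operator applied to \<open>g n\<close> at \<open>X\<close>; it equals
    \<open>h (X) - E\<close> once \<open>c n\<close> is below \<open>X\<close>.\<close>
  let ?d = "\<lambda>n \<omega>. 2 * (X \<omega> + \<nu>) * g' n (X \<omega>) - g n (X \<omega>) * X \<omega>"
  have int1: "integrable M (\<lambda>\<omega>. 2 * (X \<omega> + \<nu>) * g' n (X \<omega>))" for n
    by (rule integrable_bounded_mult[where B = "1 / 2"]) (use integrable_X g'_bound in auto)
  \<comment> \<open>Integration by parts holds for each \<open>g n\<close>, and the derivative bound
    1/2 is uniform, so the estimate survives the limit.\<close>
  have d_bound: "\<bar>\<integral>\<omega>. ?d n \<omega> \<partial>M\<bar> \<le> ?D" for n
  proof -
    have "(\<integral>\<omega>. ?d n \<omega> \<partial>M) = (\<integral>\<omega>. 2 * (X \<omega> + \<nu>) * g' n (X \<omega>) \<partial>M) - (\<integral>\<omega>. g' n (X \<omega>) * T \<omega> \<partial>M) / 2"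
      unfolding Bochner_Integration.integral_diff[OF int1 ibp(2)] ibp(1) by simp
    also have "\<dots> = (\<integral>\<omega>. 2 * (X \<omega> + \<nu>) * g' n (X \<omega>) - g' n (X \<omega>) * T \<omega> / 2 \<partial>M)"
      by (subst Bochner_Integration.integral_diff[OF int1 integrable_divide[OF ibp(3)]]) simp
    also have "\<dots> = (\<integral>\<omega>. g' n (X \<omega>) * (2 * (X \<omega> + \<nu>) - T \<omega> / 2) \<partial>M)"
      by (intro Bochner_Integration.integral_cong refl) (simp add: algebra_simps)
    finally have "(\<integral>\<omega>. ?d n \<omega> \<partial>M) = (\<integral>\<omega>. g' n (X \<omega>) * (2 * (X \<omega> + \<nu>) - T \<omega> / 2) \<partial>M)" .
    then have "\<bar>\<integral>\<omega>. ?d n \<omega> \<partial>M\<bar> \<le> (\<integral>\<omega>. \<bar>g' n (X \<omega>) * (2 * (X \<omega> + \<nu>) - T \<omega> / 2)\<bar> \<partial>M)"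
      by (simp only: integral_abs_bound)
    also have "\<dots> \<le> ?D"
    proof (rule integral_mono')
      show "integrable M (\<lambda>\<omega>. \<bar>2 * (X \<omega> + \<nu>) - T \<omega> / 2\<bar>)"
        using integrable_X integrable_T by simp
      show "\<bar>g' n (X \<omega>) * (2 * (X \<omega> + \<nu>) - T \<omega> / 2)\<bar> \<le> \<bar>2 * (X \<omega> + \<nu>) - T \<omega> / 2\<bar>" for \<omega>
        unfolding abs_mult by (rule mult_left_le_one_le) (use g'_bound[of n "X \<omega>"] in auto)
    qed simp
    finally show ?thesis .
  qed
  have "(\<lambda>n. \<integral>\<omega>. ?d n \<omega> \<partial>M) \<longlonglongrightarrow> (\<integral>\<omega>. h (X \<omega>) - E \<partial>M)"
  proof (rule integral_dominated_convergence[where w = "\<lambda>\<omega>. \<bar>X \<omega> + \<nu>\<bar> + (\<bar>f 0\<bar> * \<bar>X \<omega>\<bar> + (X \<omega>)\<^sup>2)"])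
    show "integrable M (\<lambda>\<omega>. \<bar>X \<omega> + \<nu>\<bar> + (\<bar>f 0\<bar> * \<bar>X \<omega>\<bar> + (X \<omega>)\<^sup>2))"
      using integrable_X sqint_X by (simp add: sqint_def)
    show "AE \<omega> in M. (\<lambda>n. ?d n \<omega>) \<longlonglongrightarrow> h (X \<omega>) - E"
      using X_gt
    proof eventually_elim
      case (elim \<omega>)
      \<comment> \<open>As \<open>X\<close> exceeds \<open>-\<nu>\<close> strictly, almost every
        point eventually leaves the region of linear continuation, and the sequence becomes constant
        there.\<close>
      have "\<forall>\<^sub>F n in sequentially. c n < X \<omega>" by (rule order_tendstoD(2)[OF c_lim elim])
      then have "\<forall>\<^sub>F n in sequentially. ?d n \<omega> = h (X \<omega>) - E"
      proof eventually_elim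
        case (elim n)
        then have "g n (X \<omega>) = f (X \<omega>)" "g' n (X \<omega>) = f' (X \<omega>)" by (auto simp: g_def g'_def)
        then show ?case using stein[OF \<open>- \<nu> < X \<omega>\<close>] by (simp add: mult.commute)
      qed
      then show ?case by (rule tendsto_eventually)
    qed
    show "AE \<omega> in M. norm (?d n \<omega>) \<le> \<bar>X \<omega> + \<nu>\<bar> + (\<bar>f 0\<bar> * \<bar>X \<omega>\<bar> + (X \<omega>)\<^sup>2)" for n
    proof (rule AE_I2)
      fix \<omega>
      have "\<bar>2 * (X \<omega> + \<nu>) * g' n (X \<omega>)\<bar> \<le> \<bar>2 * (X \<omega> + \<nu>)\<bar> * (1 / 2)"
        unfolding abs_mult[of "2 * (X \<omega> + \<nu>)"] by (rule mult_left_mono[OF g'_bound]) simp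
      moreover have "\<bar>g n (X \<omega>) * X \<omega>\<bar> \<le> (\<bar>f 0\<bar> + \<bar>X \<omega>\<bar>) * \<bar>X \<omega>\<bar>"
        unfolding abs_mult by (rule mult_right_mono[OF g_bound]) simp
      moreover have "(\<bar>f 0\<bar> + \<bar>X \<omega>\<bar>) * \<bar>X \<omega>\<bar> = \<bar>f 0\<bar> * \<bar>X \<omega>\<bar> + (X \<omega>)\<^sup>2"
        by (simp add: power2_eq_square algebra_simps)
      moreover have "\<bar>2 * (X \<omega> + \<nu>)\<bar> * (1 / 2) = \<bar>X \<omega> + \<nu>\<bar>"
        by (simp only: abs_mult) simp
      ultimately show "norm (?d n \<omega>) \<le> \<bar>X \<omega> + \<nu>\<bar> + (\<bar>f 0\<bar> * \<bar>X \<omega>\<bar> + (X \<omega>)\<^sup>2)"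
        using abs_triangle_ineq4[of "2 * (X \<omega> + \<nu>) * g' n (X \<omega>)" "g n (X \<omega>) * X \<omega>"]
        unfolding real_norm_def by linarith
    qed
  qed measurable
  from tendsto_rabs[OF this] have "\<bar>\<integral>\<omega>. h (X \<omega>) - E \<partial>M\<bar> \<le> ?D"
    by (rule LIMSEQ_le_const2) (use d_bound in blast)
  moreover have "integrable M (\<lambda>\<omega>. h (X \<omega>))"
    using hb(1) by (intro integrable_const_bound[where B = 1]) auto
  ultimately have "\<bar>(\<integral>\<omega>. h (X \<omega>) \<partial>M) - E\<bar> \<le> ?D" by (simp add: prob_space)
  then have "ennreal \<bar>(LINT \<omega>|M. h (X \<omega>)) - (LINT y|R. h (2 * G y - \<nu>))\<bar> \<le> ennreal ?D"
    unfolding E_G by (rule ennreal_leI)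
  also have "\<dots> \<le> L2norm M (\<lambda>\<omega>. 2 * (X \<omega> + \<nu>) - T \<omega> / 2)"
    by (rule expectation_abs_le_L2norm) measurable
  finally show "ennreal \<bar>(LINT \<omega>|M. h (X \<omega>)) - (LINT y|R. h (2 * G y - \<nu>))\<bar>
      \<le> L2norm M (\<lambda>\<omega>. 2 * (X \<omega> + \<nu>) - T \<omega> / 2)" .
qed

end

theorem proposition3p2:
  fixes M :: "'a measure" and U :: "nat \<Rightarrow> 'a \<Rightarrow> real"
    and X :: "'a \<Rightarrow> real" and DX Z :: "real \<Rightarrow> 'a \<Rightarrow> real" and T :: "'a \<Rightarrow> real"
    and Q :: "'b measure" and N :: "'b \<Rightarrow> real"
    and R :: "'c measure"
  assumes "prob_space M"
    and "prob_space.indep_vars M (\<lambda>_. borel) U UNIV"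
    and "\<And>k. distr M borel (U k) = uniform_measure lborel {-1..1}"
    and "closed_gradient M U X DX"
    and "(LINT \<omega>|M. X \<omega>) = 0"
    and "cond_gradient M U DX Z"
    and "T = T_functional DX Z"
    and "prob_space Q" and "distributed Q lborel N std_normal_density"
    and "prob_space R"
  shows "dist_W M X Q N \<le> L2norm M (\<lambda>\<omega>. 2 - T \<omega>) / 2
    \<and> L2norm M (\<lambda>\<omega>. 2 - T \<omega>) / 2
        \<le> ennreal \<bar>1 - (LINT \<omega>|M. (X \<omega>)\<^sup>2)\<bar>
          + L2norm M (\<lambda>\<omega>. T \<omega> - (LINT \<omega>|M. T \<omega>)) / 2
    \<and> dist_TV M X Q N \<le> L2norm M (\<lambda>\<omega>. 2 - T \<omega>)
    \<and> L2norm M (\<lambda>\<omega>. 2 - T \<omega>)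
        \<le> 2 * ennreal \<bar>1 - (LINT \<omega>|M. (X \<omega>)\<^sup>2)\<bar>
          + L2norm M (\<lambda>\<omega>. T \<omega> - (LINT \<omega>|M. T \<omega>))
    \<and> (\<forall>\<nu>>0. (AE \<omega> in M. X \<omega> > - \<nu>) \<longrightarrow>
        (\<forall>G. distributed R lborel G (gamma_density (\<nu> / 2)) \<longrightarrow>
            dist_C2 M X R (\<lambda>\<omega>. 2 * G \<omega> - \<nu>)
              \<le> L2norm M (\<lambda>\<omega>. 2 * (X \<omega> + \<nu>) - T \<omega> / 2))
        \<and> L2norm M (\<lambda>\<omega>. 2 * (X \<omega> + \<nu>) - T \<omega> / 2)
            \<le> L2norm M (\<lambda>\<omega>. 2 * (X \<omega> + \<nu>) - (enn2real (L2norm M X))\<^sup>2)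
              + L2norm M (\<lambda>\<omega>. T \<omega> - (LINT \<omega>|M. T \<omega>)))"
proof -
  interpret prob_space M by fact
  interpret malliavin_setup M U X DX Z
    by unfold_locales (fact assms)+
  note X0 = assms(5)
  show ?thesis
    unfolding assms(7)
    using dist_W_le[OF X0 assms(8,9)] L2norm_half_2_minus_T[OF X0] dist_TV_le[OF X0 assms(8,9)]
      L2norm_2_minus_T[OF X0] dist_C2_le[OF X0 _ _ assms(10)] L2norm_gamma[OF X0]
    by simp
qed

end
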